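(* Let $\mathcal{C}$ be a category that has finite limits, and let $N, M$ be classes of morphisms in $\mathcal{C}$. Then: (1) ${}^{\perp}R(Sp^{\cong}(M)) = {}^{\perp}Sp^{\cong}(M) = {}^{\perp}M$, where all three left orthogonal classes, and the retract closure $R$, are taken in $\mathrm{Pro}(\mathcal{C})$ (morphisms of $\mathcal{C}$ being regarded as morphisms between simple pro-objects). (2) If $\mathrm{Mor}(\mathcal{C}) = M\circ N$, then $\mathrm{Mor}(\mathrm{Pro}(\mathcal{C})) = Sp^{\cong}(M)\circ Lw^{\cong}(N)$. (3) If $\mathrm{Mor}(\mathcal{C}) = M\circ N$ and $N\perp M$ (in particular, if $(N,M)$ is a weak factorization system in $\mathcal{C}$), then $(Lw^{\cong}(N), R(Sp^{\cong}(M)))$ is a weak factorization system in $\mathrm{Pro}(\mathcal{C})$.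
   Context: Directed categories and posets. A category $I$ is directed (cofiltered) if it is nonempty; for all objects $s,t$ there is an object $u$ with morphisms $u\to s$, $u\to t$; and for all parallel $f,g:s\to t$ there is $h:u\to s$ with $fh=gh$. A poset $T$ is viewed as a category with a single morphism $u\to v$ iff $u\ge v$. A poset $T$ is cofinite if $\{z\in T : z\le x\}$ is finite for every $x\in T$. Pro-categories. $\mathrm{Pro}(\mathcal{C})$ has as objects the diagrams $I\to\mathcal{C}$ with $I$ small and directed, and $\mathrm{Hom}_{\mathrm{Pro}(\mathcal{C})}(X,Y)=\lim_s\operatorname{colim}_t\mathrm{Hom}_{\mathcal{C}}(X_t,Y_s)$. $\mathcal{C}$ is identified with the full subcategory of simple objects (those indexed by the one-object, one-morphism category). A natural transformation between two diagrams with the same small directed indexing category induces a morphism in $\mathrm{Pro}(\mathcal{C})$. Classes of morphisms. For a class $M$ of morphisms in a category: $R(M)$ is the class of retracts (in the arrow category) of morphisms in $M$; ${}^{\perp}M$ (resp. $M^{\perp}$) is the class of morphisms having the left (resp. right) lifting property with respect to all morphisms in $M$; $N\perp M$ means every morphism in $N$ has the left lifting property with respect to every morphism in $M$. $\mathrm{Mor}(\mathcal{D})=M\circ N$ means every morphism of $\mathcal{D}$ factors as a morphism in $N$ followed by a morphism in $M$. $(N,M)$ is a weak factorization system in $\mathcal{D}$ if $\mathrm{Mor}(\mathcal{D})=M\circ N$, $N={}^{\perp}M$ and $N^{\perp}=M$. Let $\mathcal{C}$ have finite limits and let $M$ be a class of morphisms of $\mathcal{C}$. A natural transformation $X\to Y$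 of diagrams $I\to\mathcal{C}$ is a levelwise $M$-map if $X_i\to Y_i$ is in $M$ for all $i\in I$. If $I=T$ is a cofinite poset, it is a special $M$-map if for every $t\in T$ the natural map $X_t\to Y_t\times_{\lim_{s<t}Y_s}\lim_{s<t}X_s$ is in $M$. $Lw^{\cong}(M)$ (resp. $Sp^{\cong}(M)$) is the class of morphisms in $\mathrm{Pro}(\mathcal{C})$ that are isomorphic (in the arrow category of $\mathrm{Pro}(\mathcal{C})$) to a morphism induced by a natural transformation, between diagrams with the same small directed indexing category, which is a levelwise $M$-map (resp. a special $M$-map, the indexing category then being a small cofinite directed poset). *)

theory Defs
  imports Main
begin

section \<open>Categories\<close>

text \<open>
  Only the values of the operations on the carriers \<open>Obj\<close> and \<open>Arr\<close> are meaningful; the laws below say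
  nothing about values outside. \<open>g \<cdot>\<^bsub>C\<^esub> f\<close> is composition in the usual order (first \<open>f\<close>, then \<open>g\<close>).
  A class of morphisms of \<open>C\<close> is a subset of \<open>Arr C\<close>.
\<close>

record ('o, 'a) cat =
  Obj :: "'o set"
  Arr :: "'a set"
  Dom :: "'a \<Rightarrow> 'o"
  Cod :: "'a \<Rightarrow> 'o"
  Idn :: "'o \<Rightarrow> 'a"
  Comp :: "'a \<Rightarrow> 'a \<Rightarrow> 'a"  (infixl "\<cdot>\<index>" 70)

definition hom :: "('o, 'a) cat \<Rightarrow> 'o \<Rightarrow> 'o \<Rightarrow> 'a set" where
  "hom C x y = {f \<in> Arr C. Dom C f = x \<and> Cod C f = y}"

locale category =
  fixes C :: "('o, 'a) cat" (structure)
  assumes Dom_in: "f \<in> Arr C \<Longrightarrow> Dom C f \<in> Obj C"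
    and Cod_in: "f \<in> Arr C \<Longrightarrow> Cod C f \<in> Obj C"
    and Idn_in: "x \<in> Obj C \<Longrightarrow> Idn C x \<in> hom C x x"
    and Comp_in: "\<lbrakk>f \<in> hom C x y; g \<in> hom C y z\<rbrakk> \<Longrightarrow> g \<cdot> f \<in> hom C x z"
    and Comp_Idn: "f \<in> hom C x y \<Longrightarrow> f \<cdot> Idn C x = f"
    and Idn_Comp: "f \<in> hom C x y \<Longrightarrow> Idn C y \<cdot> f = f"
    and Comp_assoc: "\<lbrakk>f \<in> hom C w x; g \<in> hom C x y; h \<in> hom C y z\<rbrakk> \<Longrightarrow> (h \<cdot> g) \<cdot> f = h \<cdot> (g \<cdot> f)"

definition full_subcat :: "('o, 'a) cat \<Rightarrow> 'o set \<Rightarrow> ('o, 'a) cat" where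
  "full_subcat C S = C\<lparr>Obj := S, Arr := {f \<in> Arr C. Dom C f \<in> S \<and> Cod C f \<in> S}\<rparr>"

definition isomorphic :: "('o, 'a) cat \<Rightarrow> 'o \<Rightarrow> 'o \<Rightarrow> bool" where
  "isomorphic C x y \<longleftrightarrow>
     (\<exists>f \<in> hom C x y. \<exists>g \<in> hom C y x. g \<cdot>\<^bsub>C\<^esub> f = Idn C x \<and> f \<cdot>\<^bsub>C\<^esub> g = Idn C y)"

definition retract_of :: "('o, 'a) cat \<Rightarrow> 'o \<Rightarrow> 'o \<Rightarrow> bool" where
  "retract_of C x y \<longleftrightarrow> (\<exists>s \<in> hom C x y. \<exists>r \<in> hom C y x. r \<cdot>\<^bsub>C\<^esub> s = Idn C x)"

text \<open>An arrow from \<open>f\<close> to \<open>g\<close> in the arrow category is recorded as \<open>(f, g, u, v)\<close>, with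
  \<open>u\<close> between the domains and \<open>v\<close> between the codomains.\<close>

definition arrow_cat :: "('o, 'a) cat \<Rightarrow> ('a, 'a \<times> 'a \<times> 'a \<times> 'a) cat" where
  "arrow_cat C = \<lparr>
     Obj = Arr C,
     Arr = {(f, g, u, v). f \<in> Arr C \<and> g \<in> Arr C \<and> u \<in> hom C (Dom C f) (Dom C g)
              \<and> v \<in> hom C (Cod C f) (Cod C g) \<and> v \<cdot>\<^bsub>C\<^esub> f = g \<cdot>\<^bsub>C\<^esub> u},
     Dom = (\<lambda>(f, g, u, v). f),
     Cod = (\<lambda>(f, g, u, v). g),
     Idn = (\<lambda>f. (f, f, Idn C (Dom C f), Idn C (Cod C f))),
     Comp = (\<lambda>(f', g', u', v') (f, g, u, v). (f, g', u' \<cdot>\<^bsub>C\<^esub> u, v' \<cdot>\<^bsub>C\<^esub> v))\<rparr>"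


section \<open>Classes of morphisms\<close>

definition retracts :: "('o, 'a) cat \<Rightarrow> 'a set \<Rightarrow> 'a set" where
  "retracts C M = {f \<in> Arr C. \<exists>g \<in> M. retract_of (arrow_cat C) f g}"

definition iso_closure :: "('o, 'a) cat \<Rightarrow> 'a set \<Rightarrow> 'a set" where
  "iso_closure C M = {f \<in> Arr C. \<exists>g \<in> M. isomorphic (arrow_cat C) f g}"

definition lifts :: "('o, 'a) cat \<Rightarrow> 'a \<Rightarrow> 'a \<Rightarrow> bool" where
  "lifts C i p \<longleftrightarrow>
     (\<forall>u \<in> hom C (Dom C i) (Dom C p). \<forall>v \<in> hom C (Cod C i) (Cod C p).
        p \<cdot>\<^bsub>C\<^esub> u = v \<cdot>\<^bsub>C\<^esub> i \<longrightarrow>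
        (\<exists>h \<in> hom C (Cod C i) (Dom C p). h \<cdot>\<^bsub>C\<^esub> i = u \<and> p \<cdot>\<^bsub>C\<^esub> h = v))"

definition orth :: "('o, 'a) cat \<Rightarrow> 'a set \<Rightarrow> 'a set \<Rightarrow> bool" where
  "orth C N M \<longleftrightarrow> (\<forall>i \<in> N. \<forall>p \<in> M. lifts C i p)"

definition left_orth :: "('o, 'a) cat \<Rightarrow> 'a set \<Rightarrow> 'a set" where
  "left_orth C M = {i \<in> Arr C. \<forall>p \<in> M. lifts C i p}"

definition right_orth :: "('o, 'a) cat \<Rightarrow> 'a set \<Rightarrow> 'a set" where
  "right_orth C N = {p \<in> Arr C. \<forall>i \<in> N. lifts C i p}"

definition all_factor :: "('o, 'a) cat \<Rightarrow> 'a set \<Rightarrow> 'a set \<Rightarrow> bool" where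
  "all_factor C M N \<longleftrightarrow>
     (\<forall>f \<in> Arr C. \<exists>n \<in> N. \<exists>m \<in> M. Cod C n = Dom C m \<and> m \<cdot>\<^bsub>C\<^esub> n = f)"

definition weak_factorization_system :: "('o, 'a) cat \<Rightarrow> 'a set \<Rightarrow> 'a set \<Rightarrow> bool" where
  "weak_factorization_system C N M \<longleftrightarrow>
     all_factor C M N \<and> N = left_orth C M \<and> right_orth C N = M"


section \<open>Diagrams and limits\<close>

record ('i, 'j, 'o, 'a) diagram =
  Idx :: "('i, 'j) cat"
  OMap :: "'i \<Rightarrow> 'o"
  AMap :: "'j \<Rightarrow> 'a"

definition is_diagram :: "('o, 'a) cat \<Rightarrow> ('i, 'j, 'o, 'a) diagram \<Rightarrow> bool" where
  "is_diagram C X \<longleftrightarrow>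
     category (Idx X)
     \<and> (\<forall>i \<in> Obj (Idx X). OMap X i \<in> Obj C)
     \<and> (\<forall>i \<in> Obj (Idx X). \<forall>j \<in> Obj (Idx X). \<forall>u \<in> hom (Idx X) i j.
          AMap X u \<in> hom C (OMap X i) (OMap X j))
     \<and> (\<forall>i \<in> Obj (Idx X). AMap X (Idn (Idx X) i) = Idn C (OMap X i))
     \<and> (\<forall>u \<in> Arr (Idx X). \<forall>v \<in> Arr (Idx X). Cod (Idx X) u = Dom (Idx X) v \<longrightarrow>
          AMap X (v \<cdot>\<^bsub>Idx X\<^esub> u) = AMap X v \<cdot>\<^bsub>C\<^esub> AMap X u)"

definition nat_trans ::
    "('o, 'a) cat \<Rightarrow> ('i, 'j, 'o, 'a) diagram \<Rightarrow> ('i, 'j, 'o, 'a) diagram \<Rightarrow> ('i \<Rightarrow> 'a) \<Rightarrow> bool" where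
  "nat_trans C X Y \<phi> \<longleftrightarrow>
     is_diagram C X \<and> is_diagram C Y \<and> Idx X = Idx Y
     \<and> (\<forall>i \<in> Obj (Idx X). \<phi> i \<in> hom C (OMap X i) (OMap Y i))
     \<and> (\<forall>i \<in> Obj (Idx X). \<forall>j \<in> Obj (Idx X). \<forall>u \<in> hom (Idx X) i j.
          \<phi> j \<cdot>\<^bsub>C\<^esub> AMap X u = AMap Y u \<cdot>\<^bsub>C\<^esub> \<phi> i)"

definition restrict_diagram :: "('i, 'j, 'o, 'a) diagram \<Rightarrow> 'i set \<Rightarrow> ('i, 'j, 'o, 'a) diagram" where
  "restrict_diagram X S = X\<lparr>Idx := full_subcat (Idx X) S\<rparr>"

definition cone :: "('o, 'a) cat \<Rightarrow> ('i, 'j, 'o, 'a) diagram \<Rightarrow> 'o \<Rightarrow> ('i \<Rightarrow> 'a) \<Rightarrow> bool" where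
  "cone C X L \<pi> \<longleftrightarrow>
     L \<in> Obj C
     \<and> (\<forall>i \<in> Obj (Idx X). \<pi> i \<in> hom C L (OMap X i))
     \<and> (\<forall>i \<in> Obj (Idx X). \<forall>j \<in> Obj (Idx X). \<forall>u \<in> hom (Idx X) i j. AMap X u \<cdot>\<^bsub>C\<^esub> \<pi> i = \<pi> j)"

definition limit_cone :: "('o, 'a) cat \<Rightarrow> ('i, 'j, 'o, 'a) diagram \<Rightarrow> 'o \<Rightarrow> ('i \<Rightarrow> 'a) \<Rightarrow> bool" where
  "limit_cone C X L \<pi> \<longleftrightarrow>
     cone C X L \<pi>
     \<and> (\<forall>K \<kappa>. cone C X K \<kappa> \<longrightarrow> (\<exists>!h. h \<in> hom C K L \<and> (\<forall>i \<in> Obj (Idx X). \<pi> i \<cdot>\<^bsub>C\<^esub> h = \<kappa> i)))"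

text \<open>Every finite category is isomorphic to one whose objects and arrows are natural numbers.\<close>

definition has_finite_limits :: "('o, 'a) cat \<Rightarrow> bool" where
  "has_finite_limits C \<longleftrightarrow>
     (\<forall>X :: (nat, nat, 'o, 'a) diagram.
        is_diagram C X \<and> finite (Obj (Idx X)) \<and> finite (Arr (Idx X)) \<longrightarrow>
        (\<exists>L \<pi>. limit_cone C X L \<pi>))"

definition is_pullback :: "('o, 'a) cat \<Rightarrow> 'a \<Rightarrow> 'a \<Rightarrow> 'o \<Rightarrow> 'a \<Rightarrow> 'a \<Rightarrow> bool" where
  "is_pullback C f g P p q \<longleftrightarrow>
     f \<in> Arr C \<and> g \<in> Arr C \<and> Cod C f = Cod C g
     \<and> p \<in> hom C P (Dom C f) \<and> q \<in> hom C P (Dom C g) \<and> f \<cdot>\<^bsub>C\<^esub> p = g \<cdot>\<^bsub>C\<^esub> q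
     \<and> (\<forall>Q. \<forall>a \<in> hom C Q (Dom C f). \<forall>b \<in> hom C Q (Dom C g). f \<cdot>\<^bsub>C\<^esub> a = g \<cdot>\<^bsub>C\<^esub> b \<longrightarrow>
          (\<exists>!h. h \<in> hom C Q P \<and> p \<cdot>\<^bsub>C\<^esub> h = a \<and> q \<cdot>\<^bsub>C\<^esub> h = b))"


section \<open>Directed categories and cofinite directed posets\<close>

definition directed :: "('i, 'j) cat \<Rightarrow> bool" where
  "directed I \<longleftrightarrow>
     category I
     \<and> Obj I \<noteq> {}
     \<and> (\<forall>s \<in> Obj I. \<forall>t \<in> Obj I. \<exists>u \<in> Obj I. hom I u s \<noteq> {} \<and> hom I u t \<noteq> {})
     \<and> (\<forall>s \<in> Obj I. \<forall>t \<in> Obj I. \<forall>f \<in> hom I s t. \<forall>g \<in> hom I s t.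
          \<exists>u \<in> Obj I. \<exists>h \<in> hom I u s. f \<cdot>\<^bsub>I\<^esub> h = g \<cdot>\<^bsub>I\<^esub> h)"

text \<open>The pair \<open>(v, u) \<in> le\<close> means \<open>v \<le> u\<close>; arrows go from larger to smaller elements.\<close>

definition poset_category :: "('i \<times> 'i) set \<Rightarrow> ('i, 'j) cat \<Rightarrow> bool" where
  "poset_category le I \<longleftrightarrow>
     category I
     \<and> partial_order_on (Obj I) le
     \<and> (\<forall>u \<in> Obj I. \<forall>v \<in> Obj I.
          if (v, u) \<in> le then (\<exists>!f. f \<in> hom I u v) else hom I u v = {})"

definition cofinite :: "'i set \<Rightarrow> ('i \<times> 'i) set \<Rightarrow> bool" where
  "cofinite T le \<longleftrightarrow> (\<forall>x \<in> T. finite {z \<in> T. (z, x) \<in> le})"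


section \<open>Pro-categories\<close>

text \<open>
  The index type \<open>'i\<close>, meant to be infinite but otherwise arbitrary, plays the role of the universe:
  a small category is one whose objects and arrows are elements of \<open>'i\<close>. There is no bound on
  the objects and arrows of \<open>C\<close>.
\<close>

type_synonym ('i, 'o, 'a) pro_obj = "('i, 'i, 'o, 'a) diagram"

definition is_pro_obj :: "('o, 'a) cat \<Rightarrow> ('i, 'o, 'a) pro_obj \<Rightarrow> bool" where
  "is_pro_obj C X \<longleftrightarrow> is_diagram C X \<and> directed (Idx X)"

text \<open>
  The colimit over \<open>t\<close> of the sets \<open>hom C (X\<^sub>t) c\<close>, as the quotient of the disjoint union by the
  equivalence relation generated by \<open>(t, f) \<sim> (t', f \<cdot> X(u))\<close> for \<open>u : t' \<rightarrow> t\<close>.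
\<close>

definition colim_total :: "('o, 'a) cat \<Rightarrow> ('i, 'o, 'a) pro_obj \<Rightarrow> 'o \<Rightarrow> ('i \<times> 'a) set" where
  "colim_total C X c = (SIGMA t : Obj (Idx X). hom C (OMap X t) c)"

definition colim_step ::
    "('o, 'a) cat \<Rightarrow> ('i, 'o, 'a) pro_obj \<Rightarrow> 'o \<Rightarrow> (('i \<times> 'a) \<times> ('i \<times> 'a)) set" where
  "colim_step C X c =
     {((t, f), (t', f \<cdot>\<^bsub>C\<^esub> AMap X u)) | t t' f u.
        t \<in> Obj (Idx X) \<and> t' \<in> Obj (Idx X) \<and> f \<in> hom C (OMap X t) c \<and> u \<in> hom (Idx X) t' t}"

definition colim_rel ::
    "('o, 'a) cat \<Rightarrow> ('i, 'o, 'a) pro_obj \<Rightarrow> 'o \<Rightarrow> (('i \<times> 'a) \<times> ('i \<times> 'a)) set" where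
  "colim_rel C X c = (colim_step C X c \<union> (colim_step C X c)\<inverse>)\<^sup>*"

definition colim_class ::
    "('o, 'a) cat \<Rightarrow> ('i, 'o, 'a) pro_obj \<Rightarrow> 'o \<Rightarrow> 'i \<Rightarrow> 'a \<Rightarrow> ('i \<times> 'a) set" where
  "colim_class C X c t f = colim_rel C X c `` {(t, f)}"

definition colim_hom :: "('o, 'a) cat \<Rightarrow> ('i, 'o, 'a) pro_obj \<Rightarrow> 'o \<Rightarrow> ('i \<times> 'a) set set" where
  "colim_hom C X c = colim_total C X c // colim_rel C X c"

text \<open>The map of colimits induced by \<open>g : c \<rightarrow> d\<close>.\<close>

definition colim_push ::
    "('o, 'a) cat \<Rightarrow> ('i, 'o, 'a) pro_obj \<Rightarrow> 'o \<Rightarrow> 'a \<Rightarrow> ('i \<times> 'a) set \<Rightarrow> ('i \<times> 'a) set" where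
  "colim_push C X d g K = (\<Union>(t, f) \<in> K. colim_class C X d t (g \<cdot>\<^bsub>C\<^esub> f))"

text \<open>
  The limit over \<open>s\<close> of the colimits: compatible families, normalised to \<^const>\<open>undefined\<close>
  outside the index category of \<open>Y\<close> so that equality of morphisms is equality of families.
\<close>

definition pro_hom ::
    "('o, 'a) cat \<Rightarrow> ('i, 'o, 'a) pro_obj \<Rightarrow> ('i, 'o, 'a) pro_obj \<Rightarrow> ('i \<Rightarrow> ('i \<times> 'a) set) set" where
  "pro_hom C X Y =
     {F. (\<forall>s \<in> Obj (Idx Y). F s \<in> colim_hom C X (OMap Y s))
       \<and> (\<forall>s \<in> Obj (Idx Y). \<forall>s' \<in> Obj (Idx Y). \<forall>u \<in> hom (Idx Y) s s'.
            colim_push C X (OMap Y s') (AMap Y u) (F s) = F s')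
       \<and> (\<forall>s. s \<notin> Obj (Idx Y) \<longrightarrow> F s = undefined)}"

definition pro_idn :: "('o, 'a) cat \<Rightarrow> ('i, 'o, 'a) pro_obj \<Rightarrow> 'i \<Rightarrow> ('i \<times> 'a) set" where
  "pro_idn C X s =
     (if s \<in> Obj (Idx X) then colim_class C X (OMap X s) s (Idn C (OMap X s)) else undefined)"

text \<open>All the classes in the union below are equal.\<close>

definition pro_comp ::
    "('o, 'a) cat \<Rightarrow> ('i, 'o, 'a) pro_obj \<Rightarrow> ('i, 'o, 'a) pro_obj
      \<Rightarrow> ('i \<Rightarrow> ('i \<times> 'a) set) \<Rightarrow> ('i \<Rightarrow> ('i \<times> 'a) set) \<Rightarrow> 'i \<Rightarrow> ('i \<times> 'a) set" where
  "pro_comp C X Z G F s =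
     (if s \<in> Obj (Idx Z)
      then \<Union>(t, g) \<in> G s. \<Union>(r, f) \<in> F t. colim_class C X (OMap Z s) r (g \<cdot>\<^bsub>C\<^esub> f)
      else undefined)"

type_synonym ('i, 'o, 'a) pro_arr =
  "('i, 'o, 'a) pro_obj \<times> ('i, 'o, 'a) pro_obj \<times> ('i \<Rightarrow> ('i \<times> 'a) set)"

type_synonym ('i, 'o, 'a) pro_cat = "(('i, 'o, 'a) pro_obj, ('i, 'o, 'a) pro_arr) cat"

definition Pro :: "('o, 'a) cat \<Rightarrow> ('i, 'o, 'a) pro_cat" where
  "Pro C = \<lparr>
     Obj = {X. is_pro_obj C X},
     Arr = {(X, Y, F). is_pro_obj C X \<and> is_pro_obj C Y \<and> F \<in> pro_hom C X Y},
     Dom = (\<lambda>(X, Y, F). X),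
     Cod = (\<lambda>(X, Y, F). Y),
     Idn = (\<lambda>X. (X, X, pro_idn C X)),
     Comp = (\<lambda>(Y, Z, G) (X, Y', F). (X, Z, pro_comp C X Z G F))\<rparr>"

definition pro_induced ::
    "('o, 'a) cat \<Rightarrow> ('i, 'o, 'a) pro_obj \<Rightarrow> ('i, 'o, 'a) pro_obj \<Rightarrow> ('i \<Rightarrow> 'a) \<Rightarrow> ('i, 'o, 'a) pro_arr" where
  "pro_induced C X Y \<phi> =
     (X, Y, \<lambda>s. if s \<in> Obj (Idx Y) then colim_class C X (OMap Y s) s (\<phi> s) else undefined)"

text \<open>
  The one-object, one-morphism category; which element of \<open>'i\<close> serves as object and arrow is
  immaterial.
\<close>

definition point_cat :: "('i, 'i) cat" where
  "point_cat = \<lparr>Obj = {undefined}, Arr = {undefined}, Dom = (\<lambda>_. undefined), Cod = (\<lambda>_. undefined),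
     Idn = (\<lambda>_. undefined), Comp = (\<lambda>_ _. undefined)\<rparr>"

definition simple_obj :: "('o, 'a) cat \<Rightarrow> 'o \<Rightarrow> ('i, 'o, 'a) pro_obj" where
  "simple_obj C c = \<lparr>Idx = point_cat, OMap = (\<lambda>_. c), AMap = (\<lambda>_. Idn C c)\<rparr>"

definition simple_arr :: "('o, 'a) cat \<Rightarrow> 'a \<Rightarrow> ('i, 'o, 'a) pro_arr" where
  "simple_arr C f = pro_induced C (simple_obj C (Dom C f)) (simple_obj C (Cod C f)) (\<lambda>_. f)"


section \<open>Levelwise and special maps\<close>

definition levelwise ::
    "('o, 'a) cat \<Rightarrow> 'a set \<Rightarrow> ('i, 'j, 'o, 'a) diagram \<Rightarrow> ('i, 'j, 'o, 'a) diagram \<Rightarrow> ('i \<Rightarrow> 'a) \<Rightarrow> bool"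
  where
  "levelwise C M X Y \<phi> \<longleftrightarrow> nat_trans C X Y \<phi> \<and> (\<forall>i \<in> Obj (Idx X). \<phi> i \<in> M)"

text \<open>
  The natural map \<open>h : X\<^sub>t \<rightarrow> Y\<^sub>t \<times>\<^bsub>lim Y\<^esub> lim X\<close>, the limits being over \<open>s < t\<close>, is in \<open>M\<close>.
  Here \<open>LX\<close>, \<open>LY\<close> are the limits, \<open>P\<close> the pullback of \<open>a : Y\<^sub>t \<rightarrow> LY\<close> and \<open>b : LX \<rightarrow> LY\<close>, and the
  equations say that \<open>a\<close>, \<open>b\<close> and \<open>h\<close> are the canonical maps. \<open>M\<close> need not be closed under
  isomorphisms, so this can depend on the choice of the limit objects; it is required for some choice.
\<close>

definition special_at ::
    "('o, 'a) cat \<Rightarrow> 'a set \<Rightarrow> ('i \<times> 'i) set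
      \<Rightarrow> ('i, 'j, 'o, 'a) diagram \<Rightarrow> ('i, 'j, 'o, 'a) diagram \<Rightarrow> ('i \<Rightarrow> 'a) \<Rightarrow> 'i \<Rightarrow> bool" where
  "special_at C M le X Y \<phi> t \<longleftrightarrow>
     (let S = {s \<in> Obj (Idx X). (s, t) \<in> le \<and> s \<noteq> t} in
      \<exists>LX \<pi> LY \<rho> a b P p q h.
        limit_cone C (restrict_diagram X S) LX \<pi>
        \<and> limit_cone C (restrict_diagram Y S) LY \<rho>
        \<and> a \<in> hom C (OMap Y t) LY \<and> (\<forall>s \<in> S. \<forall>u \<in> hom (Idx Y) t s. \<rho> s \<cdot>\<^bsub>C\<^esub> a = AMap Y u)
        \<and> b \<in> hom C LX LY \<and> (\<forall>s \<in> S. \<rho> s \<cdot>\<^bsub>C\<^esub> b = \<phi> s \<cdot>\<^bsub>C\<^esub> \<pi> s)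
        \<and> is_pullback C a b P p q
        \<and> h \<in> hom C (OMap X t) P \<and> p \<cdot>\<^bsub>C\<^esub> h = \<phi> t
        \<and> (\<forall>s \<in> S. \<forall>u \<in> hom (Idx X) t s. \<pi> s \<cdot>\<^bsub>C\<^esub> (q \<cdot>\<^bsub>C\<^esub> h) = AMap X u)
        \<and> h \<in> M)"

definition special ::
    "('o, 'a) cat \<Rightarrow> 'a set \<Rightarrow> ('i, 'j, 'o, 'a) diagram \<Rightarrow> ('i, 'j, 'o, 'a) diagram \<Rightarrow> ('i \<Rightarrow> 'a) \<Rightarrow> bool"
  where
  "special C M X Y \<phi> \<longleftrightarrow>
     nat_trans C X Y \<phi>
     \<and> (\<exists>le. poset_category le (Idx X) \<and> cofinite (Obj (Idx X)) le
          \<and> (\<forall>t \<in> Obj (Idx X). special_at C M le X Y \<phi> t))"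

definition Lw :: "('o, 'a) cat \<Rightarrow> 'a set \<Rightarrow> ('i, 'o, 'a) pro_arr set" where
  "Lw C M = iso_closure (Pro C)
     {pro_induced C X Y \<phi> | X Y \<phi>. directed (Idx X) \<and> levelwise C M X Y \<phi>}"

definition Sp :: "('o, 'a) cat \<Rightarrow> 'a set \<Rightarrow> ('i, 'o, 'a) pro_arr set" where
  "Sp C M = iso_closure (Pro C)
     {pro_induced C X Y \<phi> | X Y \<phi>. directed (Idx X) \<and> special C M X Y \<phi>}"


section \<open>The pro-category is a category\<close>

lemma equiv_colim_rel: "equiv UNIV (colim_rel C X c)"
proof -
  have "sym (colim_rel C X c)"
    unfolding colim_rel_def by (intro sym_rtrancl sym_Un_converse)
  then show ?thesis
    unfolding equiv_def by (auto simp: colim_rel_def refl_on_def intro: trans_rtrancl)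
qed

lemma class_eq_iff: "colim_class C X c t f = colim_class C X c t' f' \<longleftrightarrow> ((t,f),(t',f')) \<in> colim_rel C X c"
  unfolding colim_class_def by (rule eq_equiv_class_iff[OF equiv_colim_rel UNIV_I UNIV_I])

lemma mem_class: "(t',f') \<in> colim_class C X c t f \<longleftrightarrow> colim_class C X c t f = colim_class C X c t' f'"
  unfolding class_eq_iff by (simp add: colim_class_def)

context category begin

lemma category_arrow_cat: "category (arrow_cat C)"
proof -
  have sq: "(v' \<cdot> v) \<cdot> f = g' \<cdot> (u' \<cdot> u)"
    if "f \<in> Arr C" "g \<in> Arr C" "g' \<in> Arr C" "u \<in> hom C (Dom C f) (Dom C g)" "v \<in> hom C (Cod C f) (Cod C g)"
      "u' \<in> hom C (Dom C g) (Dom C g')" "v' \<in> hom C (Cod C g) (Cod C g')" "v \<cdot> f = g \<cdot> u" "v' \<cdot> g = g' \<cdot> u'" for f g g' u v u' v'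
  proof -
    have h: "f \<in> hom C (Dom C f) (Cod C f)" "g \<in> hom C (Dom C g) (Cod C g)" "g' \<in> hom C (Dom C g') (Cod C g')"
      using that by (auto simp: hom_def)
    show ?thesis using Comp_assoc[OF h(1) that(5,7)] Comp_assoc[OF that(4) h(2) that(7)] Comp_assoc[OF that(4,6) h(3)] that(8,9)
      by simp
  qed
  have self: "f \<in> hom C (Dom C f) (Cod C f)" if "f \<in> Arr C" for f using that by (simp add: hom_def)
  show ?thesis
  proof (unfold_locales, goal_cases)
    case 3 then show ?case
      using self Idn_in[OF Dom_in] Idn_in[OF Cod_in] Idn_Comp[OF self] Comp_Idn[OF self]
      by (auto simp: arrow_cat_def hom_def[of "arrow_cat C"] hom_def[of "\<lparr>Obj = _, Arr = _, Dom = _, Cod = _, Idn = _, Comp = _\<rparr>"])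
  next
    case 4 then show ?case 
      using sq Comp_in
      by (auto simp: arrow_cat_def hom_def[of "\<lparr>Obj = _, Arr = _, Dom = _, Cod = _, Idn = _, Comp = _\<rparr>"])
  next
    case 5 then show ?case 
      using Comp_Idn
      by (auto simp: arrow_cat_def hom_def[of "\<lparr>Obj = _, Arr = _, Dom = _, Cod = _, Idn = _, Comp = _\<rparr>"])
  next
    case 6 then show ?case 
      using Idn_Comp
      by (auto simp: arrow_cat_def hom_def[of "\<lparr>Obj = _, Arr = _, Dom = _, Cod = _, Idn = _, Comp = _\<rparr>"])
  next
    case 7 then show ?case 
      using Comp_assoc
      by (auto simp: arrow_cat_def hom_def[of "\<lparr>Obj = _, Arr = _, Dom = _, Cod = _, Idn = _, Comp = _\<rparr>"])
  qed (auto simp: arrow_cat_def)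
qed

lemma step_total:
  assumes "is_diagram C X" "(p,q) \<in> colim_step C X c" 
  shows "p \<in> colim_total C X c" "q \<in> colim_total C X c"
proof -
  obtain t t' f u where pq: "p = (t,f)" "q = (t', f \<cdot> AMap X u)" "t \<in> Obj (Idx X)" "t' \<in> Obj (Idx X)"
      "f \<in> hom C (OMap X t) c" "u \<in> hom (Idx X) t' t" using assms(2) unfolding colim_step_def by auto
  have "AMap X u \<in> hom C (OMap X t') (OMap X t)" using assms(1) pq unfolding is_diagram_def by blast
  with Comp_in[OF this pq(5)] pq show "p \<in> colim_total C X c" "q \<in> colim_total C X c"
    by (auto simp: colim_total_def)
qed

lemma rel_total:
  assumes "is_diagram C X" "(p,q) \<in> colim_rel C X c" "p \<in> colim_total C X c"
  shows "q \<in> colim_total C X c"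
  using assms(2,3) unfolding colim_rel_def
  by (induction rule: rtrancl_induct) (use step_total[OF assms(1)] in blast)+

lemma colim_homE:
  assumes "K \<in> colim_hom C X c"
  obtains t f where "t \<in> Obj (Idx X)" "f \<in> hom C (OMap X t) c" "K = colim_class C X c t f"
  using assms unfolding colim_hom_def colim_total_def quotient_def colim_class_def by auto

lemma colim_class_in: "\<lbrakk>t \<in> Obj (Idx X); f \<in> hom C (OMap X t) c\<rbrakk> \<Longrightarrow> colim_class C X c t f \<in> colim_hom C X c"
  unfolding colim_hom_def colim_total_def quotient_def colim_class_def by auto

lemma colim_hom_mem:
  assumes "is_diagram C X" "K \<in> colim_hom C X c" "(t,f) \<in> K"
  shows "t \<in> Obj (Idx X)" "f \<in> hom C (OMap X t) c" "K = colim_class C X c t f"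
proof -
  obtain t0 f0 where *: "t0 \<in> Obj (Idx X)" "f0 \<in> hom C (OMap X t0) c" "K = colim_class C X c t0 f0"
    using assms(2) by (rule colim_homE)
  then have r: "((t0,f0),(t,f)) \<in> colim_rel C X c" using assms(3) by (simp add: colim_class_def)
  have "(t,f) \<in> colim_total C X c"
    by (rule rel_total[OF assms(1) r]) (use * in \<open>auto simp: colim_total_def\<close>)
  then show "t \<in> Obj (Idx X)" "f \<in> hom C (OMap X t) c" by (auto simp: colim_total_def)
  show "K = colim_class C X c t f" using r * class_eq_iff by metis
qed

lemma colim_hom_ne: assumes "K \<in> colim_hom C X c" obtains t f where "(t,f) \<in> K"
  using assms mem_class by (metis colim_homE)

lemma rel_push:
  assumes X: "is_diagram C X" and r: "(p,q) \<in> colim_rel C X c" "p \<in> colim_total C X c" and g: "g \<in> hom C c d"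
  shows "((fst p, g \<cdot> snd p), (fst q, g \<cdot> snd q)) \<in> colim_rel C X d"
proof -
  have st: "((fst p, g \<cdot> snd p), (fst q, g \<cdot> snd q)) \<in> colim_step C X d" if s: "(p,q) \<in> colim_step C X c" for p q
  proof -
    from s obtain t t' f u where pq: "p = (t,f)" "q = (t', f \<cdot> AMap X u)" "t \<in> Obj (Idx X)" "t' \<in> Obj (Idx X)"
      "f \<in> hom C (OMap X t) c" "u \<in> hom (Idx X) t' t" unfolding colim_step_def by auto
    have "AMap X u \<in> hom C (OMap X t') (OMap X t)" using X pq unfolding is_diagram_def by blast
    then have "g \<cdot> (f \<cdot> AMap X u) = (g \<cdot> f) \<cdot> AMap X u" "g \<cdot> f \<in> hom C (OMap X t) d"
      using Comp_assoc Comp_in g pq by metis+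
    then show ?thesis using pq unfolding colim_step_def by auto
  qed
  show ?thesis using r unfolding colim_rel_def
  proof (induction rule: rtrancl_induct)
    case base then show ?case by simp
  next
    case (step y z)
    then have "((fst y, g \<cdot> snd y), (fst z, g \<cdot> snd z)) \<in> colim_step C X d \<union> (colim_step C X d)\<inverse>"
      using st by blast
    with step show ?case by (meson rtrancl.rtrancl_into_rtrancl)
  qed
qed

lemma push_class:
  assumes X: "is_diagram C X" and t: "t \<in> Obj (Idx X)" "f \<in> hom C (OMap X t) c" and g: "g \<in> hom C c d"
  shows "colim_push C X d g (colim_class C X c t f) = colim_class C X d t (g \<cdot> f)"
proof -
  have "colim_class C X d t' (g \<cdot> f') = colim_class C X d t (g \<cdot> f)" if "(t',f') \<in> colim_class C X c t f" for t' f'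
  proof -
    have "((t,f),(t',f')) \<in> colim_rel C X c" using that by (simp add: colim_class_def)
    from rel_push[OF X this _ g] t show ?thesis by (simp add: class_eq_iff[symmetric] colim_total_def)
  qed
  moreover have "(t,f) \<in> colim_class C X c t f" by (simp add: mem_class)
  ultimately show ?thesis unfolding colim_push_def by fast
qed

lemma comp_wd:
  assumes X: "is_diagram C X" and Y: "is_diagram C Y" and F: "F \<in> pro_hom C X Y"
    and r: "(p,q) \<in> colim_rel C Y c" "p \<in> colim_total C Y c"
    and f: "(r0,f0) \<in> F (fst p)" "(r1,f1) \<in> F (fst q)"
  shows "colim_class C X c r0 (snd p \<cdot> f0) = colim_class C X c r1 (snd q \<cdot> f1)"
proof -
  define v where "v = (\<lambda>p. colim_push C X c (snd p) (F (fst p)))"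
  have v: "v p = colim_class C X c r (snd p \<cdot> f)" if "p \<in> colim_total C Y c" "(r,f) \<in> F (fst p)" for p r f
  proof -
    have "F (fst p) \<in> colim_hom C X (OMap Y (fst p))" using F that by (auto simp: pro_hom_def colim_total_def)
    from colim_hom_mem[OF X this that(2)] show ?thesis
      unfolding v_def using push_class[OF X] that(1) by (auto simp: colim_total_def)
  qed
  have st: "v p = v q" if s: "(p,q) \<in> colim_step C Y c" for p q
  proof -
    from s obtain t t' g u where pq: "p = (t,g)" "q = (t', g \<cdot> AMap Y u)" "t \<in> Obj (Idx Y)" "t' \<in> Obj (Idx Y)"
      "g \<in> hom C (OMap Y t) c" "u \<in> hom (Idx Y) t' t" unfolding colim_step_def by auto
    have Yu: "AMap Y u \<in> hom C (OMap Y t') (OMap Y t)" using Y pq unfolding is_diagram_def by blast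
    have Ft': "F t' \<in> colim_hom C X (OMap Y t')" and e: "F t = colim_push C X (OMap Y t) (AMap Y u) (F t')"
      using F pq by (auto simp: pro_hom_def)
    obtain r f where rf: "r \<in> Obj (Idx X)" "f \<in> hom C (OMap X r) (OMap Y t')" "F t' = colim_class C X (OMap Y t') r f"
      using Ft' by (rule colim_homE)
    have "F t = colim_class C X (OMap Y t) r (AMap Y u \<cdot> f)" unfolding e rf(3)
      by (rule push_class[OF X rf(1,2) Yu])
    then have "(r, AMap Y u \<cdot> f) \<in> F t" "(r,f) \<in> F t'" using rf by (simp_all add: mem_class)
    then have "v p = colim_class C X c r (g \<cdot> (AMap Y u \<cdot> f))" "v q = colim_class C X c r ((g \<cdot> AMap Y u) \<cdot> f)"
      using v[OF step_total(1)[OF Y s]] v[OF step_total(2)[OF Y s]] pq(1,2) by auto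
    then show ?thesis using Comp_assoc[OF rf(2) Yu pq(5)] by simp
  qed
  have "v p = v q" using r(1) unfolding colim_rel_def
  proof (induction rule: rtrancl_induct)
    case (step y z)
    then have "v y = v z" using st[of y z] st[of z y] by auto
    with step show ?case by simp
  qed simp
  then show ?thesis using v[OF r(2) f(1)] v[OF rel_total[OF Y r] f(2)] by simp
qed

lemma pro_comp_eq:
  assumes X: "is_diagram C X" and Y: "is_diagram C Y" and F: "F \<in> pro_hom C X Y" and G: "G \<in> pro_hom C Y Z"
    and s: "s \<in> Obj (Idx Z)" and g: "(t,g) \<in> G s" and f: "(r,f) \<in> F t"
  shows "pro_comp C X Z G F s = colim_class C X (OMap Z s) r (g \<cdot> f)"
proof -
  have Gs: "G s \<in> colim_hom C Y (OMap Z s)" using G s by (auto simp: pro_hom_def)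
  have "colim_class C X (OMap Z s) r' (g' \<cdot> f') = colim_class C X (OMap Z s) r (g \<cdot> f)"
    if "(t',g') \<in> G s" "(r',f') \<in> F t'" for t' g' r' f'
  proof -
    note a = colim_hom_mem[OF Y Gs that(1)] and b = colim_hom_mem[OF Y Gs g]
    have "((t',g'),(t,g)) \<in> colim_rel C Y (OMap Z s)" using a(3) b(3) class_eq_iff by metis
    from comp_wd[OF X Y F this] a that f show ?thesis by (auto simp: colim_total_def)
  qed
  then have "(\<Union>(t', g') \<in> G s. \<Union>(r', f') \<in> F t'. colim_class C X (OMap Z s) r' (g' \<cdot> f'))
      = colim_class C X (OMap Z s) r (g \<cdot> f)"
    using f g by (fast)
  then show ?thesis using s unfolding pro_comp_def by simp
qed

lemma pro_hom_rep:
  assumes "is_diagram C X" "F \<in> pro_hom C X Y" "s \<in> Obj (Idx Y)"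
  obtains r f where "r \<in> Obj (Idx X)" "f \<in> hom C (OMap X r) (OMap Y s)" "(r,f) \<in> F s"
    "F s = colim_class C X (OMap Y s) r f"
proof -
  have K: "F s \<in> colim_hom C X (OMap Y s)" using assms by (auto simp: pro_hom_def)
  obtain r f where m: "(r,f) \<in> F s" by (rule colim_hom_ne[OF K])
  show ?thesis
    by (rule that[OF colim_hom_mem(1)[OF assms(1) K m] colim_hom_mem(2)[OF assms(1) K m] m colim_hom_mem(3)[OF assms(1) K m]])
qed

lemma pro_homI:
  assumes "\<And>s. s \<in> Obj (Idx Y) \<Longrightarrow> F s \<in> colim_hom C X (OMap Y s)"
    and "\<And>s s' u. \<lbrakk>s \<in> Obj (Idx Y); s' \<in> Obj (Idx Y); u \<in> hom (Idx Y) s s'\<rbrakk> \<Longrightarrow>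
       colim_push C X (OMap Y s') (AMap Y u) (F s) = F s'"
    and "\<And>s. s \<notin> Obj (Idx Y) \<Longrightarrow> F s = undefined"
  shows "F \<in> pro_hom C X Y"
  unfolding pro_hom_def mem_Collect_eq
  by (intro conjI ballI allI impI) (rule assms; assumption)+

lemma pro_idn_in: assumes X: "is_diagram C X" shows "pro_idn C X \<in> pro_hom C X X"
proof (rule pro_homI)
  fix s assume s: "s \<in> Obj (Idx X)"
  then have Xs: "OMap X s \<in> Obj C" using X s unfolding is_diagram_def by blast
  show "pro_idn C X s \<in> colim_hom C X (OMap X s)"
    using s Xs by (simp add: pro_idn_def colim_class_in Idn_in)
  fix s' u assume s': "s' \<in> Obj (Idx X)" and u: "u \<in> hom (Idx X) s s'"
  have Xu: "AMap X u \<in> hom C (OMap X s) (OMap X s')" using X s s' u unfolding is_diagram_def by blast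
  have Xs': "OMap X s' \<in> Obj C" using X s' unfolding is_diagram_def by blast
  have "((s', Idn C (OMap X s')), (s, Idn C (OMap X s') \<cdot> AMap X u)) \<in> colim_rel C X (OMap X s')"
    unfolding colim_rel_def
    by (rule r_into_rtrancl) (use s s' u Idn_in[OF Xs'] in \<open>auto simp: colim_step_def\<close>)
  then have "colim_class C X (OMap X s') s (AMap X u \<cdot> Idn C (OMap X s)) = colim_class C X (OMap X s') s' (Idn C (OMap X s'))"
    unfolding Comp_Idn[OF Xu] Idn_Comp[OF Xu] class_eq_iff[symmetric] by (rule sym)
  then show "colim_push C X (OMap X s') (AMap X u) (pro_idn C X s) = pro_idn C X s'"
    by (simp only: pro_idn_def s s' if_True push_class[OF X s Idn_in[OF Xs] Xu])
qed (simp add: pro_idn_def)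

lemma pro_comp_in:
  assumes X: "is_diagram C X" and Y: "is_diagram C Y" and Z: "is_diagram C Z" and F: "F \<in> pro_hom C X Y" and G: "G \<in> pro_hom C Y Z"
  shows "pro_comp C X Z G F \<in> pro_hom C X Z"
proof (rule pro_homI)
  fix s assume s: "s \<in> Obj (Idx Z)"
  obtain t g where g: "t \<in> Obj (Idx Y)" "g \<in> hom C (OMap Y t) (OMap Z s)" "(t,g) \<in> G s"
      "G s = colim_class C Y (OMap Z s) t g"
    using pro_hom_rep[OF Y G s] .
  obtain r f where f: "r \<in> Obj (Idx X)" "f \<in> hom C (OMap X r) (OMap Y t)" "(r,f) \<in> F t"
      "F t = colim_class C X (OMap Y t) r f"
    using pro_hom_rep[OF X F g(1)] .
  note e = pro_comp_eq[OF X Y F G s g(3) f(3)]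
  show "pro_comp C X Z G F s \<in> colim_hom C X (OMap Z s)"
    unfolding e using colim_class_in f g Comp_in by metis
  fix s' u assume s': "s' \<in> Obj (Idx Z)" and u: "u \<in> hom (Idx Z) s s'"
  have Zu: "AMap Z u \<in> hom C (OMap Z s) (OMap Z s')" using Z s s' u unfolding is_diagram_def by blast
  have "G s' = colim_push C Y (OMap Z s') (AMap Z u) (G s)" using G s s' u unfolding pro_hom_def by auto
  then have "(t, AMap Z u \<cdot> g) \<in> G s'" using push_class[OF Y g(1,2) Zu] g(4) mem_class by metis
  from pro_comp_eq[OF X Y F G s' this f(3)]
  show "colim_push C X (OMap Z s') (AMap Z u) (pro_comp C X Z G F s) = pro_comp C X Z G F s'"
    unfolding e using push_class[OF X f(1) Comp_in[OF f(2) g(2)] Zu] Comp_assoc[OF f(2) g(2) Zu] by simp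
qed (simp add: pro_comp_def)

theorem category_Pro: "category (Pro C :: ('i, 'o, 'a) pro_cat)"
proof
  let ?P = "Pro C :: ('i, 'o, 'a) pro_cat"
  have P: "hom ?P X Y = {(X', Y', F). X' = X \<and> Y' = Y \<and> is_pro_obj C X \<and> is_pro_obj C Y \<and> F \<in> pro_hom C X Y}" for X Y
    by (auto simp: hom_def Pro_def)
  have D: "is_diagram C X" if "is_pro_obj C X" for X :: "('i, 'o, 'a) pro_obj" using that by (simp add: is_pro_obj_def)
  fix f assume "f \<in> Arr ?P" then show "Dom ?P f \<in> Obj ?P" "Cod ?P f \<in> Obj ?P"
    by (auto simp: Pro_def)
next
  let ?P = "Pro C :: ('i, 'o, 'a) pro_cat"
  fix x assume "x \<in> Obj ?P" then show "Idn ?P x \<in> hom ?P x x"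
    by (auto simp: Pro_def hom_def is_pro_obj_def pro_idn_in)
next
  let ?P = "Pro C :: ('i, 'o, 'a) pro_cat"
  fix f g x y z assume "f \<in> hom ?P x y" "g \<in> hom ?P y z" 
  then show "g \<cdot>\<^bsub>?P\<^esub> f \<in> hom ?P x z"
    by (auto simp: Pro_def hom_def is_pro_obj_def intro: pro_comp_in)
next
  let ?P = "Pro C :: ('i, 'o, 'a) pro_cat"
  fix f x y assume "f \<in> hom ?P x y"
  then obtain F where F: "f = (x,y,F)" "is_diagram C x" "is_diagram C y" "F \<in> pro_hom C x y"
    by (auto simp: Pro_def hom_def is_pro_obj_def)
  have "pro_comp C x y F (pro_idn C x) s = F s" for s
  proof (cases "s \<in> Obj (Idx y)")
    case True
    obtain t g where g: "t \<in> Obj (Idx x)" "g \<in> hom C (OMap x t) (OMap y s)" "(t,g) \<in> F s"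
        "F s = colim_class C x (OMap y s) t g"
      using pro_hom_rep[OF F(2,4) True] .
    have "(t, Idn C (OMap x t)) \<in> pro_idn C x t" using g by (simp add: pro_idn_def mem_class)
    from pro_comp_eq[OF F(2,2) pro_idn_in[OF F(2)] F(4) True g(3) this] show ?thesis
      using g Comp_Idn by metis
  qed (use F in \<open>auto simp: pro_comp_def pro_hom_def\<close>)
  then have "pro_comp C x y F (pro_idn C x) = F" by blast
  then show "f \<cdot>\<^bsub>?P\<^esub> Idn ?P x = f" using F by (simp add: Pro_def)
  have "pro_comp C x y (pro_idn C y) F s = F s" for s
  proof (cases "s \<in> Obj (Idx y)")
    case True
    obtain t g where g: "t \<in> Obj (Idx x)" "g \<in> hom C (OMap x t) (OMap y s)" "(t,g) \<in> F s"
        "F s = colim_class C x (OMap y s) t g"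
      using pro_hom_rep[OF F(2,4) True] .
    have "(s, Idn C (OMap y s)) \<in> pro_idn C y s" using True by (simp add: pro_idn_def mem_class)
    from pro_comp_eq[OF F(2,3,4) pro_idn_in[OF F(3)] True this g(3)] show ?thesis
      using g Idn_Comp by metis
  qed (use F in \<open>auto simp: pro_comp_def pro_hom_def\<close>)
  then have "pro_comp C x y (pro_idn C y) F = F" by blast
  then show "Idn ?P y \<cdot>\<^bsub>?P\<^esub> f = f" using F by (simp add: Pro_def)
next
  let ?P = "Pro C :: ('i, 'o, 'a) pro_cat"
  fix f g h w x y z assume a: "f \<in> hom ?P w x" "g \<in> hom ?P x y" "h \<in> hom ?P y z"
  obtain F where F: "f = (w,x,F)" "is_diagram C w" "is_diagram C x" "F \<in> pro_hom C w x"
    using a(1) by (auto simp: Pro_def hom_def is_pro_obj_def)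
  obtain G where G: "g = (x,y,G)" "is_diagram C y" "G \<in> pro_hom C x y"
    using a(2) by (auto simp: Pro_def hom_def is_pro_obj_def)
  obtain H where H: "h = (y,z,H)" "is_diagram C z" "H \<in> pro_hom C y z"
    using a(3) by (auto simp: Pro_def hom_def is_pro_obj_def)
  note GF = pro_comp_in[OF F(2,3) G(2) F(4) G(3)] and HG = pro_comp_in[OF F(3) G(2) H(2) G(3) H(3)]
  have "pro_comp C w z (pro_comp C x z H G) F s = pro_comp C w z H (pro_comp C w y G F) s" for s
  proof (cases "s \<in> Obj (Idx z)")
    case True
    obtain t k where k: "t \<in> Obj (Idx y)" "k \<in> hom C (OMap y t) (OMap z s)" "(t,k) \<in> H s"
        "H s = colim_class C y (OMap z s) t k"
      using pro_hom_rep[OF G(2) H(3) True] .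
    obtain r j where j: "r \<in> Obj (Idx x)" "j \<in> hom C (OMap x r) (OMap y t)" "(r,j) \<in> G t"
        "G t = colim_class C x (OMap y t) r j"
      using pro_hom_rep[OF F(3) G(3) k(1)] .
    obtain q i where i: "q \<in> Obj (Idx w)" "i \<in> hom C (OMap w q) (OMap x r)" "(q,i) \<in> F r"
        "F r = colim_class C w (OMap x r) q i"
      using pro_hom_rep[OF F(2) F(4) j(1)] .
    have "(r, k \<cdot> j) \<in> pro_comp C x z H G s"
      using pro_comp_eq[OF F(3) G(2,3) H(3) True k(3) j(3)] by (simp add: mem_class)
    note e1 = pro_comp_eq[OF F(2,3,4) HG True this i(3)]
    have "(q, j \<cdot> i) \<in> pro_comp C w y G F t"
      using pro_comp_eq[OF F(2,3,4) G(3) k(1) j(3) i(3)] by (simp add: mem_class)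
    note e2 = pro_comp_eq[OF F(2) G(2) GF H(3) True k(3) this]
    show ?thesis unfolding e1 e2 using Comp_assoc[OF i(2) j(2) k(2)] by simp
  qed (simp add: pro_comp_def)
  then have "pro_comp C w z (pro_comp C x z H G) F = pro_comp C w z H (pro_comp C w y G F)" by blast
  then show "(h \<cdot>\<^bsub>?P\<^esub> g) \<cdot>\<^bsub>?P\<^esub> f = h \<cdot>\<^bsub>?P\<^esub> (g \<cdot>\<^bsub>?P\<^esub> f)" using F G H by (simp add: Pro_def)
qed

end

end

theory Submission
  imports Defs
begin

text \<open>
  Part (1): a lift against a special map is built one index at a time, by recursion along the cofinite
  poset; this works in the pro-category because finite limits of \<open>C\<close> remain limits there.

  Part (2): every morphism of pro-objects is isomorphic to a levelwise one indexed by the poset of finite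
  subsets of \<open>'i\<close>, and a levelwise map over a cofinite poset is factored in the manner of Reedy.

  Part (3): a morphism \<open>f\<close> that lifts against special maps factors as a levelwise \<open>N\<close>-map \<open>n\<close> followed by
  a special \<open>M\<close>-map \<open>m\<close>, and a lift \<open>k\<close> in the square \<open>m \<circ> n = id \<circ> f\<close> exhibits \<open>f\<close> as a retract of \<open>n\<close> under
  its domain. The idempotent \<open>k \<circ> m\<close> splits by changing only the index poset and the transition maps of the
  middle object, so that \<open>f\<close> itself is isomorphic to a levelwise \<open>N\<close>-map.
\<close>

section \<open>Retracts and lifting in a category\<close>

text \<open>\<open>N\<close> and \<open>M\<close> are arbitrary classes, not closed under
  isomorphisms or retracts. Factorizations and matching maps must therefore be hit on the nose in
  \<open>C\<close>, with suitably chosen limits; only \<open>Lw\<close> and \<open>Sp\<close> absorb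
  isomorphisms. This is also why the usual retract argument does not finish part (3): a retract of a
  levelwise \<open>N\<close>-map is not visibly levelwise, and a real change of diagram is required.

  The other obstacle is size. Index categories live on the fixed type \<open>'i\<close>, so
  auxiliary posets must fit into it. As \<open>'i\<close> is infinite, pairs, lists and finite
  subsets of \<open>'i\<close> can be coded in \<open>'i\<close>. One poset then serves all
  pro-objects: objects and arrows of any index category are elements of \<open>'i\<close>, so "reach
  this object" and "equalize these two arrows" are tasks named by such elements, and the poset is
  arranged so that every task recurs above every element.

  Morphisms out of a pro-object \<open>A\<close> enter through the sets
  \<open>colim_hom C A c\<close>. These are filtered colimits and commute with finite limits; over a
  cofinite poset the matching limits are finite.\<close>

context category
begin

lemma comp_Arr [simp]:
  assumes "f \<in> Arr C" "g \<in> Arr C" "Dom C g = Cod C f"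
  shows "g \<cdot> f \<in> Arr C" "Dom C (g \<cdot> f) = Dom C f" "Cod C (g \<cdot> f) = Cod C g"
  using Comp_in[of f "Dom C f" "Cod C f" g "Cod C g"] assms by (auto simp: hom_def)

lemma comp_assoc [simp]:
  assumes "f \<in> Arr C" "g \<in> Arr C" "h \<in> Arr C" "Dom C g = Cod C f" "Dom C h = Cod C g"
  shows "(h \<cdot> g) \<cdot> f = h \<cdot> (g \<cdot> f)"
  using Comp_assoc[of f "Dom C f" "Cod C f" g "Cod C g" h "Cod C h"] assms by (auto simp: hom_def)

lemma Idn_Arr [simp]:
  assumes "x \<in> Obj C"
  shows "Idn C x \<in> Arr C" "Dom C (Idn C x) = x" "Cod C (Idn C x) = x"
  using Idn_in[OF assms] by (auto simp: hom_def)

lemma comp_idn [simp]: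
  assumes "f \<in> Arr C"
  shows "Dom C f = x \<Longrightarrow> f \<cdot> Idn C x = f" "Cod C f = x \<Longrightarrow> Idn C x \<cdot> f = f"
  using Comp_Idn[of f] Idn_Comp[of f] assms by (auto simp: hom_def)

lemma hom_Obj:
  assumes "f \<in> hom C x y"
  shows "x \<in> Obj C" "y \<in> Obj C"
  using assms Dom_in Cod_in by (auto simp: hom_def)

lemma hom_Dom_Cod: "f \<in> Arr C \<Longrightarrow> f \<in> hom C (Dom C f) (Cod C f)"
  by (simp add: hom_def)

text \<open>\<open>comp_assoc\<close> is a simp rule that nests composites to the right, so a known
  product \<open>g \<cdot> f\<close> disappears inside \<open>g \<cdot> (f \<cdot> h)\<close>. This
  form lets such an equation act there.\<close>

lemma comp_left_eq:
  assumes "g \<cdot> f = k" "f \<in> hom C x y" "g \<in> hom C y z" "h \<in> hom C w x"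
  shows "g \<cdot> (f \<cdot> h) = k \<cdot> h"
  using assms by (auto simp: hom_def)

lemma retract_of_arrow_iff:
  assumes "f \<in> Arr C" "g \<in> Arr C"
  shows "retract_of (arrow_cat C) f g \<longleftrightarrow>
    (\<exists>s1 \<in> hom C (Dom C f) (Dom C g). \<exists>s2 \<in> hom C (Cod C f) (Cod C g).
     \<exists>r1 \<in> hom C (Dom C g) (Dom C f). \<exists>r2 \<in> hom C (Cod C g) (Cod C f).
       s2 \<cdot> f = g \<cdot> s1 \<and> r2 \<cdot> g = f \<cdot> r1 \<and> r1 \<cdot> s1 = Idn C (Dom C f) \<and> r2 \<cdot> s2 = Idn C (Cod C f))"
  unfolding retract_of_def hom_def[of "arrow_cat C"]
  using assms by (fastforce simp: arrow_cat_def)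

lemma isomorphic_arrow_iff:
  assumes "f \<in> Arr C" "g \<in> Arr C"
  shows "isomorphic (arrow_cat C) f g \<longleftrightarrow>
    (\<exists>s1 \<in> hom C (Dom C f) (Dom C g). \<exists>s2 \<in> hom C (Cod C f) (Cod C g).
     \<exists>r1 \<in> hom C (Dom C g) (Dom C f). \<exists>r2 \<in> hom C (Cod C g) (Cod C f).
       s2 \<cdot> f = g \<cdot> s1 \<and> r2 \<cdot> g = f \<cdot> r1 \<and> r1 \<cdot> s1 = Idn C (Dom C f) \<and> r2 \<cdot> s2 = Idn C (Cod C f)
       \<and> s1 \<cdot> r1 = Idn C (Dom C g) \<and> s2 \<cdot> r2 = Idn C (Cod C g))"
  unfolding isomorphic_def hom_def[of "arrow_cat C"]
  using assms by (fastforce simp: arrow_cat_def)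

lemma isomorphic_refl: "x \<in> Obj C \<Longrightarrow> isomorphic C x x"
  unfolding isomorphic_def using Idn_in Comp_Idn by metis

lemma isomorphic_sym: "isomorphic C x y \<Longrightarrow> isomorphic C y x"
  unfolding isomorphic_def by blast

lemma isomorphic_trans:
  assumes "isomorphic C x y" "isomorphic C y z"
  shows "isomorphic C x z"
proof -
  obtain f g f' g' where fg: "f \<in> hom C x y" "g \<in> hom C y x" "g \<cdot> f = Idn C x" "f \<cdot> g = Idn C y"
     "f' \<in> hom C y z" "g' \<in> hom C z y" "g' \<cdot> f' = Idn C y" "f' \<cdot> g' = Idn C z"
    using assms unfolding isomorphic_def by auto
  have "(g \<cdot> g') \<cdot> (f' \<cdot> f) = Idn C x"
    using fg comp_left_eq[OF fg(7,5,6,1)] by (auto simp: hom_def)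
  moreover have "(f' \<cdot> f) \<cdot> (g \<cdot> g') = Idn C z"
    using fg comp_left_eq[OF fg(4,2,1,6)] by (auto simp: hom_def)
  ultimately show ?thesis unfolding isomorphic_def using fg Comp_in by meson
qed

lemma arrow_iso_trans:
  "isomorphic (arrow_cat C) f g \<Longrightarrow> isomorphic (arrow_cat C) g h \<Longrightarrow> isomorphic (arrow_cat C) f h"
  using category.isomorphic_trans[OF category_arrow_cat] .

lemma arrow_iso_sym: "isomorphic (arrow_cat C) f g \<Longrightarrow> isomorphic (arrow_cat C) g f"
  using category.isomorphic_sym[OF category_arrow_cat] .

lemma arrow_iso_refl: "f \<in> Arr C \<Longrightarrow> isomorphic (arrow_cat C) f f"
  using category.isomorphic_refl[OF category_arrow_cat, of f] by (simp add: arrow_cat_def)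

lemma isomorphic_imp_retract: "isomorphic C x y \<Longrightarrow> retract_of C x y"
  unfolding isomorphic_def retract_of_def by blast

text \<open>One square suffices: conjugating it with the inverses \<open>r1\<close> and
  \<open>r2\<close> yields the square in the other direction.\<close>

lemma arrow_isoI:
  assumes f: "f \<in> hom C x y" and g: "g \<in> hom C x' y'" and s: "s1 \<in> hom C x x'" "s2 \<in> hom C y y'"
    and r: "r1 \<in> hom C x' x" "r2 \<in> hom C y' y" and sq: "s2 \<cdot> f = g \<cdot> s1"
    and inv: "r1 \<cdot> s1 = Idn C x" "s1 \<cdot> r1 = Idn C x'" "r2 \<cdot> s2 = Idn C y" "s2 \<cdot> r2 = Idn C y'"
  shows "isomorphic (arrow_cat C) f g"
proof -
  have "r2 \<cdot> g = r2 \<cdot> (g \<cdot> (s1 \<cdot> r1))" using g inv by (simp add: hom_def)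
  also have "\<dots> = r2 \<cdot> ((s2 \<cdot> f) \<cdot> r1)" unfolding sq using g s r by (simp add: hom_def)
  also have "\<dots> = r2 \<cdot> (s2 \<cdot> (f \<cdot> r1))" using f s r by (simp add: hom_def)
  also have "\<dots> = f \<cdot> r1" using comp_left_eq[OF inv(3) s(2) r(2) Comp_in[OF r(1) f]] f r by (simp add: hom_def)
  finally have "r2 \<cdot> g = f \<cdot> r1" .
  moreover have "f \<in> Arr C" "g \<in> Arr C" "Dom C f = x" "Cod C f = y" "Dom C g = x'" "Cod C g = y'"
    using f g by (auto simp: hom_def)
  ultimately show ?thesis
    using isomorphic_arrow_iff[of f g] s r sq inv by blast
qed

lemma arrow_iso_comp_left:
  assumes f: "f \<in> hom C x y" and u: "u \<in> hom C y y'" and v: "v \<in> hom C y' y"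
    and "v \<cdot> u = Idn C y" "u \<cdot> v = Idn C y'"
  shows "isomorphic (arrow_cat C) (u \<cdot> f) f"
proof -
  have x: "x \<in> Obj C" using f hom_Obj by blast
  have "v \<cdot> (u \<cdot> f) = f \<cdot> Idn C x" using comp_left_eq[OF assms(4) u v f] f by (simp add: hom_def)
  from arrow_isoI[OF Comp_in[OF f u] f Idn_in[OF x] v Idn_in[OF x] u this]
  show ?thesis using x assms by simp
qed

lemma arrow_iso_comp_right:
  assumes f: "f \<in> hom C y z" and u: "u \<in> hom C y' y" and v: "v \<in> hom C y y'"
    and "v \<cdot> u = Idn C y'" "u \<cdot> v = Idn C y"
  shows "isomorphic (arrow_cat C) (f \<cdot> u) f"
proof -
  have z: "z \<in> Obj C" using f hom_Obj by blast
  have "Idn C z \<cdot> (f \<cdot> u) = f \<cdot> u" using Idn_Comp[OF Comp_in[OF u f]] .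
  from arrow_isoI[OF Comp_in[OF u f] f u Idn_in[OF z] v Idn_in[OF z] this]
  show ?thesis using z assms by simp
qed

text \<open>A lifting problem against \<open>p\<close> is carried into one against \<open>q\<close>
  by the section \<open>(s1, s2)\<close>; its solution comes back along \<open>r1\<close>, and the
  retraction identities restore the original data.\<close>

lemma lifts_retract_right:
  assumes "i \<in> Arr C" "p \<in> Arr C" "q \<in> Arr C" "retract_of (arrow_cat C) p q" "lifts C i q"
  shows "lifts C i p"
  unfolding lifts_def
proof (intro ballI impI)
  obtain s1 s2 r1 r2 where r: "s1 \<in> hom C (Dom C p) (Dom C q)" "s2 \<in> hom C (Cod C p) (Cod C q)"
    "r1 \<in> hom C (Dom C q) (Dom C p)" "r2 \<in> hom C (Cod C q) (Cod C p)"
    "s2 \<cdot> p = q \<cdot> s1" "r2 \<cdot> q = p \<cdot> r1" "r1 \<cdot> s1 = Idn C (Dom C p)" "r2 \<cdot> s2 = Idn C (Cod C p)"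
    using assms(4) unfolding retract_of_arrow_iff[OF assms(2,3)] by blast
  fix u v assume uv: "u \<in> hom C (Dom C i) (Dom C p)" "v \<in> hom C (Cod C i) (Cod C p)" "p \<cdot> u = v \<cdot> i"
  have "q \<cdot> (s1 \<cdot> u) = (s2 \<cdot> v) \<cdot> i"
    using uv r assms(1-3) comp_left_eq[OF r(5) hom_Dom_Cod[OF assms(2)] r(2) uv(1)]
    by (simp add: hom_def)
  moreover have "s1 \<cdot> u \<in> hom C (Dom C i) (Dom C q)" "s2 \<cdot> v \<in> hom C (Cod C i) (Cod C q)"
    using r uv Comp_in by blast+
  ultimately obtain h where h: "h \<in> hom C (Cod C i) (Dom C q)" "h \<cdot> i = s1 \<cdot> u" "q \<cdot> h = s2 \<cdot> v"
    using assms(5) unfolding lifts_def by blast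
  have "(r1 \<cdot> h) \<cdot> i = u"
    using h uv r assms(1) comp_left_eq[OF r(7) r(1,3) uv(1)] by (simp add: hom_def)
  moreover have "p \<cdot> (r1 \<cdot> h) = v"
    using h uv r assms(2,3) comp_left_eq[OF r(6) hom_Dom_Cod[OF assms(3)] r(4) h(1)]
       comp_left_eq[OF r(8) r(2,4) uv(2)] by (simp add: hom_def)
  ultimately show "\<exists>h\<in>hom C (Cod C i) (Dom C p). h \<cdot> i = u \<and> p \<cdot> h = v"
    using Comp_in[OF h(1) r(3)] by blast
qed

lemma lifts_retract_left:
  assumes "i \<in> Arr C" "j \<in> Arr C" "p \<in> Arr C" "retract_of (arrow_cat C) i j" "lifts C j p"
  shows "lifts C i p"
  unfolding lifts_def
proof (intro ballI impI)
  obtain s1 s2 r1 r2 where r: "s1 \<in> hom C (Dom C i) (Dom C j)" "s2 \<in> hom C (Cod C i) (Cod C j)"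
    "r1 \<in> hom C (Dom C j) (Dom C i)" "r2 \<in> hom C (Cod C j) (Cod C i)"
    "s2 \<cdot> i = j \<cdot> s1" "r2 \<cdot> j = i \<cdot> r1" "r1 \<cdot> s1 = Idn C (Dom C i)" "r2 \<cdot> s2 = Idn C (Cod C i)"
    using assms(4) unfolding retract_of_arrow_iff[OF assms(1,2)] by blast
  fix u v assume uv: "u \<in> hom C (Dom C i) (Dom C p)" "v \<in> hom C (Cod C i) (Cod C p)" "p \<cdot> u = v \<cdot> i"
  have "p \<cdot> (u \<cdot> r1) = (v \<cdot> r2) \<cdot> j"
    using uv r assms(1-3) comp_left_eq[OF uv(3) uv(1) hom_Dom_Cod[OF assms(3)] r(3)]
    by (simp add: hom_def)
  moreover have "u \<cdot> r1 \<in> hom C (Dom C j) (Dom C p)" "v \<cdot> r2 \<in> hom C (Cod C j) (Cod C p)"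
    using r uv Comp_in by blast+
  ultimately obtain h where h: "h \<in> hom C (Cod C j) (Dom C p)" "h \<cdot> j = u \<cdot> r1" "p \<cdot> h = v \<cdot> r2"
    using assms(5) unfolding lifts_def by blast
  have "(h \<cdot> s2) \<cdot> i = u"
    using h uv r assms(1,2) comp_left_eq[OF h(2) hom_Dom_Cod[OF assms(2)] h(1) r(1)]
    by (simp add: hom_def)
  moreover have "p \<cdot> (h \<cdot> s2) = v"
    using h uv r assms comp_left_eq[OF h(3) h(1) hom_Dom_Cod[OF assms(3)] r(2)] by (simp add: hom_def)
  ultimately show "\<exists>h\<in>hom C (Cod C i) (Dom C p). h \<cdot> i = u \<and> p \<cdot> h = v"
    using Comp_in[OF r(2) h(1)] by blast
qed

lemma retracts_incl: "M \<subseteq> Arr C \<Longrightarrow> M \<subseteq> retracts C M"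
  using arrow_iso_refl category.isomorphic_imp_retract[OF category_arrow_cat]
  unfolding retracts_def by blast

lemma left_orth_retracts:
  assumes "M \<subseteq> Arr C"
  shows "left_orth C (retracts C M) = left_orth C M"
  using retracts_incl[OF assms] lifts_retract_right assms
  unfolding left_orth_def retracts_def by blast

lemma left_orth_iso_closure:
  assumes "M \<subseteq> Arr C"
  shows "left_orth C M \<subseteq> left_orth C (iso_closure C M)"
  using lifts_retract_right assms category.isomorphic_imp_retract[OF category_arrow_cat]
  unfolding left_orth_def iso_closure_def by blast

lemma iso_closureI:
  "f \<in> Arr C \<Longrightarrow> g \<in> M \<Longrightarrow> isomorphic (arrow_cat C) f g \<Longrightarrow> f \<in> iso_closure C M"
  unfolding iso_closure_def by blast

lemma iso_closure_incl: "M \<subseteq> Arr C \<Longrightarrow> M \<subseteq> iso_closure C M"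
  using arrow_iso_refl iso_closureI by blast

text \<open>The isomorphism between \<open>f\<close> and \<open>g\<close> is absorbed at the two
  ends: \<open>n \<cdot> s1\<close> differs from \<open>n\<close>, and \<open>r2 \<cdot> m\<close>
  from \<open>m\<close>, only by an invertible factor, so both stay in the isomorphism
  closures.\<close>

lemma factor_iso_closure:
  assumes fg: "f \<in> Arr C" "g \<in> Arr C" "isomorphic (arrow_cat C) f g"
    and nm: "n \<in> N" "n \<in> Arr C" "m \<in> M" "m \<in> Arr C" "Cod C n = Dom C m" "m \<cdot> n = g"
  shows "\<exists>n' \<in> iso_closure C N. \<exists>m' \<in> iso_closure C M. Cod C n' = Dom C m' \<and> m' \<cdot> n' = f"
proof -
  obtain s1 s2 r1 r2 where r: "s1 \<in> hom C (Dom C f) (Dom C g)" "s2 \<in> hom C (Cod C f) (Cod C g)"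
    "r1 \<in> hom C (Dom C g) (Dom C f)" "r2 \<in> hom C (Cod C g) (Cod C f)"
    "s2 \<cdot> f = g \<cdot> s1" "r2 \<cdot> g = f \<cdot> r1" "r1 \<cdot> s1 = Idn C (Dom C f)" "r2 \<cdot> s2 = Idn C (Cod C f)"
    "s1 \<cdot> r1 = Idn C (Dom C g)" "s2 \<cdot> r2 = Idn C (Cod C g)"
    using fg(3) unfolding isomorphic_arrow_iff[OF fg(1,2)] by blast
  have d: "Dom C g = Dom C n" "Cod C g = Cod C m" using nm by auto
  have n: "n \<in> hom C (Dom C g) (Cod C n)" and m: "m \<in> hom C (Dom C m) (Cod C g)"
    using nm d by (auto simp: hom_def)
  have "n \<cdot> s1 \<in> iso_closure C N"
    using arrow_iso_comp_right[OF n r(1,3,7,9)] nm r(1) d by (intro iso_closureI) (auto simp: hom_def)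
  moreover have "r2 \<cdot> m \<in> iso_closure C M"
    using arrow_iso_comp_left[OF m r(4,2,10,8)] nm r(4) d by (intro iso_closureI) (auto simp: hom_def)
  moreover have "Cod C (n \<cdot> s1) = Dom C (r2 \<cdot> m)" using nm r d by (auto simp: hom_def)
  moreover have "(r2 \<cdot> m) \<cdot> (n \<cdot> s1) = f"
  proof -
    have "(r2 \<cdot> m) \<cdot> (n \<cdot> s1) = r2 \<cdot> ((m \<cdot> n) \<cdot> s1)" using nm(2,4,5) r d by (simp add: hom_def)
    also have "\<dots> = r2 \<cdot> (s2 \<cdot> f)" using nm(6) r by simp
    also have "\<dots> = f" using comp_left_eq[OF r(8) r(2,4) hom_Dom_Cod[OF fg(1)]] fg by simp
    finally show ?thesis .
  qed
  ultimately show ?thesis by blast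
qed

text \<open>The retract argument: \<open>g\<close> lifts against its own first factor
  \<open>n\<close>, and the lift in the square from \<open>n\<close> to \<open>g\<close> with an
  identity on top presents \<open>g\<close> as a retract of \<open>m\<close> over its
  codomain.\<close>

lemma right_orth_subset_retracts:
  assumes "all_factor C M N" "N \<subseteq> Arr C" "M \<subseteq> Arr C"
  shows "right_orth C N \<subseteq> retracts C M"
proof
  fix g assume g: "g \<in> right_orth C N"
  then have gA: "g \<in> Arr C" by (simp add: right_orth_def)
  obtain n m where nm: "n \<in> N" "m \<in> M" "Cod C n = Dom C m" "m \<cdot> n = g"
    using assms(1) gA unfolding all_factor_def by blast
  have nmA: "n \<in> Arr C" "m \<in> Arr C" using nm assms(2,3) by auto
  with nm(3,4) have A: "n \<in> Arr C" "m \<in> Arr C" "Dom C g = Dom C n" "Cod C g = Cod C m" by auto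
  have o: "Dom C g \<in> Obj C" "Cod C g \<in> Obj C" using gA Dom_in Cod_in by auto
  have "lifts C n g" using g nm by (simp add: right_orth_def)
  moreover have "Idn C (Dom C g) \<in> hom C (Dom C n) (Dom C g)" "m \<in> hom C (Cod C n) (Cod C g)"
    "g \<cdot> Idn C (Dom C g) = m \<cdot> n"
    using A nm o gA by (auto simp: hom_def)
  ultimately obtain h where h: "h \<in> hom C (Cod C n) (Dom C g)" "h \<cdot> n = Idn C (Dom C g)" "g \<cdot> h = m"
    unfolding lifts_def by metis
  have "retract_of (arrow_cat C) g m"
    unfolding retract_of_arrow_iff[OF gA A(2)]
    by (rule bexI[of _ n], rule bexI[of _ "Idn C (Cod C g)"], rule bexI[of _ h], rule bexI[of _ "Idn C (Cod C g)"])
       (use h nm A o gA in \<open>auto simp: hom_def\<close>)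
  then show "g \<in> retracts C M" unfolding retracts_def using gA nm by blast
qed

end

section \<open>Directed index categories\<close>

lemma diagram_Obj: "is_diagram C X \<Longrightarrow> i \<in> Obj (Idx X) \<Longrightarrow> OMap X i \<in> Obj C"
  and diagram_Idn: "is_diagram C X \<Longrightarrow> i \<in> Obj (Idx X) \<Longrightarrow> AMap X (Idn (Idx X) i) = Idn C (OMap X i)"
  and diagram_category: "is_diagram C X \<Longrightarrow> category (Idx X)"
  unfolding is_diagram_def by blast+

lemma diagram_hom:
  "is_diagram C X \<Longrightarrow> u \<in> hom (Idx X) i j \<Longrightarrow> AMap X u \<in> hom C (OMap X i) (OMap X j)"
  using category.hom_Obj[of "Idx X" u i j] unfolding is_diagram_def by blast

lemma diagram_comp:
  "is_diagram C X \<Longrightarrow> u \<in> hom (Idx X) i j \<Longrightarrow> v \<in> hom (Idx X) j k \<Longrightarrow>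
    AMap X (v \<cdot>\<^bsub>Idx X\<^esub> u) = AMap X v \<cdot>\<^bsub>C\<^esub> AMap X u"
  unfolding is_diagram_def hom_def by auto

lemma pro_objD:
  assumes "is_pro_obj C X"
  shows "is_diagram C X" "directed (Idx X)" "category (Idx X)" "Obj (Idx X) \<noteq> {}"
  using assms unfolding is_pro_obj_def directed_def by auto

context category
begin

lemma directed_equalize:
  assumes "directed C" "f \<in> hom C x y" "g \<in> hom C x y"
  obtains k h where "k \<in> Obj C" "h \<in> hom C k x" "f \<cdot> h = g \<cdot> h"
proof -
  have "x \<in> Obj C" "y \<in> Obj C" using assms hom_Obj by blast+
  then have "\<exists>u\<in>Obj C. \<exists>h\<in>hom C u x. f \<cdot> h = g \<cdot> h"
    using assms unfolding directed_def by simp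
  then show thesis using that by blast
qed

lemma directed_square:
  assumes "directed C" "v \<in> hom C x z" "w \<in> hom C y z"
  obtains k a b where "k \<in> Obj C" "a \<in> hom C k x" "b \<in> hom C k y" "v \<cdot> a = w \<cdot> b"
proof -
  have o: "x \<in> Obj C" "y \<in> Obj C" "z \<in> Obj C" using assms hom_Obj by blast+
  obtain k a b where k: "k \<in> Obj C" "a \<in> hom C k x" "b \<in> hom C k y"
    using assms(1) o unfolding directed_def by blast
  have "v \<cdot> a \<in> hom C k z" "w \<cdot> b \<in> hom C k z" using assms k Comp_in by blast+
  from directed_equalize[OF assms(1) this]
  obtain l e where e: "l \<in> Obj C" "e \<in> hom C l k" "(v \<cdot> a) \<cdot> e = (w \<cdot> b) \<cdot> e" .
  show ?thesis
    by (rule that[OF e(1) Comp_in[OF e(2) k(2)] Comp_in[OF e(2) k(3)]])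
       (use e(3) Comp_assoc[OF e(2) k(2) assms(2)] Comp_assoc[OF e(2) k(3) assms(3)] in simp)
qed

text \<open>Pattern for finitely many requirements at once: each can be met by going further out
  and, once met, survives going further out, so induction on the finite set meets them one after
  another.\<close>

lemma directed_finite_refine:
  assumes "directed C" "finite F" "k \<in> Obj C"
    and ex: "\<And>s k' h. s \<in> F \<Longrightarrow> h \<in> hom C k' k \<Longrightarrow> \<exists>k''. \<exists>g \<in> hom C k'' k'. Q s (h \<cdot> g)"
    and st: "\<And>s k' k'' h g. s \<in> F \<Longrightarrow> Q s h \<Longrightarrow> h \<in> hom C k' k \<Longrightarrow> g \<in> hom C k'' k' \<Longrightarrow> Q s (h \<cdot> g)"
  obtains k' h where "k' \<in> Obj C" "h \<in> hom C k' k" "\<forall>s \<in> F. Q s h"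
proof -
  have "\<exists>k'. \<exists>h \<in> hom C k' k. \<forall>s \<in> F. Q s h"
    using \<open>finite F\<close> ex st
  proof (induction F)
    case empty
    then show ?case using Idn_in[OF \<open>k \<in> Obj C\<close>] by auto
  next
    case (insert x F)
    have "\<exists>k'. \<exists>h \<in> hom C k' k. \<forall>s \<in> F. Q s h"
      by (rule insert.IH) (use insert.prems in \<open>blast+\<close>)
    then obtain k' h where h: "h \<in> hom C k' k" "\<forall>s \<in> F. Q s h" by blast
    obtain k'' g where g: "g \<in> hom C k'' k'" "Q x (h \<cdot> g)" using insert.prems(1)[of x h k'] h by blast
    have "\<forall>s \<in> insert x F. Q s (h \<cdot> g)" using g h insert.prems(2) by blast
    then show ?case using Comp_in[OF g(1) h(1)] by blast
  qed
  then show thesis using that hom_Obj by blast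
qed

lemma directed_finite_cone:
  assumes "directed C" "finite F" "\<And>s. s \<in> F \<Longrightarrow> x s \<in> Obj C"
  obtains k c where "k \<in> Obj C" "\<And>s. s \<in> F \<Longrightarrow> c s \<in> hom C k (x s)"
proof -
  obtain k where k: "k \<in> Obj C" using assms(1) unfolding directed_def by blast
  \<comment> \<open>A requirement may depend only on the arrow \<open>h\<close>, so the vertex of
    the cone is recovered as \<open>Dom C h\<close>.\<close>
  obtain k' h where h: "k' \<in> Obj C" "h \<in> hom C k' k" "\<forall>s \<in> F. hom C (Dom C h) (x s) \<noteq> {}"
  proof (rule directed_finite_refine[OF assms(1,2) k, of "\<lambda>s h. hom C (Dom C h) (x s) \<noteq> {}"])
    fix s k' h assume a: "s \<in> F" "h \<in> hom C k' k"
    then have "x s \<in> Obj C" "k' \<in> Obj C" using assms(3) hom_Obj by blast+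
    then obtain k'' where "k'' \<in> Obj C" "hom C k'' k' \<noteq> {}" "hom C k'' (x s) \<noteq> {}"
      using assms(1) unfolding directed_def by blast
    then obtain g where g: "g \<in> hom C k'' k'" "hom C k'' (x s) \<noteq> {}" by blast
    then have "Dom C (h \<cdot> g) = k''" using a by (simp add: hom_def)
    then show "\<exists>k''. \<exists>g\<in>hom C k'' k'. hom C (Dom C (h \<cdot> g)) (x s) \<noteq> {}" using g by metis
  next
    fix s k' k'' h g
    assume a: "hom C (Dom C h) (x s) \<noteq> {}" "h \<in> hom C k' k" "g \<in> hom C k'' k'"
    then obtain c where "c \<in> hom C k' (x s)" by (auto simp: hom_def)
    then have "c \<cdot> g \<in> hom C k'' (x s)" using a(3) Comp_in by blast
    moreover have "Dom C (h \<cdot> g) = k''" using a by (simp add: hom_def)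
    ultimately show "hom C (Dom C (h \<cdot> g)) (x s) \<noteq> {}" by auto
  qed
  then have "\<forall>s \<in> F. \<exists>c. c \<in> hom C k' (x s)" by (auto simp: hom_def)
  then show thesis using that h(1) by metis
qed

lemma directed_finite_equalize:
  assumes "directed C" "finite E" "k \<in> Obj C"
    and "\<And>f g. (f, g) \<in> E \<Longrightarrow> \<exists>y. f \<in> hom C k y \<and> g \<in> hom C k y"
  obtains k' h where "k' \<in> Obj C" "h \<in> hom C k' k" "\<And>f g. (f, g) \<in> E \<Longrightarrow> f \<cdot> h = g \<cdot> h"
proof (rule directed_finite_refine[OF assms(1-3), of "\<lambda>s h. fst s \<cdot> h = snd s \<cdot> h"])
  fix s k' h assume a: "s \<in> E" "h \<in> hom C k' k"
  obtain f g y where s: "s = (f, g)" "f \<in> hom C k y" "g \<in> hom C k y"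
    using assms(4) a(1) by (metis surj_pair)
  have "f \<cdot> h \<in> hom C k' y" "g \<cdot> h \<in> hom C k' y" using s a Comp_in by blast+
  from directed_equalize[OF assms(1) this]
  obtain k'' e where e: "k'' \<in> Obj C" "e \<in> hom C k'' k'" "(f \<cdot> h) \<cdot> e = (g \<cdot> h) \<cdot> e" .
  then show "\<exists>k''. \<exists>e\<in>hom C k'' k'. fst s \<cdot> (h \<cdot> e) = snd s \<cdot> (h \<cdot> e)"
    using Comp_assoc[OF e(2) a(2) s(2)] Comp_assoc[OF e(2) a(2) s(3)] s(1) by auto
next
  fix s k' k'' h e assume a: "s \<in> E" "fst s \<cdot> h = snd s \<cdot> h" "h \<in> hom C k' k" "e \<in> hom C k'' k'"
  obtain f g y where s: "s = (f, g)" "f \<in> hom C k y" "g \<in> hom C k y"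
    using assms(4) a(1) by (metis surj_pair)
  have "f \<cdot> (h \<cdot> e) = (f \<cdot> h) \<cdot> e" "g \<cdot> (h \<cdot> e) = (g \<cdot> h) \<cdot> e"
    using Comp_assoc[OF a(4,3) s(2)] Comp_assoc[OF a(4,3) s(3)] by simp_all
  then show "fst s \<cdot> (h \<cdot> e) = snd s \<cdot> (h \<cdot> e)" using s a by simp
next
  fix k' h assume "k' \<in> Obj C" "h \<in> hom C k' k" "\<forall>s\<in>E. fst s \<cdot> h = snd s \<cdot> h"
  then show thesis using that by fastforce
qed

section \<open>Morphisms from a pro-object to an object\<close>

lemma class_restrict:
  assumes "is_diagram C X" "t \<in> Obj (Idx X)" "f \<in> hom C (OMap X t) c" "u \<in> hom (Idx X) t' t"
  shows "colim_class C X c t' (f \<cdot> AMap X u) = colim_class C X c t f"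
proof -
  have "t' \<in> Obj (Idx X)" using category.hom_Obj[OF diagram_category[OF assms(1)] assms(4)] by blast
  then have "((t, f), (t', f \<cdot> AMap X u)) \<in> colim_step C X c"
    using assms unfolding colim_step_def by blast
  then show ?thesis unfolding class_eq_iff colim_rel_def
    by (intro r_into_rtrancl) blast
qed

text \<open>The relation is generated by zigzags. Induction along the zigzag keeps a single span
  from \<open>k\<close> over both ends: directedness closes a square when the next term is a
  restriction of the current one, and composition suffices in the opposite direction. The typing of
  the second representative is carried along because only the first is given.\<close>

lemma class_eqD:
  assumes X: "is_pro_obj C X" and t: "t \<in> Obj (Idx X)" "f \<in> hom C (OMap X t) c"
    and eq: "colim_class C X c t f = colim_class C X c t' f'"
  obtains k u v where "k \<in> Obj (Idx X)" "u \<in> hom (Idx X) k t" "v \<in> hom (Idx X) k t'"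
    "f \<cdot> AMap X u = f' \<cdot> AMap X v"
proof -
  note D = pro_objD(1)[OF X]
  interpret I: category "Idx X" using pro_objD(3)[OF X] .
  note dh = diagram_hom[OF D] and dc = diagram_comp[OF D]
  have "((t,f),(t',f')) \<in> (colim_step C X c \<union> (colim_step C X c)\<inverse>)\<^sup>*"
    using eq unfolding class_eq_iff colim_rel_def .
  then have "\<exists>k u v. k \<in> Obj (Idx X) \<and> u \<in> hom (Idx X) k t \<and> v \<in> hom (Idx X) k (fst (t',f'))
     \<and> f \<cdot> AMap X u = snd (t',f') \<cdot> AMap X v \<and> snd (t',f') \<in> hom C (OMap X (fst (t',f'))) c"
  proof (induction rule: rtrancl_induct)
    case base
    then show ?case using I.Idn_in[OF t(1)] t by auto
  next
    case (step y z)
    then obtain k u v where k: "k \<in> Obj (Idx X)" "u \<in> hom (Idx X) k t" "v \<in> hom (Idx X) k (fst y)"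
     "f \<cdot> AMap X u = snd y \<cdot> AMap X v" "snd y \<in> hom C (OMap X (fst y)) c" by blast
    from step(2) show ?case
    proof
      assume "(y, z) \<in> colim_step C X c"
      then obtain w where w: "w \<in> hom (Idx X) (fst z) (fst y)" "snd z = snd y \<cdot> AMap X w"
        unfolding colim_step_def by auto
      obtain l a b where l: "l \<in> Obj (Idx X)" "a \<in> hom (Idx X) l k" "b \<in> hom (Idx X) l (fst z)"
        "v \<cdot>\<^bsub>Idx X\<^esub> a = w \<cdot>\<^bsub>Idx X\<^esub> b"
        using I.directed_square[OF pro_objD(2)[OF X] k(3) w(1)] .
      have "f \<cdot> AMap X (u \<cdot>\<^bsub>Idx X\<^esub> a) = (f \<cdot> AMap X u) \<cdot> AMap X a"
        using dc[OF l(2) k(2)] Comp_assoc[OF dh[OF l(2)] dh[OF k(2)] t(2)] by simp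
      also have "\<dots> = snd y \<cdot> AMap X (v \<cdot>\<^bsub>Idx X\<^esub> a)"
        using dc[OF l(2) k(3)] Comp_assoc[OF dh[OF l(2)] dh[OF k(3)] k(5)] k(4) by simp
      also have "\<dots> = snd z \<cdot> AMap X b"
        using dc[OF l(3) w(1)] Comp_assoc[OF dh[OF l(3)] dh[OF w(1)] k(5)] l(4) w(2) by simp
      finally show ?case
        using l k w I.Comp_in[OF l(2) k(2)] Comp_in[OF dh[OF w(1)] k(5)] by metis
    next
      assume "(y, z) \<in> (colim_step C X c)\<inverse>"
      then obtain w where w: "w \<in> hom (Idx X) (fst y) (fst z)" "snd y = snd z \<cdot> AMap X w"
        "snd z \<in> hom C (OMap X (fst z)) c"
        unfolding colim_step_def by auto
      have "snd z \<cdot> AMap X (w \<cdot>\<^bsub>Idx X\<^esub> v) = snd y \<cdot> AMap X v"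
        using dc[OF k(3) w(1)] Comp_assoc[OF dh[OF k(3)] dh[OF w(1)] w(3)] w(2) by simp
      then show ?case using k w I.Comp_in[OF k(3) w(1)] by metis
    qed
  qed
  then show thesis using that by auto
qed

text \<open>A span with two different legs is turned into one with equal legs by equalizing the legs
  further out.\<close>

lemma class_eqD_same:
  assumes X: "is_pro_obj C X" and t: "t \<in> Obj (Idx X)" "f \<in> hom C (OMap X t) c" "f' \<in> hom C (OMap X t) c"
    and eq: "colim_class C X c t f = colim_class C X c t f'"
  obtains k u where "k \<in> Obj (Idx X)" "u \<in> hom (Idx X) k t" "f \<cdot> AMap X u = f' \<cdot> AMap X u"
proof -
  note D = pro_objD(1)[OF X]
  interpret I: category "Idx X" using pro_objD(3)[OF X] .
  note dh = diagram_hom[OF D] and dc = diagram_comp[OF D]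
  obtain k u v where k: "k \<in> Obj (Idx X)" "u \<in> hom (Idx X) k t" "v \<in> hom (Idx X) k t"
    "f \<cdot> AMap X u = f' \<cdot> AMap X v"
    using class_eqD[OF X t(1,2) eq] .
  obtain l e where e: "l \<in> Obj (Idx X)" "e \<in> hom (Idx X) l k" "u \<cdot>\<^bsub>Idx X\<^esub> e = v \<cdot>\<^bsub>Idx X\<^esub> e"
    using I.directed_equalize[OF pro_objD(2)[OF X] k(2,3)] .
  have "f \<cdot> AMap X (u \<cdot>\<^bsub>Idx X\<^esub> e) = (f \<cdot> AMap X u) \<cdot> AMap X e"
    using dc[OF e(2) k(2)] Comp_assoc[OF dh[OF e(2)] dh[OF k(2)] t(2)] by simp
  also have "\<dots> = f' \<cdot> AMap X (u \<cdot>\<^bsub>Idx X\<^esub> e)"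
    unfolding e(3) using dc[OF e(2) k(3)] Comp_assoc[OF dh[OF e(2)] dh[OF k(3)] t(3)] k(4) by simp
  finally show thesis using that e(1) I.Comp_in[OF e(2) k(2)] by blast
qed

lemma finite_classes_eqD:
  assumes X: "is_pro_obj C X" and t: "t \<in> Obj (Idx X)" and "finite E"
    and E: "\<And>e. e \<in> E \<Longrightarrow> f e \<in> hom C (OMap X t) (c e)" "\<And>e. e \<in> E \<Longrightarrow> f' e \<in> hom C (OMap X t) (c e)"
      "\<And>e. e \<in> E \<Longrightarrow> colim_class C X (c e) t (f e) = colim_class C X (c e) t (f' e)"
  obtains k u where "k \<in> Obj (Idx X)" "u \<in> hom (Idx X) k t" "\<And>e. e \<in> E \<Longrightarrow> f e \<cdot> AMap X u = f' e \<cdot> AMap X u"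
proof -
  note D = pro_objD(1)[OF X]
  interpret I: category "Idx X" using pro_objD(3)[OF X] .
  note dh = diagram_hom[OF D] and dc = diagram_comp[OF D]
  show thesis
  proof (rule I.directed_finite_refine[OF pro_objD(2)[OF X] \<open>finite E\<close> t, of "\<lambda>e u. f e \<cdot> AMap X u = f' e \<cdot> AMap X u"])
    fix e k' h assume e: "e \<in> E" and h: "h \<in> hom (Idx X) k' t"
    have k': "k' \<in> Obj (Idx X)" using I.hom_Obj[OF h] by blast
    have "colim_class C X (c e) k' (f e \<cdot> AMap X h) = colim_class C X (c e) k' (f' e \<cdot> AMap X h)"
      using class_restrict[OF D t E(1)[OF e] h] class_restrict[OF D t E(2)[OF e] h] E(3)[OF e] by simp
    from class_eqD_same[OF X k' _ _ this] obtain k'' g where g: "g \<in> hom (Idx X) k'' k'"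
      "(f e \<cdot> AMap X h) \<cdot> AMap X g = (f' e \<cdot> AMap X h) \<cdot> AMap X g"
      using Comp_in[OF dh[OF h]] E[OF e] by metis
    then have "f e \<cdot> AMap X (h \<cdot>\<^bsub>Idx X\<^esub> g) = f' e \<cdot> AMap X (h \<cdot>\<^bsub>Idx X\<^esub> g)"
      using dc[OF g(1) h] Comp_assoc[OF dh[OF g(1)] dh[OF h] E(1)[OF e]]
        Comp_assoc[OF dh[OF g(1)] dh[OF h] E(2)[OF e]] by simp
    then show "\<exists>k''. \<exists>g\<in>hom (Idx X) k'' k'.
        f e \<cdot> AMap X (h \<cdot>\<^bsub>Idx X\<^esub> g) = f' e \<cdot> AMap X (h \<cdot>\<^bsub>Idx X\<^esub> g)"
      using g(1) by blast
  next
    fix e k' k'' h g assume e: "e \<in> E" and eq: "f e \<cdot> AMap X h = f' e \<cdot> AMap X h"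
      and h: "h \<in> hom (Idx X) k' t" and g: "g \<in> hom (Idx X) k'' k'"
    show "f e \<cdot> AMap X (h \<cdot>\<^bsub>Idx X\<^esub> g) = f' e \<cdot> AMap X (h \<cdot>\<^bsub>Idx X\<^esub> g)"
      using dc[OF g h] Comp_assoc[OF dh[OF g] dh[OF h] E(1)[OF e]]
        Comp_assoc[OF dh[OF g] dh[OF h] E(2)[OF e]] eq by simp
  next
    fix k' h assume "k' \<in> Obj (Idx X)" "h \<in> hom (Idx X) k' t" "\<forall>s\<in>E. f s \<cdot> AMap X h = f' s \<cdot> AMap X h"
    then show thesis using that by blast
  qed
qed

text \<open>The individual representatives live at different stages; a cone over those stages moves
  them to a common one.\<close>

lemma finite_classes_rep:
  assumes X: "is_pro_obj C X" and "finite F" and x: "\<And>s. s \<in> F \<Longrightarrow> x s \<in> colim_hom C X (c s)"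
  obtains k w where "k \<in> Obj (Idx X)" "\<And>s. s \<in> F \<Longrightarrow> w s \<in> hom C (OMap X k) (c s)"
    "\<And>s. s \<in> F \<Longrightarrow> x s = colim_class C X (c s) k (w s)"
proof -
  note D = pro_objD(1)[OF X]
  interpret I: category "Idx X" using pro_objD(3)[OF X] .
  have "\<exists>t f. t \<in> Obj (Idx X) \<and> f \<in> hom C (OMap X t) (c s) \<and> x s = colim_class C X (c s) t f" if "s \<in> F" for s
    using colim_homE[OF x[OF that]] by metis
  then obtain t f where tf: "\<And>s. s \<in> F \<Longrightarrow> t s \<in> Obj (Idx X)" "\<And>s. s \<in> F \<Longrightarrow> f s \<in> hom C (OMap X (t s)) (c s)"
    "\<And>s. s \<in> F \<Longrightarrow> x s = colim_class C X (c s) (t s) (f s)" by metis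
  obtain k u where k: "k \<in> Obj (Idx X)" "\<And>s. s \<in> F \<Longrightarrow> u s \<in> hom (Idx X) k (t s)"
    using I.directed_finite_cone[OF pro_objD(2)[OF X] \<open>finite F\<close>, of t] tf(1) by blast
  show thesis
    by (rule that[of k "\<lambda>s. f s \<cdot> AMap X (u s)"])
       (use k tf Comp_in[OF diagram_hom[OF D k(2)]] class_restrict[OF D tf(1) tf(2) k(2)] in auto)
qed

lemma push_in: "is_diagram C X \<Longrightarrow> x \<in> colim_hom C X c \<Longrightarrow> g \<in> hom C c d \<Longrightarrow> colim_push C X d g x \<in> colim_hom C X d"
  by (erule colim_homE) (simp add: push_class colim_class_in Comp_in)

lemma push_push:
  assumes "is_diagram C X" "x \<in> colim_hom C X c" "g \<in> hom C c d" "h \<in> hom C d e"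
  shows "colim_push C X e h (colim_push C X d g x) = colim_push C X e (h \<cdot> g) x"
proof -
  obtain t f where t: "t \<in> Obj (Idx X)" "f \<in> hom C (OMap X t) c" "x = colim_class C X c t f"
    using assms(2) by (rule colim_homE)
  show ?thesis unfolding t(3) push_class[OF assms(1) t(1,2) assms(3)]
    push_class[OF assms(1) t(1,2) Comp_in[OF assms(3,4)]]
    push_class[OF assms(1) t(1) Comp_in[OF t(2) assms(3)] assms(4)]
    Comp_assoc[OF t(2) assms(3,4)] ..
qed

lemma push_Idn:
  assumes "is_diagram C X" "x \<in> colim_hom C X c" "c \<in> Obj C"
  shows "colim_push C X c (Idn C c) x = x"
proof -
  obtain t f where t: "t \<in> Obj (Idx X)" "f \<in> hom C (OMap X t) c" "x = colim_class C X c t f"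
    using assms(2) by (rule colim_homE)
  show ?thesis unfolding t(3) push_class[OF assms(1) t(1,2) Idn_in[OF assms(3)]] Idn_Comp[OF t(2)] ..
qed

text \<open>Precomposition with a morphism \<open>F\<close> of pro-objects with domain \<open>A\<close>.\<close>

definition pro_pull ::
    "('i, 'o, 'a) pro_obj \<Rightarrow> 'o \<Rightarrow> ('i \<Rightarrow> ('i \<times> 'a) set) \<Rightarrow> ('i \<times> 'a) set \<Rightarrow> ('i \<times> 'a) set" where
  "pro_pull A c F K = (\<Union>(t, g) \<in> K. \<Union>(r, f) \<in> F t. colim_class C A c r (g \<cdot> f))"

lemma pro_comp_pull:
  "pro_comp C X Z G F = (\<lambda>s. if s \<in> Obj (Idx Z) then pro_pull X (OMap Z s) F (G s) else undefined)"
  unfolding pro_comp_def pro_pull_def ..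

lemma pro_homD:
  assumes "F \<in> pro_hom C A B"
  shows "s \<in> Obj (Idx B) \<Longrightarrow> F s \<in> colim_hom C A (OMap B s)"
    "s \<in> Obj (Idx B) \<Longrightarrow> s' \<in> Obj (Idx B) \<Longrightarrow> u \<in> hom (Idx B) s s' \<Longrightarrow> colim_push C A (OMap B s') (AMap B u) (F s) = F s'"
    "s \<notin> Obj (Idx B) \<Longrightarrow> F s = undefined"
  using assms unfolding pro_hom_def by auto

lemma pro_hom_ext:
  assumes "F \<in> pro_hom C A B" "G \<in> pro_hom C A B" "\<And>s. s \<in> Obj (Idx B) \<Longrightarrow> F s = G s"
  shows "F = G"
  using assms unfolding pro_hom_def by fastforce

lemma pull_class:
  assumes A: "is_diagram C A" and B: "is_diagram C B" and F: "F \<in> pro_hom C A B"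
    and g: "t \<in> Obj (Idx B)" "g \<in> hom C (OMap B t) c"
  shows "pro_pull A c F (colim_class C B c t g) = colim_push C A c g (F t)"
proof -
  obtain r f where f: "r \<in> Obj (Idx A)" "f \<in> hom C (OMap A r) (OMap B t)" "(r,f) \<in> F t"
      "F t = colim_class C A (OMap B t) r f"
    using pro_hom_rep[OF A F g(1)] .
  have "colim_class C A c r' (g' \<cdot> f') = colim_class C A c r (g \<cdot> f)"
    if "(t',g') \<in> colim_class C B c t g" "(r',f') \<in> F t'" for t' g' r' f'
  proof -
    have "((t,g),(t',g')) \<in> colim_rel C B c" using that(1) by (simp add: colim_class_def)
    from comp_wd[OF A B F this] g that f show ?thesis by (auto simp: colim_total_def)
  qed
  moreover have "(t, g) \<in> colim_class C B c t g" by (simp add: mem_class)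
  ultimately have "pro_pull A c F (colim_class C B c t g) = colim_class C A c r (g \<cdot> f)"
    unfolding pro_pull_def using f(3) by fast
  then show ?thesis unfolding f(4) push_class[OF A f(1,2) g(2)] .
qed

context
  fixes A B :: "('i, 'o, 'a) pro_obj" and F
  assumes A: "is_diagram C A" and B: "is_diagram C B" and F: "F \<in> pro_hom C A B"
begin

lemma pull_in: "x \<in> colim_hom C B c \<Longrightarrow> pro_pull A c F x \<in> colim_hom C A c"
  by (erule colim_homE) (simp add: pull_class[OF A B F], rule push_in[OF A pro_homD(1)[OF F]])

lemma pull_push:
  assumes "x \<in> colim_hom C B c" "g \<in> hom C c d"
  shows "pro_pull A d F (colim_push C B d g x) = colim_push C A d g (pro_pull A c F x)"
proof -
  obtain t f where t: "t \<in> Obj (Idx B)" "f \<in> hom C (OMap B t) c" "x = colim_class C B c t f"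
    using assms(1) by (rule colim_homE)
  show ?thesis unfolding t(3) push_class[OF B t(1,2) assms(2)] pull_class[OF A B F t(1,2)]
    pull_class[OF A B F t(1) Comp_in[OF t(2) assms(2)]]
    push_push[OF A pro_homD(1)[OF F t(1)] t(2) assms(2)] ..
qed

end

section \<open>Finite limits and morphisms from pro-objects\<close>

text \<open>Filtered colimits of sets commute with finite limits, existence part: move the finitely
  many classes to a common stage, go out far enough that the arrows of the diagram commute with the
  representatives on the nose, and factor the resulting cone in \<open>C\<close>.\<close>

lemma limit_cone_class_ex:
  assumes A: "is_pro_obj C A" and fin: "finite (Obj (Idx D))" "finite (Arr (Idx D))"
    and D: "is_diagram C D" and L: "limit_cone C D L \<pi>"
    and x: "\<And>s. s \<in> Obj (Idx D) \<Longrightarrow> x s \<in> colim_hom C A (OMap D s)"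
    and comp: "\<And>s s' u. s \<in> Obj (Idx D) \<Longrightarrow> s' \<in> Obj (Idx D) \<Longrightarrow> u \<in> hom (Idx D) s s' \<Longrightarrow>
      colim_push C A (OMap D s') (AMap D u) (x s) = x s'"
  shows "\<exists>z \<in> colim_hom C A L. \<forall>s \<in> Obj (Idx D). colim_push C A (OMap D s) (\<pi> s) z = x s"
proof -
  note dA = pro_objD(1)[OF A]
  interpret D: category "Idx D" using diagram_category[OF D] .
  obtain k w where k: "k \<in> Obj (Idx A)" and w: "\<And>s. s \<in> Obj (Idx D) \<Longrightarrow> w s \<in> hom C (OMap A k) (OMap D s)"
    "\<And>s. s \<in> Obj (Idx D) \<Longrightarrow> x s = colim_class C A (OMap D s) k (w s)"
    by (rule finite_classes_rep[OF A fin(1), of x "OMap D"]) (use x in auto)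
  obtain l v where l: "l \<in> Obj (Idx A)" "v \<in> hom (Idx A) l k"
    and v: "\<And>u. u \<in> Arr (Idx D) \<Longrightarrow> (AMap D u \<cdot> w (Dom (Idx D) u)) \<cdot> AMap A v = w (Cod (Idx D) u) \<cdot> AMap A v"
  proof (rule finite_classes_eqD[OF A k fin(2), of "\<lambda>u. AMap D u \<cdot> w (Dom (Idx D) u)" "\<lambda>u. OMap D (Cod (Idx D) u)" "\<lambda>u. w (Cod (Idx D) u)"])
    fix u assume u: "u \<in> Arr (Idx D)"
    have o: "Dom (Idx D) u \<in> Obj (Idx D)" "Cod (Idx D) u \<in> Obj (Idx D)" using u D.Dom_in D.Cod_in by auto
    have u': "u \<in> hom (Idx D) (Dom (Idx D) u) (Cod (Idx D) u)" using D.hom_Dom_Cod u by blast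
    note Du = diagram_hom[OF D u']
    show "AMap D u \<cdot> w (Dom (Idx D) u) \<in> hom C (OMap A k) (OMap D (Cod (Idx D) u))"
      "w (Cod (Idx D) u) \<in> hom C (OMap A k) (OMap D (Cod (Idx D) u))"
      using Comp_in[OF w(1)[OF o(1)] Du] w(1)[OF o(2)] by auto
    show "colim_class C A (OMap D (Cod (Idx D) u)) k (AMap D u \<cdot> w (Dom (Idx D) u))
        = colim_class C A (OMap D (Cod (Idx D) u)) k (w (Cod (Idx D) u))"
      using comp[OF o u'] unfolding w(2)[OF o(1)] w(2)[OF o(2)] push_class[OF dA k w(1)[OF o(1)] Du] .
  qed (rule that)
  note Av = diagram_hom[OF dA l(2)]
  define y where "y s = w s \<cdot> AMap A v" for s
  have y: "y s \<in> hom C (OMap A l) (OMap D s)" "x s = colim_class C A (OMap D s) l (y s)" if "s \<in> Obj (Idx D)" for s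
    using Comp_in[OF Av w(1)[OF that]] class_restrict[OF dA k w(1)[OF that] l(2)] w(2)[OF that]
    by (auto simp: y_def)
  have "cone C D (OMap A l) y"
    unfolding cone_def
  proof (intro conjI ballI)
    show "OMap A l \<in> Obj C" using diagram_Obj[OF dA l(1)] .
    fix i j u assume i: "i \<in> Obj (Idx D)" and j: "j \<in> Obj (Idx D)" and u: "u \<in> hom (Idx D) i j"
    then have u': "u \<in> Arr (Idx D)" "Dom (Idx D) u = i" "Cod (Idx D) u = j" by (auto simp: hom_def)
    show "AMap D u \<cdot> y i = y j"
      using v[OF u'(1)] Comp_assoc[OF Av w(1)[OF i] diagram_hom[OF D u]] u' by (simp add: y_def)
  qed (use y in auto)
  then obtain h where h: "h \<in> hom C (OMap A l) L" "\<And>s. s \<in> Obj (Idx D) \<Longrightarrow> \<pi> s \<cdot> h = y s"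
    using L unfolding limit_cone_def by blast
  have \<pi>: "\<pi> s \<in> hom C L (OMap D s)" if "s \<in> Obj (Idx D)" for s
    using L that unfolding limit_cone_def cone_def by blast
  show ?thesis
    by (rule bexI[of _ "colim_class C A L l h"])
       (use h y push_class[OF dA l(1) h(1) \<pi>] colim_class_in[OF l(1) h(1)] in auto)
qed

text \<open>The injectivity part of the same exchange: equality of classes after each projection
  becomes equality in \<open>C\<close> at one later stage, where the universal property
  applies.\<close>

lemma limit_cone_class_unique:
  assumes A: "is_pro_obj C A" and fin: "finite (Obj (Idx D))" and L: "limit_cone C D L \<pi>" and D: "is_diagram C D"
    and z: "z \<in> colim_hom C A L" "z' \<in> colim_hom C A L"
    and eq: "\<And>s. s \<in> Obj (Idx D) \<Longrightarrow> colim_push C A (OMap D s) (\<pi> s) z = colim_push C A (OMap D s) (\<pi> s) z'"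
  shows "z = z'"
proof -
  note dA = pro_objD(1)[OF A]
  have \<pi>: "\<pi> s \<in> hom C L (OMap D s)" if "s \<in> Obj (Idx D)" for s
    using L that unfolding limit_cone_def cone_def by blast
  \<comment> \<open>The two elements index their own representatives, which places both at one stage
    \<open>k\<close>.\<close>
  obtain k w where k: "k \<in> Obj (Idx A)" and w: "\<And>s. s \<in> {z, z'} \<Longrightarrow> w s \<in> hom C (OMap A k) L"
    "\<And>s. s \<in> {z, z'} \<Longrightarrow> s = colim_class C A L k (w s)"
    by (rule finite_classes_rep[OF A, of "{z, z'}" "\<lambda>s. s" "\<lambda>_. L"]) (use z in auto)
  obtain f f' where wz: "f \<in> hom C (OMap A k) L" "f' \<in> hom C (OMap A k) L"
    and wc: "z = colim_class C A L k f" "z' = colim_class C A L k f'"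
    using w[of z] w[of z'] by blast
  obtain l v where l: "l \<in> Obj (Idx A)" "v \<in> hom (Idx A) l k"
    and v: "\<And>s. s \<in> Obj (Idx D) \<Longrightarrow> (\<pi> s \<cdot> f) \<cdot> AMap A v = (\<pi> s \<cdot> f') \<cdot> AMap A v"
  proof (rule finite_classes_eqD[OF A k fin, of "\<lambda>s. \<pi> s \<cdot> f" "\<lambda>s. OMap D s" "\<lambda>s. \<pi> s \<cdot> f'"])
    fix s assume s: "s \<in> Obj (Idx D)"
    show "\<pi> s \<cdot> f \<in> hom C (OMap A k) (OMap D s)" "\<pi> s \<cdot> f' \<in> hom C (OMap A k) (OMap D s)"
      using Comp_in[OF wz(1) \<pi>[OF s]] Comp_in[OF wz(2) \<pi>[OF s]] .
    show "colim_class C A (OMap D s) k (\<pi> s \<cdot> f) = colim_class C A (OMap D s) k (\<pi> s \<cdot> f')"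
      using eq[OF s] push_class[OF dA k wz(1) \<pi>[OF s]] push_class[OF dA k wz(2) \<pi>[OF s]] wc by metis
  qed (rule that)
  note Av = diagram_hom[OF dA l(2)]
  have 1: "f \<cdot> AMap A v \<in> hom C (OMap A l) L" "f' \<cdot> AMap A v \<in> hom C (OMap A l) L"
    using Comp_in[OF Av] wz by blast+
  have 2: "\<pi> s \<cdot> (f \<cdot> AMap A v) = \<pi> s \<cdot> (f' \<cdot> AMap A v)" if "s \<in> Obj (Idx D)" for s
    using v[OF that] Comp_assoc[OF Av wz(1) \<pi>[OF that]] Comp_assoc[OF Av wz(2) \<pi>[OF that]] by simp
  have "cone C D (OMap A l) (\<lambda>s. \<pi> s \<cdot> (f \<cdot> AMap A v))"
    unfolding cone_def
  proof (intro conjI ballI)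
    show "OMap A l \<in> Obj C" using diagram_Obj[OF dA l(1)] .
    fix i j u assume i: "i \<in> Obj (Idx D)" and j: "j \<in> Obj (Idx D)" and u: "u \<in> hom (Idx D) i j"
    have "AMap D u \<cdot> \<pi> i = \<pi> j" using L i j u unfolding limit_cone_def cone_def by blast
    from comp_left_eq[OF this \<pi>[OF i] diagram_hom[OF D u] 1(1)]
    show "AMap D u \<cdot> (\<pi> i \<cdot> (f \<cdot> AMap A v)) = \<pi> j \<cdot> (f \<cdot> AMap A v)" .
  qed (use Comp_in[OF 1(1) \<pi>] in auto)
  then have "\<exists>!h. h \<in> hom C (OMap A l) L \<and> (\<forall>s \<in> Obj (Idx D). \<pi> s \<cdot> h = \<pi> s \<cdot> (f \<cdot> AMap A v))"
    using L unfolding limit_cone_def by blast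
  then have "f \<cdot> AMap A v = f' \<cdot> AMap A v"
    by (rule ex1E) (use 1 2 in \<open>metis (no_types, lifting)\<close>)
  then show ?thesis
    using wc class_restrict[OF dA k wz(1) l(2)] class_restrict[OF dA k wz(2) l(2)] by simp
qed

lemma pullbackD:
  assumes "is_pullback C f g P p q"
  shows "f \<in> hom C (Dom C f) (Cod C f)" "g \<in> hom C (Dom C g) (Cod C f)"
    "p \<in> hom C P (Dom C f)" "q \<in> hom C P (Dom C g)" "f \<cdot> p = g \<cdot> q"
proof -
  have "f \<in> Arr C" "g \<in> Arr C" "Cod C f = Cod C g"
    using assms unfolding is_pullback_def by simp_all
  then show "f \<in> hom C (Dom C f) (Cod C f)" "g \<in> hom C (Dom C g) (Cod C f)"
    by (simp_all add: hom_def)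
qed (use assms in \<open>simp_all add: is_pullback_def\<close>)

text \<open>\<open>is_pullback\<close> is stated by arrows and not as a \<open>limit_cone\<close>,
  so the exchange with filtered colimits is carried out again; \<open>class_eqD\<close> provides the
  stage at which the square commutes.\<close>

lemma pullback_class_ex:
  assumes A: "is_pro_obj C A" and P: "is_pullback C f g P p q"
    and x: "x \<in> colim_hom C A (Dom C f)" and y: "y \<in> colim_hom C A (Dom C g)"
    and eq: "colim_push C A (Cod C f) f x = colim_push C A (Cod C f) g y"
  shows "\<exists>z \<in> colim_hom C A P. colim_push C A (Dom C f) p z = x \<and> colim_push C A (Dom C g) q z = y"
proof -
  note dA = pro_objD(1)[OF A]
  interpret I: category "Idx A" using pro_objD(3)[OF A] .
  note fg = pullbackD[OF P]
  obtain t a where t: "t \<in> Obj (Idx A)" "a \<in> hom C (OMap A t) (Dom C f)" "x = colim_class C A (Dom C f) t a"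
    using x by (rule colim_homE)
  obtain t' b where t': "t' \<in> Obj (Idx A)" "b \<in> hom C (OMap A t') (Dom C g)" "y = colim_class C A (Dom C g) t' b"
    using y by (rule colim_homE)
  have "colim_class C A (Cod C f) t (f \<cdot> a) = colim_class C A (Cod C f) t' (g \<cdot> b)"
    using eq push_class[OF dA t(1,2) fg(1)] push_class[OF dA t'(1,2) fg(2)] t t' by simp
  from class_eqD[OF A t(1) Comp_in[OF t(2) fg(1)] this]
  obtain k u v where k: "k \<in> Obj (Idx A)" "u \<in> hom (Idx A) k t" "v \<in> hom (Idx A) k t'"
    and e: "(f \<cdot> a) \<cdot> AMap A u = (g \<cdot> b) \<cdot> AMap A v" .
  note Au = diagram_hom[OF dA k(2)] and Av = diagram_hom[OF dA k(3)]
  have ab: "a \<cdot> AMap A u \<in> hom C (OMap A k) (Dom C f)" "b \<cdot> AMap A v \<in> hom C (OMap A k) (Dom C g)"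
    using Comp_in[OF Au t(2)] Comp_in[OF Av t'(2)] by auto
  moreover have "f \<cdot> (a \<cdot> AMap A u) = g \<cdot> (b \<cdot> AMap A v)"
    using e Comp_assoc[OF Au t(2) fg(1)] Comp_assoc[OF Av t'(2) fg(2)] by simp
  ultimately obtain h where h: "h \<in> hom C (OMap A k) P" "p \<cdot> h = a \<cdot> AMap A u" "q \<cdot> h = b \<cdot> AMap A v"
    using P unfolding is_pullback_def by blast
  have "colim_push C A (Dom C f) p (colim_class C A P k h) = x"
    unfolding push_class[OF dA k(1) h(1) fg(3)] h(2) t(3) by (rule class_restrict[OF dA t(1,2) k(2)])
  moreover have "colim_push C A (Dom C g) q (colim_class C A P k h) = y"
    unfolding push_class[OF dA k(1) h(1) fg(4)] h(3) t'(3) by (rule class_restrict[OF dA t'(1,2) k(3)])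
  ultimately show ?thesis using colim_class_in[OF k(1) h(1)] by blast
qed

text \<open>The two legs are treated in turn: first a stage where the composites with
  \<open>p\<close> agree, then a later one where those with \<open>q\<close> agree as well.\<close>

lemma pullback_class_unique:
  assumes A: "is_pro_obj C A" and P: "is_pullback C f g P p q"
    and z: "z \<in> colim_hom C A P" "z' \<in> colim_hom C A P"
    and eq: "colim_push C A (Dom C f) p z = colim_push C A (Dom C f) p z'"
      "colim_push C A (Dom C g) q z = colim_push C A (Dom C g) q z'"
  shows "z = z'"
proof -
  note dA = pro_objD(1)[OF A]
  interpret I: category "Idx A" using pro_objD(3)[OF A] .
  note fg = pullbackD[OF P]
  obtain t0 a0 where t0: "t0 \<in> Obj (Idx A)" "a0 \<in> hom C (OMap A t0) P" "z = colim_class C A P t0 a0"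
    using z(1) by (rule colim_homE)
  obtain t1 a1 where t1: "t1 \<in> Obj (Idx A)" "a1 \<in> hom C (OMap A t1) P" "z' = colim_class C A P t1 a1"
    using z(2) by (rule colim_homE)
  have "colim_class C A (Dom C f) t0 (p \<cdot> a0) = colim_class C A (Dom C f) t1 (p \<cdot> a1)"
    using eq(1) push_class[OF dA t0(1,2) fg(3)] push_class[OF dA t1(1,2) fg(3)] t0 t1 by simp
  from class_eqD[OF A t0(1) Comp_in[OF t0(2) fg(3)] this]
  obtain k u v where k: "k \<in> Obj (Idx A)" "u \<in> hom (Idx A) k t0" "v \<in> hom (Idx A) k t1"
    and e: "(p \<cdot> a0) \<cdot> AMap A u = (p \<cdot> a1) \<cdot> AMap A v" .
  note Au = diagram_hom[OF dA k(2)] and Av = diagram_hom[OF dA k(3)]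
  define b0 b1 where "b0 = a0 \<cdot> AMap A u" and "b1 = a1 \<cdot> AMap A v"
  have b: "b0 \<in> hom C (OMap A k) P" "b1 \<in> hom C (OMap A k) P"
    using Comp_in[OF Au t0(2)] Comp_in[OF Av t1(2)] by (auto simp: b0_def b1_def)
  have zb: "z = colim_class C A P k b0" "z' = colim_class C A P k b1"
    using class_restrict[OF dA t0(1,2) k(2)] class_restrict[OF dA t1(1,2) k(3)] t0 t1 by (auto simp: b0_def b1_def)
  have pb: "p \<cdot> b0 = p \<cdot> b1"
    using e Comp_assoc[OF Au t0(2) fg(3)] Comp_assoc[OF Av t1(2) fg(3)] by (simp add: b0_def b1_def)
  have "colim_class C A (Dom C g) k (q \<cdot> b0) = colim_class C A (Dom C g) k (q \<cdot> b1)"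
    using eq(2) push_class[OF dA k(1) b(1) fg(4)] push_class[OF dA k(1) b(2) fg(4)] zb by simp
  from class_eqD_same[OF A k(1) _ _ this] obtain l w where
    l: "l \<in> Obj (Idx A)" "w \<in> hom (Idx A) l k" "(q \<cdot> b0) \<cdot> AMap A w = (q \<cdot> b1) \<cdot> AMap A w"
    using Comp_in[OF b(1) fg(4)] Comp_in[OF b(2) fg(4)] by metis
  note Aw = diagram_hom[OF dA l(2)]
  have c: "b0 \<cdot> AMap A w \<in> hom C (OMap A l) P" "b1 \<cdot> AMap A w \<in> hom C (OMap A l) P"
    using Comp_in[OF Aw] b by auto
  have qc: "q \<cdot> (b0 \<cdot> AMap A w) = q \<cdot> (b1 \<cdot> AMap A w)" and pc: "p \<cdot> (b0 \<cdot> AMap A w) = p \<cdot> (b1 \<cdot> AMap A w)"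
    using l(3) pb Comp_assoc[OF Aw b(1) fg(4)] Comp_assoc[OF Aw b(2) fg(4)]
      Comp_assoc[OF Aw b(1) fg(3)] Comp_assoc[OF Aw b(2) fg(3)] by simp_all
  have "f \<cdot> (p \<cdot> (b0 \<cdot> AMap A w)) = g \<cdot> (q \<cdot> (b0 \<cdot> AMap A w))"
    using comp_left_eq[OF fg(5,3,1) c(1)] Comp_assoc[OF c(1) fg(4,2)] by simp
  then have "\<exists>!h. h \<in> hom C (OMap A l) P \<and> p \<cdot> h = p \<cdot> (b0 \<cdot> AMap A w) \<and> q \<cdot> h = q \<cdot> (b0 \<cdot> AMap A w)"
    using P Comp_in[OF c(1) fg(3)] Comp_in[OF c(1) fg(4)] unfolding is_pullback_def by blast
  then have "b0 \<cdot> AMap A w = b1 \<cdot> AMap A w"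
    by (rule ex1E) (use c pc qc in \<open>metis (no_types, lifting)\<close>)
  then show ?thesis
    using zb class_restrict[OF dA k(1) b(1) l(2)] class_restrict[OF dA k(1) b(2) l(2)] by simp
qed

end

section \<open>Lifting against simple and special morphisms\<close>

text \<open>The third component of \<open>pro_induced\<close> under a name of its own, so that
  composites can be computed on families without the surrounding triples.\<close>

definition induced_map ::
    "('o, 'a) cat \<Rightarrow> ('i, 'o, 'a) pro_obj \<Rightarrow> ('i, 'o, 'a) pro_obj \<Rightarrow> ('i \<Rightarrow> 'a) \<Rightarrow> 'i \<Rightarrow> ('i \<times> 'a) set" where
  "induced_map C X Y \<phi> s = (if s \<in> Obj (Idx Y) then colim_class C X (OMap Y s) s (\<phi> s) else undefined)"

lemma pro_induced_eq: "pro_induced C X Y \<phi> = (X, Y, induced_map C X Y \<phi>)"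
  unfolding pro_induced_def induced_map_def ..

lemma Pro_simps [simp]:
  "Obj (Pro C) = {X. is_pro_obj C X}"
  "(X, Y, F) \<in> Arr (Pro C) \<longleftrightarrow> is_pro_obj C X \<and> is_pro_obj C Y \<and> F \<in> pro_hom C X Y"
  "Dom (Pro C) (X, Y, F) = X" "Cod (Pro C) (X, Y, F) = Y"
  "Idn (Pro C) X = (X, X, pro_idn C X)"
  "Comp (Pro C) (Y', Z, G) (X, Y, F) = (X, Z, pro_comp C X Z G F)"
  by (simp_all add: Pro_def)

lemma hom_Pro:
  "hom (Pro C) X Y = {(X, Y, F) | F. is_pro_obj C X \<and> is_pro_obj C Y \<and> F \<in> pro_hom C X Y}"
  by (auto simp: hom_def Pro_def)

lemma Arr_ProE:
  assumes "f \<in> Arr (Pro C)"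
  obtains X Y F where "f = (X, Y, F)" "is_pro_obj C X" "is_pro_obj C Y" "F \<in> pro_hom C X Y"
  using assms by (cases f) auto

lemma lifts_Pro_iff:
  assumes "is_pro_obj C A" "is_pro_obj C B" "is_pro_obj C X" "is_pro_obj C Y"
  shows "lifts (Pro C) (A, B, I) (X, Y, Q) \<longleftrightarrow>
    (\<forall>U \<in> pro_hom C A X. \<forall>V \<in> pro_hom C B Y. pro_comp C A Y Q U = pro_comp C A Y V I \<longrightarrow>
       (\<exists>H \<in> pro_hom C B X. pro_comp C A X H I = U \<and> pro_comp C B Y Q H = V))"
  unfolding lifts_def Pro_simps hom_Pro using assms by fastforce

lemma point_cat_simps [simp]:
  "Obj point_cat = {undefined}" "hom point_cat x y = (if x = undefined \<and> y = undefined then {undefined} else {})"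
  "Arr point_cat = {undefined}" "Idn point_cat x = undefined" "Comp point_cat u v = undefined"
  by (auto simp: point_cat_def hom_def)

lemma category_point_cat: "category point_cat"
  by unfold_locales (auto simp: point_cat_def hom_def)

lemma directed_point_cat: "directed point_cat"
  unfolding directed_def using category_point_cat by auto

lemma simple_obj_simps [simp]:
  "Idx (simple_obj C c) = point_cat" "OMap (simple_obj C c) s = c" "AMap (simple_obj C c) u = Idn C c"
  by (simp_all add: simple_obj_def)

lemma partial_order_onD':
  assumes "partial_order_on T le"
  shows "s \<in> T \<Longrightarrow> (s, s) \<in> le" "(s, t) \<in> le \<Longrightarrow> s \<in> T" "(s, t) \<in> le \<Longrightarrow> t \<in> T"
    "(s, t) \<in> le \<Longrightarrow> (t, u) \<in> le \<Longrightarrow> (s, u) \<in> le" "(s, t) \<in> le \<Longrightarrow> (t, s) \<in> le \<Longrightarrow> s = t"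
  using partial_order_onD[OF assms] unfolding refl_on_def trans_def antisym_def by blast+

text \<open>The number of elements below \<open>x\<close> is finite and strictly increases along the
  strict order, since \<open>t\<close> lies below itself but not below a smaller
  \<open>s\<close>.\<close>

lemma wf_cofinite_strict:
  assumes "partial_order_on T le" "cofinite T le"
  shows "wf {(s, t). (s, t) \<in> le \<and> s \<noteq> t}"
proof -
  note le = partial_order_onD'[OF assms(1)]
  have "{(s, t). (s, t) \<in> le \<and> s \<noteq> t} \<subseteq> measure (\<lambda>x. card {z \<in> T. (z, x) \<in> le})"
  proof clarsimp
    fix s t assume a: "(s, t) \<in> le" "s \<noteq> t"
    have "{z \<in> T. (z, s) \<in> le} \<subset> {z \<in> T. (z, t) \<in> le}"
      using a le(1,3)[of t] le(4)[of _ s t] le(5)[of s t] le(3)[OF a(1)] by auto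
    moreover have "finite {z \<in> T. (z, t) \<in> le}" using assms(2) le(3)[OF a(1)] unfolding cofinite_def by blast
    ultimately show "card {z \<in> T. (z, s) \<in> le} < card {z \<in> T. (z, t) \<in> le}" by (rule psubset_card_mono[rotated])
  qed
  then show ?thesis by (rule wf_subset[OF wf_measure])
qed

context category
begin

lemma induced_map_in:
  assumes "nat_trans C X Y \<phi>"
  shows "induced_map C X Y \<phi> \<in> pro_hom C X Y"
proof (rule pro_homI)
  have X: "is_diagram C X" and Y: "is_diagram C Y" and eq: "Idx X = Idx Y"
    and \<phi>: "\<And>i. i \<in> Obj (Idx Y) \<Longrightarrow> \<phi> i \<in> hom C (OMap X i) (OMap Y i)"
    and nat: "\<And>i j u. i \<in> Obj (Idx Y) \<Longrightarrow> j \<in> Obj (Idx Y) \<Longrightarrow> u \<in> hom (Idx Y) i j \<Longrightarrow>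
      \<phi> j \<cdot> AMap X u = AMap Y u \<cdot> \<phi> i"
    using assms unfolding nat_trans_def by auto
  fix s assume s: "s \<in> Obj (Idx Y)"
  show "induced_map C X Y \<phi> s \<in> colim_hom C X (OMap Y s)"
    using colim_class_in[of s X] \<phi>[OF s] s eq by (simp add: induced_map_def)
  fix s' u assume s': "s' \<in> Obj (Idx Y)" and u: "u \<in> hom (Idx Y) s s'"
  show "colim_push C X (OMap Y s') (AMap Y u) (induced_map C X Y \<phi> s) = induced_map C X Y \<phi> s'"
    using push_class[OF X _ \<phi>[OF s] diagram_hom[OF Y u]] nat[OF s s' u]
      class_restrict[OF X _ \<phi>[OF s'], of u s] s s' u eq by (simp add: induced_map_def)
qed (simp add: induced_map_def)

lemma pro_induced_hom:
  assumes "nat_trans C X Y \<phi>" "directed (Idx X)"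
  shows "pro_induced C X Y \<phi> \<in> hom (Pro C) X Y"
  using induced_map_in[OF assms(1)] assms
  by (auto simp: hom_Pro pro_induced_eq is_pro_obj_def nat_trans_def)

lemma pull_induced:
  assumes "is_diagram C A" "nat_trans C X Y \<phi>" "U \<in> pro_hom C A X" "s \<in> Obj (Idx Y)"
  shows "pro_comp C A Y (induced_map C X Y \<phi>) U s = colim_push C A (OMap Y s) (\<phi> s) (U s)"
proof -
  have "is_diagram C X" "s \<in> Obj (Idx X)" "\<phi> s \<in> hom C (OMap X s) (OMap Y s)"
    using assms unfolding nat_trans_def by auto
  from pull_class[OF assms(1) this(1) assms(3) this(2,3)]
  show ?thesis using assms(4) by (simp add: pro_comp_pull induced_map_def)
qed

lemma is_diagram_simple: "c \<in> Obj C \<Longrightarrow> is_diagram C (simple_obj C c)"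
  unfolding is_diagram_def using category_point_cat by (auto simp: Idn_in)

lemma is_pro_obj_simple: "c \<in> Obj C \<Longrightarrow> is_pro_obj C (simple_obj C c)"
  unfolding is_pro_obj_def using is_diagram_simple directed_point_cat by auto

lemma nat_trans_simple:
  assumes "m \<in> hom C c d"
  shows "nat_trans C (simple_obj C c) (simple_obj C d) (\<lambda>_. m)"
  unfolding nat_trans_def using is_diagram_simple hom_Obj[OF assms] assms Comp_Idn Idn_Comp by auto

lemma simple_arr_eq:
  assumes "m \<in> hom C c d"
  shows "simple_arr C m = (simple_obj C c, simple_obj C d, induced_map C (simple_obj C c) (simple_obj C d) (\<lambda>_. m))"
  using assms by (simp add: simple_arr_def pro_induced_eq hom_def)

lemma pro_hom_simple_iff:
  assumes "is_diagram C A" "c \<in> Obj C"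
  shows "U \<in> pro_hom C A (simple_obj C c) \<longleftrightarrow> U undefined \<in> colim_hom C A c \<and> (\<forall>s. s \<noteq> undefined \<longrightarrow> U s = undefined)"
  unfolding pro_hom_def using push_Idn[OF assms(1) _ assms(2)] by auto

text \<open>A morphism into a simple object is one element of a colimit set, so the lifting property
  becomes surjectivity of a map of sets onto a fibre product. The recursion for special maps uses it
  in this form.\<close>

lemma lifts_simple_iff:
  fixes A B :: "('i, 'o, 'a) pro_obj"
  assumes A: "is_pro_obj C A" and B: "is_pro_obj C B" and I: "I \<in> pro_hom C A B" and m: "m \<in> hom C c d"
  shows "lifts (Pro C) (A, B, I) (simple_arr C m) \<longleftrightarrow>
    (\<forall>x \<in> colim_hom C A c. \<forall>y \<in> colim_hom C B d. colim_push C A d m x = pro_pull A d I y \<longrightarrow>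
       (\<exists>z \<in> colim_hom C B c. pro_pull A c I z = x \<and> colim_push C B d m z = y))"
    (is "?L \<longleftrightarrow> ?R")
proof -
  note dA = pro_objD(1)[OF A] and dB = pro_objD(1)[OF B] and cd = hom_Obj[OF m]
  let ?c = "simple_obj C c :: ('i, 'o, 'a) pro_obj" and ?d = "simple_obj C d :: ('i, 'o, 'a) pro_obj"
  let ?m = "induced_map C ?c ?d (\<lambda>_. m)"
  \<comment> \<open>Wraps an element as a family on the one-object index category, whose object is
    \<open>undefined\<close>; at other arguments the normalisation of \<open>pro_hom\<close> forces
    the value \<open>undefined\<close>.\<close>
  define el :: "('i \<times> 'a) set \<Rightarrow> 'i \<Rightarrow> ('i \<times> 'a) set" where "el x = (\<lambda>s. if s = undefined then x else undefined)" for x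
  have el: "el x undefined = x" for x by (simp add: el_def)
  have el_in: "el x \<in> pro_hom C X (simple_obj C e)" if "is_diagram C X" "e \<in> Obj C" "x \<in> colim_hom C X e"
    for X :: "('i, 'o, 'a) pro_obj" and e x
    using that pro_hom_simple_iff[OF that(1,2)] by (simp add: el_def)
  have ex: "\<exists>x \<in> colim_hom C X e. U = el x" if "is_diagram C X" "e \<in> Obj C" "U \<in> pro_hom C X (simple_obj C e)"
    for X :: "('i, 'o, 'a) pro_obj" and e U
    using that(3) unfolding pro_hom_simple_iff[OF that(1,2)]
    by (intro bexI[of _ "U undefined"]) (auto simp: el_def fun_eq_iff)
  have m1: "pro_comp C X ?d ?m (el x) = el (colim_push C X d m x)" if "is_diagram C X" "x \<in> colim_hom C X c"
    for X :: "('i, 'o, 'a) pro_obj" and x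
  proof
    fix s show "pro_comp C X ?d ?m (el x) s = el (colim_push C X d m x) s"
      using pull_induced[OF that(1) nat_trans_simple[OF m] el_in[OF that(1) cd(1) that(2)], of s]
      by (cases "s = undefined") (simp_all add: el_def pro_comp_pull)
  qed
  have I1: "pro_comp C A (simple_obj C e) (el x) I = el (pro_pull A e I x)" for e x
    by (rule ext) (simp add: pro_comp_pull el_def)
  have el_inj: "el x = el y \<longleftrightarrow> x = y" for x y using el by metis
  have L: "?L \<longleftrightarrow> (\<forall>U \<in> pro_hom C A ?c. \<forall>V \<in> pro_hom C B ?d. pro_comp C A ?d ?m U = pro_comp C A ?d V I \<longrightarrow>
       (\<exists>H \<in> pro_hom C B ?c. pro_comp C A ?c H I = U \<and> pro_comp C B ?d ?m H = V))"
    unfolding simple_arr_eq[OF m]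
    using lifts_Pro_iff[OF A B is_pro_obj_simple[OF cd(1)] is_pro_obj_simple[OF cd(2)]] .
  show ?thesis
  proof
    assume l: ?L
    show ?R
    proof (intro ballI impI)
      fix x y assume x: "x \<in> colim_hom C A c" and y: "y \<in> colim_hom C B d" and e: "colim_push C A d m x = pro_pull A d I y"
      have "pro_comp C A ?d ?m (el x) = pro_comp C A ?d (el y) I"
        unfolding m1[OF dA x] I1 e ..
      then obtain H where H: "H \<in> pro_hom C B ?c" "pro_comp C A ?c H I = el x" "pro_comp C B ?d ?m H = el y"
        using l[unfolded L] el_in[OF dA cd(1) x] el_in[OF dB cd(2) y] by blast
      obtain z where z: "z \<in> colim_hom C B c" "H = el z" using ex[OF dB cd(1) H(1)] by blast
      show "\<exists>z\<in>colim_hom C B c. pro_pull A c I z = x \<and> colim_push C B d m z = y"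
        using z(1) H(2,3) unfolding z(2) I1 m1[OF dB z(1)] el_inj by blast
    qed
  next
    assume r: ?R
    show ?L unfolding L
    proof (intro ballI impI)
      fix U V assume U: "U \<in> pro_hom C A ?c" and V: "V \<in> pro_hom C B ?d"
        and e: "pro_comp C A ?d ?m U = pro_comp C A ?d V I"
      obtain x where x: "x \<in> colim_hom C A c" "U = el x" using ex[OF dA cd(1) U] by blast
      obtain y where y: "y \<in> colim_hom C B d" "V = el y" using ex[OF dB cd(2) V] by blast
      have "colim_push C A d m x = pro_pull A d I y"
        using e unfolding x(2) y(2) m1[OF dA x(1)] I1 el_inj .
      then obtain z where z: "z \<in> colim_hom C B c" "pro_pull A c I z = x" "colim_push C B d m z = y"
        using r x(1) y(1) by blast
      show "\<exists>H\<in>pro_hom C B ?c. pro_comp C A ?c H I = U \<and> pro_comp C B ?d ?m H = V"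
        by (rule bexI[OF _ el_in[OF dB cd(1) z(1)]])
           (simp add: I1 m1[OF dB z(1)] z(2,3) x(2) y(2))
    qed
  qed
qed

text \<open>Both given morphisms are represented at one index \<open>k\<close> at which the square
  commutes in \<open>C\<close>; there \<open>\<phi> k\<close> lifts against \<open>m\<close>, and
  the class of that lift is the required morphism.\<close>

lemma levelwise_lifts_simple:
  assumes lw: "levelwise C N A B \<phi>" and dir: "directed (Idx A)" and m: "m \<in> M" "m \<in> Arr C" and o: "orth C N M"
  shows "lifts (Pro C) (pro_induced C A B \<phi>) (simple_arr C m)"
proof -
  have nt: "nat_trans C A B \<phi>" and N: "\<And>i. i \<in> Obj (Idx A) \<Longrightarrow> \<phi> i \<in> N"
    using lw unfolding levelwise_def by auto
  have eq: "Idx B = Idx A" and \<phi>: "\<And>i. i \<in> Obj (Idx A) \<Longrightarrow> \<phi> i \<in> hom C (OMap A i) (OMap B i)"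
    and nat: "\<And>i j u. u \<in> hom (Idx A) i j \<Longrightarrow> i \<in> Obj (Idx A) \<Longrightarrow> j \<in> Obj (Idx A) \<Longrightarrow> \<phi> j \<cdot> AMap A u = AMap B u \<cdot> \<phi> i"
    using nt unfolding nat_trans_def by auto
  have A: "is_pro_obj C A" and B: "is_pro_obj C B"
    using nt dir by (auto simp: nat_trans_def is_pro_obj_def)
  note dA = pro_objD(1)[OF A] and dB = pro_objD(1)[OF B]
  interpret I: category "Idx A" using diagram_category[OF dA] .
  obtain c d where m': "m \<in> hom C c d" using hom_Dom_Cod[OF m(2)] by blast
  have pull: "pro_pull A e (induced_map C A B \<phi>) (colim_class C B e t g) = colim_class C A e t (g \<cdot> \<phi> t)"
    if "t \<in> Obj (Idx A)" "g \<in> hom C (OMap B t) e" for e t g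
    using pull_class[OF dA dB induced_map_in[OF nt] _ that(2)] push_class[OF dA that(1) \<phi>[OF that(1)] that(2)] that
    by (simp add: eq induced_map_def)
  show ?thesis
    unfolding pro_induced_eq lifts_simple_iff[OF A B induced_map_in[OF nt] m']
  proof (intro ballI impI)
    fix x y assume x: "x \<in> colim_hom C A c" and y: "y \<in> colim_hom C B d"
      and e: "colim_push C A d m x = pro_pull A d (induced_map C A B \<phi>) y"
    obtain t f where t: "t \<in> Obj (Idx A)" "f \<in> hom C (OMap A t) c" "x = colim_class C A c t f"
      using x by (rule colim_homE)
    obtain t' g where t': "t' \<in> Obj (Idx A)" "g \<in> hom C (OMap B t') d" "y = colim_class C B d t' g"
      using y eq by (metis colim_homE)
    have "colim_class C A d t (m \<cdot> f) = colim_class C A d t' (g \<cdot> \<phi> t')"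
      using e unfolding t(3) t'(3) push_class[OF dA t(1,2) m'] pull[OF t'(1,2)] .
    from class_eqD[OF A t(1) Comp_in[OF t(2) m'] this]
    obtain k u v where k: "k \<in> Obj (Idx A)" "u \<in> hom (Idx A) k t" "v \<in> hom (Idx A) k t'"
      "(m \<cdot> f) \<cdot> AMap A u = (g \<cdot> \<phi> t') \<cdot> AMap A v" .
    note Au = diagram_hom[OF dA k(2)] and Av = diagram_hom[OF dA k(3)]
    have Bv: "AMap B v \<in> hom C (OMap B k) (OMap B t')" using diagram_hom[OF dB] k(3) eq by simp
    define f' g' where "f' = f \<cdot> AMap A u" and "g' = g \<cdot> AMap B v"
    have f': "f' \<in> hom C (OMap A k) c" and g': "g' \<in> hom C (OMap B k) d"
      using Comp_in[OF Au t(2)] Comp_in[OF Bv t'(2)] by (auto simp: f'_def g'_def)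
    have xy: "x = colim_class C A c k f'" "y = colim_class C B d k g'"
      using class_restrict[OF dA t(1,2) k(2)] class_restrict[OF dB _ t'(2), of v k] t' t(3) k(3) eq by (auto simp: f'_def g'_def)
    have sq: "m \<cdot> f' = g' \<cdot> \<phi> k"
      using k(4) Comp_assoc[OF Au t(2) m'] Comp_assoc[OF Av \<phi>[OF t'(1)] t'(2)] Comp_assoc[OF \<phi>[OF k(1)] Bv t'(2)]
        nat[OF k(3,1) t'(1)] by (simp add: f'_def g'_def)
    have "lifts C (\<phi> k) m" using o N[OF k(1)] m(1) unfolding orth_def by blast
    moreover have "Dom C (\<phi> k) = OMap A k" "Cod C (\<phi> k) = OMap B k" "Dom C m = c" "Cod C m = d"
      using \<phi>[OF k(1)] m' by (auto simp: hom_def)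
    ultimately obtain h where h: "h \<in> hom C (OMap B k) c" "h \<cdot> \<phi> k = f'" "m \<cdot> h = g'"
      using f' g' sq unfolding lifts_def by metis
    show "\<exists>z\<in>colim_hom C B c. pro_pull A c (induced_map C A B \<phi>) z = x \<and> colim_push C B d m z = y"
      by (rule bexI[OF _ colim_class_in[OF _ h(1)]])
         (use pull[OF k(1) h(1)] push_class[OF dB _ h(1) m'] h k(1) eq xy in auto)
  qed
qed

text \<open>At \<open>t\<close> the values already found below assemble to a morphism from
  \<open>B\<close> to the matching limit of \<open>X\<close>, and together with \<open>V t\<close>
  to one into the pullback \<open>P\<close>. The relative matching map \<open>n\<close> from
  \<open>OMap X t\<close> to \<open>P\<close> is in \<open>M\<close>, so a lift against its simple
  morphism yields the value at \<open>t\<close>.\<close>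

lemma special_lifts:
  assumes A: "is_pro_obj C A" and B: "is_pro_obj C B" and I: "I \<in> pro_hom C A B"
    and l: "\<And>m. m \<in> M \<Longrightarrow> lifts (Pro C) (A, B, I) (simple_arr C m)"
    and M: "M \<subseteq> Arr C" and dir: "directed (Idx X)" and sp: "special C M X Y \<phi>"
  shows "lifts (Pro C) (A, B, I) (pro_induced C X Y \<phi>)"
proof -
  obtain le where nt: "nat_trans C X Y \<phi>" and le: "poset_category le (Idx X)" "cofinite (Obj (Idx X)) le"
    and at: "\<And>t. t \<in> Obj (Idx X) \<Longrightarrow> special_at C M le X Y \<phi> t"
    using sp unfolding special_def by auto
  have eq: "Idx Y = Idx X" and \<phi>: "\<And>i. i \<in> Obj (Idx X) \<Longrightarrow> \<phi> i \<in> hom C (OMap X i) (OMap Y i)"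
    using nt unfolding nat_trans_def by auto
  have X: "is_pro_obj C X" and Y: "is_pro_obj C Y" using nt dir by (auto simp: nat_trans_def is_pro_obj_def)
  note dA = pro_objD(1)[OF A] and dB = pro_objD(1)[OF B] and dX = pro_objD(1)[OF X] and dY = pro_objD(1)[OF Y]
  interpret J: category "Idx X" using diagram_category[OF dX] .
  let ?T = "Obj (Idx X)"
  have po: "partial_order_on ?T le" using le(1) unfolding poset_category_def by blast
  note po' = partial_order_onD'[OF po]
  have pc: "if (v, u) \<in> le then (\<exists>!f. f \<in> hom (Idx X) u v) else hom (Idx X) u v = {}" if "u \<in> ?T" "v \<in> ?T" for u v
    using le(1) that unfolding poset_category_def by blast
  have hom_le: "(v, u) \<in> le" if "f \<in> hom (Idx X) u v" for f u v
    using pc[of u v] J.hom_Obj[OF that] that by (auto split: if_splits)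
  have hom_unique: "f = g" if "f \<in> hom (Idx X) u v" "g \<in> hom (Idx X) u v" for f g u v
    using pc[of u v] J.hom_Obj[OF that(1)] that hom_le[OF that(1)] by auto
  have hom_ex: "\<exists>f. f \<in> hom (Idx X) u v" if "(v, u) \<in> le" for u v
    using pc[of u v] po'(2,3)[OF that] that by auto
  show ?thesis
    unfolding pro_induced_eq lifts_Pro_iff[OF A B X Y]
  proof (intro ballI impI)
    fix U V assume U: "U \<in> pro_hom C A X" and V: "V \<in> pro_hom C B Y"
      and UV: "pro_comp C A Y (induced_map C X Y \<phi>) U = pro_comp C A Y V I"
    have UVs: "colim_push C A (OMap Y s) (\<phi> s) (U s) = pro_pull A (OMap Y s) I (V s)" if "s \<in> ?T" for s
      using pull_induced[OF dA nt U, of s] that fun_cong[OF UV, of s] eq by (simp add: pro_comp_pull)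
    note Uin = pro_homD(1)[OF U] and Vin = pro_homD(1)[OF V, unfolded eq]
    \<comment> \<open>The value at \<open>t\<close> must solve the lifting problem at
      \<open>t\<close> and restrict to the values \<open>h s\<close> strictly below. No other values
      of \<open>h\<close> are mentioned, as well-founded choice demands.\<close>
    define Q where "Q h t r \<longleftrightarrow> t \<in> ?T \<longrightarrow>
       r \<in> colim_hom C B (OMap X t) \<and> pro_pull A (OMap X t) I r = U t \<and> colim_push C B (OMap Y t) (\<phi> t) r = V t
       \<and> (\<forall>s u. u \<in> hom (Idx X) t s \<longrightarrow> s \<noteq> t \<longrightarrow> colim_push C B (OMap X s) (AMap X u) r = h s)"
      for h :: "'b \<Rightarrow> ('b \<times> 'a) set" and t r
    have "\<exists>h. \<forall>t. Q h t (h t)"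
    proof (rule dependent_wf_choice[OF wf_cofinite_strict[OF po le(2)]])
      fix h g :: "'b \<Rightarrow> ('b \<times> 'a) set" and t r
      assume "\<And>z. (z, t) \<in> {(s, t). (s, t) \<in> le \<and> s \<noteq> t} \<Longrightarrow> h z = g z"
      then show "Q h t r = Q g t r" unfolding Q_def using hom_le by (intro iffI) auto
    next
      fix t h assume IH: "\<And>s. (s, t) \<in> {(s, t). (s, t) \<in> le \<and> s \<noteq> t} \<Longrightarrow> Q h s (h s)"
      show "\<exists>r. Q h t r"
      proof (cases "t \<in> ?T")
        case False then show ?thesis by (simp add: Q_def)
      next
        case t: True
        define S where "S = {s \<in> ?T. (s, t) \<in> le \<and> s \<noteq> t}"
        have S: "s \<in> ?T" "(s, t) \<in> le" "s \<noteq> t" if "s \<in> S" for s using that by (auto simp: S_def)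
        have Qs: "h s \<in> colim_hom C B (OMap X s)" "pro_pull A (OMap X s) I (h s) = U s"
            "colim_push C B (OMap Y s) (\<phi> s) (h s) = V s"
            "\<And>s' u. u \<in> hom (Idx X) s s' \<Longrightarrow> s' \<noteq> s \<Longrightarrow> colim_push C B (OMap X s') (AMap X u) (h s) = h s'"
          if "s \<in> S" for s
          using IH[of s] S[OF that] by (auto simp: Q_def)
        obtain LX \<pi> LY \<rho> a b P p q n where
          LX: "limit_cone C (restrict_diagram X S) LX \<pi>" and LY: "limit_cone C (restrict_diagram Y S) LY \<rho>"
          and a: "a \<in> hom C (OMap Y t) LY" "\<And>s u. s \<in> S \<Longrightarrow> u \<in> hom (Idx X) t s \<Longrightarrow> \<rho> s \<cdot> a = AMap Y u"
          and b: "b \<in> hom C LX LY" "\<And>s. s \<in> S \<Longrightarrow> \<rho> s \<cdot> b = \<phi> s \<cdot> \<pi> s"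
          and P: "is_pullback C a b P p q"
          and n: "n \<in> hom C (OMap X t) P" "p \<cdot> n = \<phi> t"
            "\<And>s u. s \<in> S \<Longrightarrow> u \<in> hom (Idx X) t s \<Longrightarrow> \<pi> s \<cdot> (q \<cdot> n) = AMap X u" "n \<in> M"
          using at[OF t] unfolding special_at_def Let_def S_def[symmetric] eq by blast
        have rX: "Obj (Idx (restrict_diagram Z S)) = S" "OMap (restrict_diagram Z S) = OMap Z"
          "AMap (restrict_diagram Z S) = AMap Z"
          "hom (Idx (restrict_diagram Z S)) x y = {u \<in> hom (Idx Z) x y. x \<in> S \<and> y \<in> S}"
          "Arr (Idx (restrict_diagram Z S)) = {u \<in> Arr (Idx Z). Dom (Idx Z) u \<in> S \<and> Cod (Idx Z) u \<in> S}"
          for Z :: "('b, 'o, 'a) pro_obj" and x y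
          by (auto simp: restrict_diagram_def full_subcat_def hom_def)
        have "finite {z \<in> ?T. (z, t) \<in> le}" using le(2) t unfolding cofinite_def by blast
        then have finS: "finite S" by (rule rev_finite_subset) (auto simp: S_def)
        \<comment> \<open>In a poset category an arrow is determined by its ends, so there are no
          more arrows than pairs in \<open>S \<times> S\<close>.\<close>
        have finA: "finite {u \<in> Arr (Idx X). Dom (Idx X) u \<in> S \<and> Cod (Idx X) u \<in> S}"
        proof (rule inj_on_finite[of "\<lambda>u. (Dom (Idx X) u, Cod (Idx X) u)" _ "S \<times> S"])
          show "inj_on (\<lambda>u. (Dom (Idx X) u, Cod (Idx X) u)) {u \<in> Arr (Idx X). Dom (Idx X) u \<in> S \<and> Cod (Idx X) u \<in> S}"
            by (rule inj_onI) (auto intro: hom_unique simp: hom_def)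
        qed (use finS in auto)
        have dR: "is_diagram C (restrict_diagram Z S)" if "is_diagram C Z" "Idx Z = Idx X" for Z :: "('b, 'o, 'a) pro_obj"
        proof -
          have "category (Idx (restrict_diagram Z S))"
            unfolding restrict_diagram_def full_subcat_def using J.category_axioms that(2) S(1)
            by unfold_locales (auto simp: hom_def)
          then show ?thesis
            using that S(1) unfolding is_diagram_def rX
            by (auto simp: restrict_diagram_def full_subcat_def)
        qed
        note dRX = dR[OF dX refl] and dRY = dR[OF dY eq]
        have \<pi>: "\<pi> s \<in> hom C LX (OMap X s)" if "s \<in> S" for s
          using LX that unfolding limit_cone_def cone_def rX by blast
        have \<rho>: "\<rho> s \<in> hom C LY (OMap Y s)" if "s \<in> S" for s
          using LY that unfolding limit_cone_def cone_def rX by blast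
        note pb = pullbackD[OF P]
        have ab: "Dom C a = OMap Y t" "Cod C a = LY" "Dom C b = LX" using a b by (auto simp: hom_def)
        note pb' = pb[unfolded ab]
        \<comment> \<open>The values chosen below form a compatible family, hence a morphism
          \<open>y\<close> from \<open>B\<close> to the limit \<open>LX\<close>.\<close>
        have "\<exists>y \<in> colim_hom C B LX. \<forall>s \<in> S. colim_push C B (OMap X s) (\<pi> s) y = h s"
        proof (rule limit_cone_class_ex[OF B _ _ dRX LX, of h, unfolded rX])
          fix s s' u assume s: "s \<in> S" "s' \<in> S" "u \<in> {u \<in> hom (Idx X) s s'. s \<in> S \<and> s' \<in> S}"
          show "colim_push C B (OMap X s') (AMap X u) (h s) = h s'"
          proof (cases "s' = s")
            case True
            then have "u = Idn (Idx X) s" using hom_unique[of u s s] J.Idn_in[OF S(1)[OF s(1)]] s by auto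
            then show ?thesis using push_Idn[OF dB Qs(1)[OF s(1)]] diagram_Idn[OF dX S(1)[OF s(1)]]
                diagram_Obj[OF dX S(1)[OF s(1)]] True by simp
          qed (use Qs(4)[of s u s'] s in auto)
        qed (use finS finA Qs(1) in auto)
        then obtain y where y: "y \<in> colim_hom C B LX" "\<And>s. s \<in> S \<Longrightarrow> colim_push C B (OMap X s) (\<pi> s) y = h s"
          by blast
        \<comment> \<open>\<open>V t\<close> and \<open>y\<close> agree over \<open>LY\<close>,
          tested on each projection, so they combine to a morphism \<open>z\<close> from
          \<open>B\<close> into the pullback.\<close>
        have "colim_push C B LY a (V t) = colim_push C B LY b y"
        proof (rule limit_cone_class_unique[OF B _ LY dRY, unfolded rX])
          fix s assume s: "s \<in> S"
          obtain u where u: "u \<in> hom (Idx X) t s" using hom_ex[OF S(2)[OF s]] by blast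
          have "colim_push C B (OMap Y s) (\<rho> s) (colim_push C B LY a (V t)) = V s"
            using push_push[OF dB Vin[OF t] a(1) \<rho>[OF s]] a(2)[OF s u] pro_homD(2)[OF V, of t s u] t S(1)[OF s] u eq
            by simp
          moreover have "colim_push C B (OMap Y s) (\<rho> s) (colim_push C B LY b y) = V s"
            using push_push[OF dB y(1) b(1) \<rho>[OF s]] b(2)[OF s] push_push[OF dB y(1) \<pi>[OF s] \<phi>[OF S(1)[OF s]]]
              y(2)[OF s] Qs(3)[OF s] by simp
          ultimately show "colim_push C B (OMap Y s) (\<rho> s) (colim_push C B LY a (V t)) =
             colim_push C B (OMap Y s) (\<rho> s) (colim_push C B LY b y)" by simp
        qed (use finS push_in[OF dB Vin[OF t] a(1)] push_in[OF dB y(1) b(1)] in auto)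
        then obtain z where z: "z \<in> colim_hom C B P" "colim_push C B (OMap Y t) p z = V t" "colim_push C B LX q z = y"
          using pullback_class_ex[OF B P, of "V t" y] Vin[OF t] y(1) unfolding ab by blast
        note piz = pull_in[OF dA dB I z(1)] and pnU = push_in[OF dA Uin[OF t] n(1)]
        \<comment> \<open>The square from \<open>I\<close> to the relative matching map commutes:
          equality in \<open>P\<close> is tested on its two legs, and on the second leg on the
          projections of \<open>LX\<close>.\<close>
        have "colim_push C A P n (U t) = pro_pull A P I z"
        proof (rule pullback_class_unique[OF A P pnU piz, unfolded ab])
          show "colim_push C A (OMap Y t) p (colim_push C A P n (U t)) = colim_push C A (OMap Y t) p (pro_pull A P I z)"
            using push_push[OF dA Uin[OF t] n(1) pb'(3)] n(2) UVs[OF t] pull_push[OF dA dB I z(1) pb'(3)] z(2) by simp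
          show "colim_push C A LX q (colim_push C A P n (U t)) = colim_push C A LX q (pro_pull A P I z)"
          proof (rule limit_cone_class_unique[OF A _ LX dRX, unfolded rX])
            fix s assume s: "s \<in> S"
            obtain u where u: "u \<in> hom (Idx X) t s" using hom_ex[OF S(2)[OF s]] by blast
            have "colim_push C A (OMap X s) (\<pi> s) (colim_push C A LX q (colim_push C A P n (U t))) = U s"
              using push_push[OF dA Uin[OF t] n(1) pb'(4)] push_push[OF dA Uin[OF t] Comp_in[OF n(1) pb'(4)] \<pi>[OF s]]
                n(3)[OF s u] pro_homD(2)[OF U t S(1)[OF s] u] by simp
            moreover have "colim_push C A (OMap X s) (\<pi> s) (colim_push C A LX q (pro_pull A P I z)) = U s"
              using pull_push[OF dA dB I z(1) pb'(4)] z(3) pull_push[OF dA dB I y(1) \<pi>[OF s]] y(2)[OF s] Qs(2)[OF s]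
              by simp
            ultimately show "colim_push C A (OMap X s) (\<pi> s) (colim_push C A LX q (colim_push C A P n (U t)))
              = colim_push C A (OMap X s) (\<pi> s) (colim_push C A LX q (pro_pull A P I z))" by simp
          qed (use finS push_in[OF dA pnU pb'(4)] push_in[OF dA piz pb'(4)] in auto)
        qed
        then obtain r where r: "r \<in> colim_hom C B (OMap X t)" "pro_pull A (OMap X t) I r = U t" "colim_push C B P n r = z"
          using l[OF n(4)] Uin[OF t] z(1) unfolding lifts_simple_iff[OF A B I n(1)] by blast
        have "Q h t r"
          unfolding Q_def
        proof (intro impI conjI allI)
          show "colim_push C B (OMap Y t) (\<phi> t) r = V t"
            using push_push[OF dB r(1) n(1) pb'(3)] n(2) r(3) z(2) by simp
          fix s u assume u: "u \<in> hom (Idx X) t s" "s \<noteq> t"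
          have s: "s \<in> S" using J.hom_Obj[OF u(1)] hom_le[OF u(1)] u(2) by (simp add: S_def)
          show "colim_push C B (OMap X s) (AMap X u) r = h s"
            using push_push[OF dB r(1) n(1) pb'(4)] push_push[OF dB r(1) Comp_in[OF n(1) pb'(4)] \<pi>[OF s]]
              n(3)[OF s u(1)] r(3) z(3) y(2)[OF s] by simp
        qed (use r in auto)
        then show ?thesis ..
      qed
    qed
    then obtain h where h: "\<And>t. Q h t (h t)" by blast
    \<comment> \<open>\<open>h\<close> is unconstrained outside the poset, whereas a family in
      \<open>pro_hom\<close> must be \<open>undefined\<close> there.\<close>
    define H where "H t = (if t \<in> ?T then h t else undefined)" for t
    have H: "H t \<in> colim_hom C B (OMap X t)" "pro_pull A (OMap X t) I (H t) = U t"
        "colim_push C B (OMap Y t) (\<phi> t) (H t) = V t"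
        "\<And>s u. u \<in> hom (Idx X) t s \<Longrightarrow> s \<noteq> t \<Longrightarrow> colim_push C B (OMap X s) (AMap X u) (H t) = H s"
      if "t \<in> ?T" for t
      using h[of t] that J.hom_Obj by (auto simp: Q_def H_def)
    have Hin: "H \<in> pro_hom C B X"
    proof (rule pro_homI)
      fix s s' u assume s: "s \<in> ?T" "s' \<in> ?T" "u \<in> hom (Idx X) s s'"
      show "colim_push C B (OMap X s') (AMap X u) (H s) = H s'"
      proof (cases "s' = s")
        case True
        then have "u = Idn (Idx X) s" using hom_unique[of u s s] J.Idn_in[OF s(1)] s by auto
        then show ?thesis using push_Idn[OF dB H(1)[OF s(1)]] diagram_Idn[OF dX s(1)]
            diagram_Obj[OF dX s(1)] True by simp
      qed (use H(4)[OF s(1,3)] in auto)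
    qed (use H(1) in \<open>auto simp: H_def\<close>)
    have "pro_comp C A X H I = U"
      by (rule pro_hom_ext[OF pro_comp_in[OF dA dB dX I Hin] U]) (simp add: pro_comp_pull H(2))
    moreover have "pro_comp C B Y (induced_map C X Y \<phi>) H = V"
      by (rule pro_hom_ext[OF pro_comp_in[OF dB dX dY Hin induced_map_in[OF nt]] V])
         (use pull_induced[OF dB nt Hin] H(3) eq in simp)
    ultimately show "\<exists>H\<in>pro_hom C B X. pro_comp C A X H I = U \<and> pro_comp C B Y (induced_map C X Y \<phi>) H = V"
      using Hin by blast
  qed
qed

end

section \<open>Diagrams indexed by posets\<close>

definition pair_code :: "'i \<times> 'i \<Rightarrow> 'i" where
  "pair_code = (SOME f. inj f)"

text \<open>Cardinal arithmetic: an infinite set is equinumerous with its square, so the choice in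
  \<open>pair_code\<close> has a witness.\<close>

lemma inj_pair_code:
  assumes "infinite (UNIV :: 'i set)"
  shows "inj (pair_code :: 'i \<times> 'i \<Rightarrow> 'i)"
proof -
  have "(card_of (UNIV \<times> UNIV :: ('i \<times> 'i) set), card_of (UNIV :: 'i set)) \<in> ordLeq"
    using card_of_Times_same_infinite[OF assms] by (rule ordIso_imp_ordLeq)
  then have "\<exists>f :: 'i \<times> 'i \<Rightarrow> 'i. inj f"
    unfolding card_of_ordLeq[symmetric] by auto
  then show ?thesis unfolding pair_code_def by (rule someI_ex)
qed

text \<open>The arrows of a poset category must be elements of \<open>'i\<close> again, hence the coding.\<close>

definition poset_cat :: "'i set \<Rightarrow> ('i \<times> 'i) set \<Rightarrow> ('i, 'i) cat" where
  "poset_cat T le = \<lparr>Obj = T, Arr = {pair_code (x, y) | x y. (y, x) \<in> le},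
     Dom = (\<lambda>f. fst (inv pair_code f)), Cod = (\<lambda>f. snd (inv pair_code f)), Idn = (\<lambda>x. pair_code (x, x)),
     Comp = (\<lambda>g f. pair_code (fst (inv pair_code f), snd (inv pair_code g)))\<rparr>"

definition poset_diagram ::
    "'i set \<Rightarrow> ('i \<times> 'i) set \<Rightarrow> ('i \<Rightarrow> 'o) \<Rightarrow> ('i \<Rightarrow> 'i \<Rightarrow> 'a) \<Rightarrow> ('i, 'i, 'o, 'a) diagram" where
  "poset_diagram T le ob ar = \<lparr>Idx = poset_cat T le, OMap = ob,
     AMap = (\<lambda>f. ar (fst (inv pair_code f)) (snd (inv pair_code f)))\<rparr>"

text \<open>A diagram on a poset freed from coded arrows: \<open>ar s t\<close> is the transition
  map from the larger \<open>s\<close> to the smaller \<open>t\<close>. Recursive constructions work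
  at this level and pass to \<open>poset_diagram\<close> afterwards.\<close>

definition poset_functor ::
    "('o, 'a) cat \<Rightarrow> 'i set \<Rightarrow> ('i \<times> 'i) set \<Rightarrow> ('i \<Rightarrow> 'o) \<Rightarrow> ('i \<Rightarrow> 'i \<Rightarrow> 'a) \<Rightarrow> bool" where
  "poset_functor C T le ob ar \<longleftrightarrow>
     (\<forall>s \<in> T. ob s \<in> Obj C \<and> ar s s = Idn C (ob s))
     \<and> (\<forall>(t, s) \<in> le. ar s t \<in> hom C (ob s) (ob t))
     \<and> (\<forall>(t, s) \<in> le. \<forall>u. (u, t) \<in> le \<longrightarrow> ar s u = ar t u \<cdot>\<^bsub>C\<^esub> ar s t)"

lemma poset_functorD:
  assumes "poset_functor C T le ob ar"
  shows "s \<in> T \<Longrightarrow> ob s \<in> Obj C" "s \<in> T \<Longrightarrow> ar s s = Idn C (ob s)"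
    "(t, s) \<in> le \<Longrightarrow> ar s t \<in> hom C (ob s) (ob t)"
    "(t, s) \<in> le \<Longrightarrow> (u, t) \<in> le \<Longrightarrow> ar s u = ar t u \<cdot>\<^bsub>C\<^esub> ar s t"
  using assms unfolding poset_functor_def by blast+

lemma poset_functorI:
  assumes "\<And>s. s \<in> T \<Longrightarrow> ob s \<in> Obj C" "\<And>s. s \<in> T \<Longrightarrow> ar s s = Idn C (ob s)"
    and "\<And>s t. (t, s) \<in> le \<Longrightarrow> ar s t \<in> hom C (ob s) (ob t)"
    and "\<And>s t u. (t, s) \<in> le \<Longrightarrow> (u, t) \<in> le \<Longrightarrow> ar s u = ar t u \<cdot>\<^bsub>C\<^esub> ar s t"
  shows "poset_functor C T le ob ar"
  unfolding poset_functor_def using assms by blast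

definition poset_trans ::
    "('o, 'a) cat \<Rightarrow> 'i set \<Rightarrow> ('i \<times> 'i) set \<Rightarrow> ('i \<Rightarrow> 'o) \<Rightarrow> ('i \<Rightarrow> 'i \<Rightarrow> 'a)
      \<Rightarrow> ('i \<Rightarrow> 'o) \<Rightarrow> ('i \<Rightarrow> 'i \<Rightarrow> 'a) \<Rightarrow> ('i \<Rightarrow> 'a) \<Rightarrow> bool" where
  "poset_trans C T le xo xa yo ya \<phi> \<longleftrightarrow>
     poset_functor C T le xo xa \<and> poset_functor C T le yo ya
     \<and> (\<forall>s \<in> T. \<phi> s \<in> hom C (xo s) (yo s)) \<and> (\<forall>(t, s) \<in> le. \<phi> t \<cdot>\<^bsub>C\<^esub> xa s t = ya s t \<cdot>\<^bsub>C\<^esub> \<phi> s)"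

lemma poset_transD:
  assumes "poset_trans C T le xo xa yo ya \<phi>"
  shows "poset_functor C T le xo xa" "poset_functor C T le yo ya" "s \<in> T \<Longrightarrow> \<phi> s \<in> hom C (xo s) (yo s)"
    "(t, s) \<in> le \<Longrightarrow> \<phi> t \<cdot>\<^bsub>C\<^esub> xa s t = ya s t \<cdot>\<^bsub>C\<^esub> \<phi> s"
  using assms unfolding poset_trans_def by blast+

lemma poset_transI:
  assumes "poset_functor C T le xo xa" "poset_functor C T le yo ya"
    and "\<And>s. s \<in> T \<Longrightarrow> \<phi> s \<in> hom C (xo s) (yo s)"
    and "\<And>s t. (t, s) \<in> le \<Longrightarrow> \<phi> t \<cdot>\<^bsub>C\<^esub> xa s t = ya s t \<cdot>\<^bsub>C\<^esub> \<phi> s"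
  shows "poset_trans C T le xo xa yo ya \<phi>"
  using assms unfolding poset_trans_def by blast

locale coded_poset =
  fixes T :: "'i set" and le :: "('i \<times> 'i) set"
  assumes infinite_index: "infinite (UNIV :: 'i set)" and po: "partial_order_on T le"
begin

lemma inv_pair_code [simp]: "inv pair_code (pair_code p) = (p :: 'i \<times> 'i)"
  by (rule inv_f_f[OF inj_pair_code[OF infinite_index]])

lemma poset_cat_simps [simp]:
  "Obj (poset_cat T le) = T"
  "Dom (poset_cat T le) (pair_code (x, y)) = x"
  "Cod (poset_cat T le) (pair_code (x, y)) = y"
  "Idn (poset_cat T le) x = pair_code (x, x)"
  "Comp (poset_cat T le) (pair_code (y', z)) (pair_code (x, y)) = pair_code (x, z)"
  by (simp_all add: poset_cat_def)

lemma poset_diagram_simps [simp]: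
  "Idx (poset_diagram T le ob ar) = poset_cat T le"
  "OMap (poset_diagram T le ob ar) = ob"
  "AMap (poset_diagram T le ob ar) (pair_code (x, y)) = ar x y"
  by (simp_all add: poset_diagram_def)

lemma Arr_poset_cat: "f \<in> Arr (poset_cat T le) \<longleftrightarrow> (\<exists>x y. f = pair_code (x, y) \<and> (y, x) \<in> le)"
  by (simp add: poset_cat_def)

lemma in_hom_poset_cat: "f \<in> hom (poset_cat T le) x y \<longleftrightarrow> (y, x) \<in> le \<and> f = pair_code (x, y)"
  unfolding hom_def by (auto simp: Arr_poset_cat)

lemma hom_poset_cat: "hom (poset_cat T le) x y = (if (y, x) \<in> le then {pair_code (x, y)} else {})"
  by (auto simp: in_hom_poset_cat)

lemma category_poset_cat: "category (poset_cat T le)"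
  by unfold_locales
    (auto simp: Arr_poset_cat in_hom_poset_cat partial_order_onD'(1)[OF po]
      dest: partial_order_onD'(2,3)[OF po] intro: partial_order_onD'(4)[OF po])

lemma poset_category_poset_cat: "poset_category le (poset_cat T le)"
  unfolding poset_category_def using category_poset_cat po by (auto simp: hom_poset_cat)

lemma directed_poset_cat:
  assumes "T \<noteq> {}" "\<And>x y. x \<in> T \<Longrightarrow> y \<in> T \<Longrightarrow> \<exists>z \<in> T. (x, z) \<in> le \<and> (y, z) \<in> le"
  shows "directed (poset_cat T le)"
  unfolding directed_def
proof (intro conjI ballI)
  fix s t f g assume "s \<in> Obj (poset_cat T le)" "f \<in> hom (poset_cat T le) s t" "g \<in> hom (poset_cat T le) s t"
  moreover from this have "f = g" by (auto simp: in_hom_poset_cat)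
  ultimately show "\<exists>u\<in>Obj (poset_cat T le). \<exists>h\<in>hom (poset_cat T le) u s.
      f \<cdot>\<^bsub>poset_cat T le\<^esub> h = g \<cdot>\<^bsub>poset_cat T le\<^esub> h"
    using category.Idn_in[OF category_poset_cat] by blast
qed (use assms category_poset_cat in \<open>auto simp: hom_poset_cat\<close>)

lemma is_diagram_poset_diagram:
  assumes "poset_functor C T le ob ar"
  shows "is_diagram C (poset_diagram T le ob ar)"
  unfolding is_diagram_def using category_poset_cat
  by (auto simp: in_hom_poset_cat Arr_poset_cat poset_functorD(1-3)[OF assms] poset_functorD(4)[OF assms])

lemma nat_trans_poset_diagram:
  assumes "poset_trans C T le xo xa yo ya \<phi>"
  shows "nat_trans C (poset_diagram T le xo xa) (poset_diagram T le yo ya) \<phi>"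
  unfolding nat_trans_def using is_diagram_poset_diagram poset_transD[OF assms] by (auto simp: in_hom_poset_cat)

end

text \<open>Only pairs inside \<open>F\<close> are tested, so the ambient order \<open>le\<close>
  can be kept when \<open>F\<close> is a set of strict predecessors.\<close>

definition poset_cone ::
    "('o, 'a) cat \<Rightarrow> 'i set \<Rightarrow> ('i \<times> 'i) set \<Rightarrow> ('i \<Rightarrow> 'o) \<Rightarrow> ('i \<Rightarrow> 'i \<Rightarrow> 'a) \<Rightarrow> 'o \<Rightarrow> ('i \<Rightarrow> 'a) \<Rightarrow> bool" where
  "poset_cone C F le ob ar L \<pi> \<longleftrightarrow>
     L \<in> Obj C \<and> (\<forall>s \<in> F. \<pi> s \<in> hom C L (ob s))
     \<and> (\<forall>s \<in> F. \<forall>t \<in> F. (t, s) \<in> le \<longrightarrow> ar s t \<cdot>\<^bsub>C\<^esub> \<pi> s = \<pi> t)"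

definition poset_limit ::
    "('o, 'a) cat \<Rightarrow> 'i set \<Rightarrow> ('i \<times> 'i) set \<Rightarrow> ('i \<Rightarrow> 'o) \<Rightarrow> ('i \<Rightarrow> 'i \<Rightarrow> 'a) \<Rightarrow> 'o \<Rightarrow> ('i \<Rightarrow> 'a) \<Rightarrow> bool" where
  "poset_limit C F le ob ar L \<pi> \<longleftrightarrow>
     poset_cone C F le ob ar L \<pi>
     \<and> (\<forall>K \<kappa>. poset_cone C F le ob ar K \<kappa> \<longrightarrow> (\<exists>!h. h \<in> hom C K L \<and> (\<forall>s \<in> F. \<pi> s \<cdot>\<^bsub>C\<^esub> h = \<kappa> s)))"

text \<open>The arrow names \<open>a s t\<close> are abstracted, so that coded posets and their
  restrictions to subsets fall under one comparison.\<close>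

lemma limit_cone_iff_poset_limit:
  assumes F: "Obj (Idx D) = F"
    and h: "\<And>s t. s \<in> F \<Longrightarrow> t \<in> F \<Longrightarrow> hom (Idx D) s t = (if (t, s) \<in> le then {a s t} else {})"
    and D: "\<And>s. s \<in> F \<Longrightarrow> OMap D s = ob s"
      "\<And>s t. s \<in> F \<Longrightarrow> t \<in> F \<Longrightarrow> (t, s) \<in> le \<Longrightarrow> AMap D (a s t) = ar s t"
  shows "limit_cone C D L \<pi> \<longleftrightarrow> poset_limit C F le ob ar L \<pi>"
proof -
  have "cone C D K \<kappa> \<longleftrightarrow> poset_cone C F le ob ar K \<kappa>" for K \<kappa>
    unfolding cone_def poset_cone_def F using h D by auto
  then show ?thesis unfolding limit_cone_def poset_limit_def F by simp
qed

lemma (in coded_poset) limit_cone_restrict_poset_diagram: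
  assumes "F \<subseteq> T" "poset_limit C F le ob ar L \<pi>"
  shows "limit_cone C (restrict_diagram (poset_diagram T le ob ar) F) L \<pi>"
proof -
  have "hom (full_subcat (poset_cat T le) F) s t = hom (poset_cat T le) s t" if "s \<in> F" "t \<in> F" for s t
    using that by (auto simp: full_subcat_def hom_def)
  then show ?thesis
    by (subst limit_cone_iff_poset_limit[where F = F and le = le and ob = ob and ar = ar and a = "\<lambda>s t. pair_code (s, t)"])
       (use assms in \<open>auto simp: restrict_diagram_def hom_poset_cat\<close>, auto simp: full_subcat_def)
qed

context category
begin

lemma poset_cone_cong:
  assumes "\<And>s. s \<in> F \<Longrightarrow> ob s = ob' s" "\<And>s t. s \<in> F \<Longrightarrow> t \<in> F \<Longrightarrow> (t, s) \<in> le \<Longrightarrow> ar s t = ar' s t"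
  shows "poset_cone C F le ob ar L \<pi> \<longleftrightarrow> poset_cone C F le ob' ar' L \<pi>"
  unfolding poset_cone_def using assms by auto

lemma poset_limit_cong:
  assumes "\<And>s. s \<in> F \<Longrightarrow> ob s = ob' s" "\<And>s t. s \<in> F \<Longrightarrow> t \<in> F \<Longrightarrow> (t, s) \<in> le \<Longrightarrow> ar s t = ar' s t"
  shows "poset_limit C F le ob ar L \<pi> \<longleftrightarrow> poset_limit C F le ob' ar' L \<pi>"
proof -
  have "poset_cone C F le ob ar = poset_cone C F le ob' ar'"
    by (intro ext, rule poset_cone_cong) (use assms in auto)
  then show ?thesis unfolding poset_limit_def by simp
qed

lemma finite_poset_limit_nat:
  fixes ob :: "nat \<Rightarrow> 'o"
  assumes "has_finite_limits C" "finite F" "partial_order_on F le" "poset_functor C F le ob ar"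
  shows "\<exists>L \<pi>. poset_limit C F le ob ar L \<pi>"
proof -
  interpret coded_poset F le using assms by unfold_locales auto
  have "finite le" using finite_subset[OF partial_order_onD(4)[OF assms(3)]] assms(2) by blast
  moreover have "Arr (poset_cat F le) \<subseteq> (\<lambda>p. pair_code (snd p, fst p)) ` le"
    by (force simp: Arr_poset_cat)
  ultimately have "finite (Arr (poset_cat F le))" by (rule finite_surj)
  then obtain L \<pi> where "limit_cone C (poset_diagram F le ob ar) L \<pi>"
    using assms(1,2) is_diagram_poset_diagram[OF assms(4)] unfolding has_finite_limits_def
    by (metis poset_cat_simps(1) poset_diagram_simps(1))
  then have "poset_limit C F le ob ar L \<pi>"
    by (subst (asm) limit_cone_iff_poset_limit[where F = F and le = le and ob = ob and ar = ar and a = "\<lambda>s t. pair_code (s, t)"])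
       (auto simp: hom_poset_cat)
  then show ?thesis by blast
qed

text \<open>\<open>has_finite_limits\<close> speaks of diagrams indexed by natural numbers, so the
  finite poset is carried over along an injection \<open>e\<close> and the limit is read back
  through its inverse \<open>d\<close>.\<close>

lemma finite_poset_limit:
  fixes F :: "'i set"
  assumes "has_finite_limits C" "finite F" "partial_order_on F le" "poset_functor C F le ob ar"
  shows "\<exists>L \<pi>. poset_limit C F le ob ar L \<pi>"
proof -
  obtain e :: "'i \<Rightarrow> nat" where e: "inj_on e F" using finite_imp_inj_to_nat_seg[OF assms(2)] by blast
  define d where "d = inv_into F e"
  have de [simp]: "d (e s) = s" if "s \<in> F" for s using e that by (simp add: d_def)
  define le' where "le' = (\<lambda>(x, y). (e x, e y)) ` le"
  note po = partial_order_onD'[OF assms(3)]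
  have le': "(e x, e y) \<in> le' \<longleftrightarrow> (x, y) \<in> le" if "x \<in> F" "y \<in> F" for x y
  proof
    assume "(e x, e y) \<in> le'"
    then obtain a b where ab: "e x = e a" "e y = e b" "(a, b) \<in> le" unfolding le'_def by auto
    then have "x = a" "y = b" using that po(2,3)[OF ab(3)] e by (simp_all add: inj_on_eq_iff)
    then show "(x, y) \<in> le" using ab by simp
  qed (auto simp: le'_def)
  have le'E: "\<exists>x y. p = e x \<and> q = e y \<and> x \<in> F \<and> y \<in> F \<and> (x, y) \<in> le" if "(p, q) \<in> le'" for p q
  proof -
    obtain a b where "p = e a" "q = e b" "(a, b) \<in> le" using \<open>(p, q) \<in> le'\<close> unfolding le'_def by auto
    then show ?thesis using po(2,3)[of a b] by (intro exI[of _ a] exI[of _ b]) simp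
  qed
  have "partial_order_on (e ` F) le'"
    unfolding partial_order_on_def preorder_on_def refl_on_def
  proof (intro conjI)
    show "le' \<subseteq> e ` F \<times> e ` F" using le'E by fast
    show "\<forall>x\<in>e ` F. (x, x) \<in> le'" using le' po(1) by auto
    show "trans le'"
    proof (rule transI)
      fix x y z assume "(x, y) \<in> le'" "(y, z) \<in> le'"
      then obtain a b b' c where a: "x = e a" "y = e b" "y = e b'" "z = e c" "(a, b) \<in> le" "(b', c) \<in> le"
        "a \<in> F" "b \<in> F" "b' \<in> F" "c \<in> F"
        using le'E by metis
      then have "b' = b" using e by (simp add: inj_on_eq_iff)
      then show "(x, z) \<in> le'" using a po(4) le' by blast
    qed
    show "antisym le'"
    proof (rule antisymI)
      fix x y assume "(x, y) \<in> le'" "(y, x) \<in> le'"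
      then obtain a b where a: "x = e a" "y = e b" "(a, b) \<in> le" "a \<in> F" "b \<in> F" "(e b, e a) \<in> le'"
        using le'E by metis
      then have "(b, a) \<in> le" using le' by blast
      then show "x = y" using a po(5) by blast
    qed
  qed
  moreover have "poset_functor C (e ` F) le' (ob \<circ> d) (\<lambda>s t. ar (d s) (d t))"
    unfolding poset_functor_def
  proof (intro conjI ballI)
    fix p assume "p \<in> le'"
    then obtain x y where p: "p = (e x, e y)" "x \<in> F" "y \<in> F" "(x, y) \<in> le" using le'E by (cases p) blast
    show "case p of (t, s) \<Rightarrow> ar (d s) (d t) \<in> hom C ((ob \<circ> d) s) ((ob \<circ> d) t)"
      using p poset_functorD(3)[OF assms(4)] by simp
    have "ar (d (e y)) (d u) = ar (d (e x)) (d u) \<cdot> ar (d (e y)) (d (e x))" if u: "(u, e x) \<in> le'" for u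
    proof -
      obtain w where "u = e w" "w \<in> F" "(w, x) \<in> le" using le'E[OF u] p(2) e by (metis inj_on_eq_iff)
      then show ?thesis using p poset_functorD(4)[OF assms(4)] by simp
    qed
    then show "case p of (t, s) \<Rightarrow> \<forall>u. (u, t) \<in> le' \<longrightarrow> ar (d s) (d u) = ar (d t) (d u) \<cdot> ar (d s) (d t)"
      using p by simp
  qed (use poset_functorD[OF assms(4)] in auto)
  ultimately obtain L \<pi> where L: "poset_limit C (e ` F) le' (ob \<circ> d) (\<lambda>s t. ar (d s) (d t)) L \<pi>"
    using finite_poset_limit_nat[OF assms(1)] assms(2) by blast
  have c: "poset_cone C F le ob ar K (\<lambda>s. \<kappa> (e s)) \<longleftrightarrow> poset_cone C (e ` F) le' (ob \<circ> d) (\<lambda>s t. ar (d s) (d t)) K \<kappa>"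
    for K \<kappa> unfolding poset_cone_def by (auto simp: le')
  have "poset_limit C F le ob ar L (\<lambda>s. \<pi> (e s))"
    unfolding poset_limit_def
  proof (intro conjI allI impI)
    show "poset_cone C F le ob ar L (\<lambda>s. \<pi> (e s))" using L unfolding c poset_limit_def by blast
    fix K \<kappa> assume "poset_cone C F le ob ar K \<kappa>"
    then have "poset_cone C F le ob ar K (\<lambda>s. (\<kappa> \<circ> d) (e s))" unfolding poset_cone_def by simp
    then have "\<exists>!h. h \<in> hom C K L \<and> (\<forall>s \<in> e ` F. \<pi> s \<cdot> h = (\<kappa> \<circ> d) s)"
      using L unfolding c poset_limit_def by blast
    then show "\<exists>!h. h \<in> hom C K L \<and> (\<forall>s \<in> F. \<pi> (e s) \<cdot> h = \<kappa> s)" by simp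
  qed
  then show ?thesis by blast
qed

text \<open>A terminal object arises as the limit of the empty diagram.\<close>

lemma terminal_exists:
  assumes "has_finite_limits C"
  obtains L where "L \<in> Obj C" "\<And>K. K \<in> Obj C \<Longrightarrow> \<exists>!h. h \<in> hom C K L"
proof -
  have "\<exists>L \<pi>. poset_limit C ({} :: nat set) {} ob ar L \<pi>" for ob ar
    by (rule finite_poset_limit_nat[OF assms]) (auto simp: poset_functor_def)
  then show thesis using that unfolding poset_limit_def poset_cone_def by auto
qed

lemma pullback_exists:
  assumes lim: "has_finite_limits C" and f: "f \<in> hom C x z" and g: "g \<in> hom C y z"
  obtains P p q where "is_pullback C f g P p q"
proof -
  \<comment> \<open>The cospan as a poset: \<open>2\<close> is the common target and lies below
    \<open>0\<close> and \<open>1\<close>, because arrows run from larger to smaller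
    elements.\<close>
  define F :: "nat set" where "F = {0, 1, 2}"
  define le :: "(nat \<times> nat) set" where "le = {(0, 0), (1, 1), (2, 2), (2, 0), (2, 1)}"
  define ob where "ob = (\<lambda>s :: nat. if s = 0 then x else if s = 1 then y else z)"
  define ar where "ar = (\<lambda>s t :: nat. if s = t then Idn C (ob s) else if s = 0 then f else g)"
  note o = hom_Obj[OF f] hom_Obj[OF g]
  have po: "partial_order_on F le"
    unfolding partial_order_on_def preorder_on_def refl_on_def trans_def antisym_def by (auto simp: F_def le_def)
  have "poset_functor C F le ob ar"
    unfolding poset_functor_def F_def le_def ob_def ar_def
    using o f g Idn_in Comp_Idn[OF f] Comp_Idn[OF g] Idn_Comp[OF f] Idn_Comp[OF g] Comp_Idn[OF Idn_in] by auto
  moreover have "finite F" by (simp add: F_def)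
  ultimately obtain P \<pi> where P: "poset_limit C F le ob ar P \<pi>"
    using finite_poset_limit_nat[OF lim _ po] by blast
  have cone: "poset_cone C F le ob ar K \<kappa> \<longleftrightarrow> K \<in> Obj C \<and> \<kappa> 0 \<in> hom C K x \<and> \<kappa> 1 \<in> hom C K y \<and> \<kappa> 2 \<in> hom C K z
      \<and> f \<cdot> \<kappa> 0 = \<kappa> 2 \<and> g \<cdot> \<kappa> 1 = \<kappa> 2" for K \<kappa>
    unfolding poset_cone_def F_def le_def ob_def ar_def using Idn_Comp by auto
  have \<pi>: "P \<in> Obj C" "\<pi> 0 \<in> hom C P x" "\<pi> 1 \<in> hom C P y" "f \<cdot> \<pi> 0 = \<pi> 2" "g \<cdot> \<pi> 1 = \<pi> 2"
    using P unfolding poset_limit_def cone by auto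
  have fg: "f \<in> Arr C" "g \<in> Arr C" "Dom C f = x" "Dom C g = y" "Cod C f = z" "Cod C g = z"
    using f g by (auto simp: hom_def)
  have "is_pullback C f g P (\<pi> 0) (\<pi> 1)"
    unfolding is_pullback_def fg
  proof (intro conjI allI ballI impI)
    fix Q a b assume a: "a \<in> hom C Q x" and b: "b \<in> hom C Q y" and e: "f \<cdot> a = g \<cdot> b"
    define \<kappa> where "\<kappa> = (\<lambda>s :: nat. if s = 0 then a else if s = 1 then b else f \<cdot> a)"
    have "poset_cone C F le ob ar Q \<kappa>"
      unfolding cone \<kappa>_def using a b e hom_Obj[OF a] Comp_in[OF a f] by simp
    then have "\<exists>!h. h \<in> hom C Q P \<and> (\<forall>s \<in> F. \<pi> s \<cdot> h = \<kappa> s)"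
      using P unfolding poset_limit_def by blast
    moreover have "(\<forall>s \<in> F. \<pi> s \<cdot> h = \<kappa> s) \<longleftrightarrow> \<pi> 0 \<cdot> h = a \<and> \<pi> 1 \<cdot> h = b" if h: "h \<in> hom C Q P" for h
      using comp_left_eq[OF \<pi>(4,2) f h] by (auto simp: F_def \<kappa>_def)
    ultimately show "\<exists>!h. h \<in> hom C Q P \<and> \<pi> 0 \<cdot> h = a \<and> \<pi> 1 \<cdot> h = b"
      by (metis (no_types, lifting))
  qed (use \<pi> fg in auto)
  then show thesis using that by blast
qed

end

section \<open>A universal cofinite directed poset\<close>

text \<open>\<open>lab x\<close> holds the finitely many tasks to be settled at \<open>x\<close>,
  each an element of \<open>'i\<close> read as an object or an arrow of an index category. Two
  labels at once name a parallel pair, and growth is strict because the transition map from an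
  element to itself is an identity and equalizes nothing.\<close>

locale index_poset = coded_poset T le for T :: "'i set" and le +
  fixes lab :: "'i \<Rightarrow> 'i set"
  assumes cofinite: "cofinite T le" and nonempty: "T \<noteq> {}"
    and upper: "x \<in> T \<Longrightarrow> y \<in> T \<Longrightarrow> \<exists>z \<in> T. (x, z) \<in> le \<and> (y, z) \<in> le"
    and finite_lab: "finite (lab x)"
    and grow: "x \<in> T \<Longrightarrow> \<exists>y \<in> T. (x, y) \<in> le \<and> x \<noteq> y \<and> a \<in> lab y \<and> b \<in> lab y"

lemma finite_sets_code:
  assumes inf: "infinite (UNIV :: 'i set)"
  obtains e :: "'i set \<Rightarrow> 'i" where "inj_on e {A. finite A}"
proof -
  note inj = inj_pair_code[OF inf]
  obtain n :: "nat \<Rightarrow> 'i" where n: "inj n" using infinite_countable_subset[OF inf] by blast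
  \<comment> \<open>Nested pairs ending in \<open>undefined\<close> are shown to separate only lists
    of equal length, hence \<open>e\<close> stores the length as well.\<close>
  define c :: "'i list \<Rightarrow> 'i" where "c xs = foldr (\<lambda>x a. pair_code (x, a)) xs undefined" for xs
  have c: "c xs = c ys \<Longrightarrow> xs = ys" if "length xs = length ys" for xs ys
    using that by (induction xs ys rule: list_induct2) (auto simp: c_def inj_eq[OF inj])
  define l where "l A = (SOME xs. set xs = A)" for A :: "'i set"
  have l: "set (l A) = A" if "finite A" for A
    unfolding l_def using finite_list[OF that] by (rule someI_ex)
  define e where "e A = pair_code (n (length (l A)), c (l A))" for A
  have "inj_on e {A. finite A}"
  proof (rule inj_onI)
    fix A B assume a: "A \<in> {A. finite A}" "B \<in> {A. finite A}" "e A = e B"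
    then have "length (l A) = length (l B)" "c (l A) = c (l B)"
      using injD[OF inj, of "(n (length (l A)), c (l A))" "(n (length (l B)), c (l B))"] injD[OF n]
      by (auto simp: e_def)
    then have "l A = l B" using c by blast
    then show "A = B" using l a by (metis mem_Collect_eq)
  qed
  then show thesis using that by blast
qed

text \<open>The elements are coded finite subsets of \<open>'i\<close>, ordered by inclusion. A
  member \<open>pair_code (x, y)\<close> carries the label \<open>x\<close>; since infinitely many
  members carry each label, a fresh one can always be added, which gives strict growth with
  prescribed labels.\<close>

lemma index_poset_exists:
  assumes inf: "infinite (UNIV :: 'i set)"
  obtains T :: "'i set" and le lab where "index_poset T le lab"
proof -
  note inj = inj_pair_code[OF inf]
  obtain e :: "'i set \<Rightarrow> 'i" where e: "inj_on e {A. finite A}" using finite_sets_code[OF inf] .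
  have e_eq: "e A = e B \<longleftrightarrow> A = B" if "finite A" "finite B" for A B
    using inj_on_eq_iff[OF e] that by simp
  define T where "T = e ` {A. finite A}"
  define le where "le = {(e A, e B) | A B. finite B \<and> A \<subseteq> B}"
  have le: "(e A, e B) \<in> le \<longleftrightarrow> A \<subseteq> B" if "finite A" "finite B" for A B
  proof
    assume "(e A, e B) \<in> le"
    then obtain A' B' where "e A = e A'" "e B = e B'" "finite B'" "A' \<subseteq> B'" unfolding le_def by auto
    then show "A \<subseteq> B" using e_eq that finite_subset by metis
  qed (use that in \<open>auto simp: le_def\<close>)
  have leE: "\<exists>A B. finite A \<and> finite B \<and> x = e A \<and> y = e B \<and> A \<subseteq> B" if "(x, y) \<in> le" for x y
    using that finite_subset unfolding le_def by blast
  define lab where "lab x = (\<lambda>z. fst (inv pair_code z)) ` (inv_into {A. finite A} e x)" for x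
  have lab: "lab (e A) = (\<lambda>z. fst (inv pair_code z)) ` A" if "finite A" for A
    using e that by (simp add: lab_def)
  have fresh: "\<exists>z. z \<notin> A \<and> fst (inv pair_code z) = x" if "finite A" for A and x :: 'i
  proof -
    have "inj (\<lambda>y. pair_code (x, y))" by (rule injI) (simp add: inj_eq[OF inj])
    then have "infinite (range (\<lambda>y. pair_code (x, y)))" using inf finite_imageD by blast
    then have "\<not> range (\<lambda>y. pair_code (x, y)) \<subseteq> A" using that finite_subset by blast
    then obtain y where "pair_code (x, y) \<notin> A" by blast
    then show ?thesis using inv_f_f[OF inj] by (intro exI[of _ "pair_code (x, y)"]) simp
  qed
  \<comment> \<open>\<open>inv_into\<close> gives no control outside \<open>T\<close>, while
    finiteness of the label sets is demanded everywhere.\<close>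
  define lab' where "lab' x = (if x \<in> T then lab x else {})" for x
  have "index_poset T le lab'"
  proof unfold_locales
    show "infinite (UNIV :: 'i set)" by (rule inf)
    show "partial_order_on T le"
      unfolding partial_order_on_def preorder_on_def refl_on_def
    proof (intro conjI)
      show "le \<subseteq> T \<times> T" using leE unfolding T_def by fast
      show "\<forall>x\<in>T. (x, x) \<in> le" using le unfolding T_def by auto
      show "trans le"
      proof (rule transI)
        fix x y z assume "(x, y) \<in> le" "(y, z) \<in> le"
        then obtain A B B' D where "finite A" "finite B" "finite B'" "finite D" "x = e A" "y = e B" "y = e B'" "z = e D"
           "A \<subseteq> B" "B' \<subseteq> D" using leE by metis
        then show "(x, z) \<in> le" using le e_eq by (metis subset_trans)
      qed
      show "antisym le"
      proof (rule antisymI)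
        fix x y assume xy: "(x, y) \<in> le" "(y, x) \<in> le"
        then obtain A B where A: "finite A" "finite B" "x = e A" "y = e B" "A \<subseteq> B" using leE by metis
        then have "B \<subseteq> A" using xy(2) le by simp
        then show "x = y" using A by auto
      qed
    qed
    show "cofinite T le"
      unfolding cofinite_def
    proof
      fix x assume "x \<in> T"
      then obtain B where B: "finite B" "x = e B" by (auto simp: T_def)
      have "{z \<in> T. (z, x) \<in> le} \<subseteq> e ` Pow B" using B le unfolding T_def by auto
      then show "finite {z \<in> T. (z, x) \<in> le}" using B finite_subset by blast
    qed
    show "T \<noteq> {}" unfolding T_def by auto
    show "finite (lab' x)" for x unfolding lab'_def using lab by (auto simp: T_def)
    fix x assume "x \<in> T"
    then obtain A where A: "finite A" "x = e A" by (auto simp: T_def)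
    show "\<exists>y\<in>T. (x, y) \<in> le \<and> x \<noteq> y \<and> a \<in> lab' y \<and> b \<in> lab' y" for a b
    proof -
      obtain z1 z2 where z: "z1 \<notin> A" "fst (inv pair_code z1) = a" "fst (inv pair_code z2) = b" using fresh[OF A(1)] by metis
      have f: "finite (insert z1 (insert z2 A))" using A by simp
      show ?thesis
        by (rule bexI[of _ "e (insert z1 (insert z2 A))"])
           (use A f z in \<open>auto simp: le e_eq lab lab'_def T_def\<close>)
    qed
    fix y assume "y \<in> T"
    then obtain B where B: "finite B" "y = e B" by (auto simp: T_def)
    show "\<exists>z\<in>T. (x, z) \<in> le \<and> (y, z) \<in> le"
      by (rule bexI[of _ "e (A \<union> B)"]) (use A B le in \<open>auto simp: T_def\<close>)
  qed
  then show thesis using that by blast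
qed

context index_poset
begin

lemma directed_index: "directed (poset_cat T le)"
  by (rule directed_poset_cat[OF nonempty upper])

lemma wf_strict: "wf {(s, t). (s, t) \<in> le \<and> s \<noteq> t}"
  using wf_cofinite_strict[OF po cofinite] .

lemma finite_below: "finite {s \<in> T. (s, t) \<in> le \<and> s \<noteq> t}"
proof (cases "t \<in> T")
  case True
  then have "finite {z \<in> T. (z, t) \<in> le}" using cofinite unfolding cofinite_def by blast
  then show ?thesis by (rule rev_finite_subset) auto
next
  case False
  then have "{s \<in> T. (s, t) \<in> le \<and> s \<noteq> t} = {}" using partial_order_onD'(3)[OF po] by blast
  then show ?thesis by (metis finite.emptyI)
qed

end

section \<open>Reindexing\<close>

context category
begin

text \<open>A cofinal reindexing \<open>\<alpha>\<close> does not change the pro-object. One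
  direction consists of identities at the objects \<open>\<alpha> j\<close>; the other picks for
  each \<open>i\<close> an arrow from some \<open>\<alpha> j\<close> to \<open>i\<close>, and
  \<open>eqz\<close> makes its class independent of the choice.\<close>

lemma cofinal_iso:
  assumes X: "is_pro_obj C X" and X': "is_pro_obj C X'"
    and \<alpha>: "\<And>j. j \<in> Obj (Idx X') \<Longrightarrow> \<alpha> j \<in> Obj (Idx X)" "\<And>j. j \<in> Obj (Idx X') \<Longrightarrow> OMap X' j = OMap X (\<alpha> j)"
    and a: "\<And>j j' u. u \<in> hom (Idx X') j j' \<Longrightarrow> a u \<in> hom (Idx X) (\<alpha> j) (\<alpha> j')"
      "\<And>j j' u. u \<in> hom (Idx X') j j' \<Longrightarrow> AMap X' u = AMap X (a u)"
    and cof: "\<And>i. i \<in> Obj (Idx X) \<Longrightarrow> \<exists>j \<in> Obj (Idx X'). hom (Idx X) (\<alpha> j) i \<noteq> {}"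
    and eqz: "\<And>i j f g. j \<in> Obj (Idx X') \<Longrightarrow> f \<in> hom (Idx X) (\<alpha> j) i \<Longrightarrow> g \<in> hom (Idx X) (\<alpha> j) i \<Longrightarrow>
      \<exists>j'. \<exists>u \<in> hom (Idx X') j' j. f \<cdot>\<^bsub>Idx X\<^esub> a u = g \<cdot>\<^bsub>Idx X\<^esub> a u"
  obtains \<iota> \<kappa> where "\<iota> \<in> pro_hom C X X'" "\<kappa> \<in> pro_hom C X' X"
    "pro_comp C X X \<kappa> \<iota> = pro_idn C X" "pro_comp C X' X' \<iota> \<kappa> = pro_idn C X'"
    "\<And>j. j \<in> Obj (Idx X') \<Longrightarrow> \<iota> j = colim_class C X (OMap X (\<alpha> j)) (\<alpha> j) (Idn C (OMap X (\<alpha> j)))"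
proof -
  note dX = pro_objD(1)[OF X] and dX' = pro_objD(1)[OF X']
  interpret I: category "Idx X" using pro_objD(3)[OF X] .
  interpret J: category "Idx X'" using pro_objD(3)[OF X'] .
  define \<iota> where "\<iota> j = (if j \<in> Obj (Idx X') then colim_class C X (OMap X (\<alpha> j)) (\<alpha> j) (Idn C (OMap X (\<alpha> j))) else undefined)" for j
  have \<iota>: "\<iota> j = colim_class C X (OMap X (\<alpha> j)) (\<alpha> j) (Idn C (OMap X (\<alpha> j)))" if "j \<in> Obj (Idx X')" for j
    using that by (simp add: \<iota>_def)
  have Xo: "OMap X i \<in> Obj C" if "i \<in> Obj (Idx X)" for i using diagram_Obj[OF dX that] .
  have push_\<iota>: "colim_push C X c f (\<iota> j) = colim_class C X c (\<alpha> j) f"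
    if "j \<in> Obj (Idx X')" "f \<in> hom C (OMap X (\<alpha> j)) c" for c f j
    using push_class[OF dX \<alpha>(1)[OF that(1)] Idn_in[OF Xo[OF \<alpha>(1)[OF that(1)]]] that(2)] that
    by (simp add: \<iota> Comp_Idn[OF that(2)])
  have \<iota>_in: "\<iota> \<in> pro_hom C X X'"
  proof (rule pro_homI)
    fix j assume j: "j \<in> Obj (Idx X')"
    show "\<iota> j \<in> colim_hom C X (OMap X' j)"
      using colim_class_in[OF \<alpha>(1)[OF j] Idn_in[OF Xo[OF \<alpha>(1)[OF j]]]] j \<alpha>(2) by (simp add: \<iota>)
    fix j' u assume j': "j' \<in> Obj (Idx X')" and u: "u \<in> hom (Idx X') j j'"
    note au = diagram_hom[OF dX a(1)[OF u]]
    have "colim_class C X (OMap X (\<alpha> j')) (\<alpha> j) (AMap X (a u)) = \<iota> j'"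
      using class_restrict[OF dX \<alpha>(1)[OF j'] Idn_in[OF Xo[OF \<alpha>(1)[OF j']]] a(1)[OF u]] j'
      by (simp add: \<iota> Idn_Comp[OF au])
    then show "colim_push C X (OMap X' j') (AMap X' u) (\<iota> j) = \<iota> j'"
      using push_\<iota>[OF j au] a(2)[OF u] \<alpha>(2)[OF j'] by simp
  qed (simp add: \<iota>_def)
  \<comment> \<open>Two choices are compared over a common \<open>l\<close>, where the resulting
    parallel arrows to \<open>i\<close> are equalized by some \<open>a w\<close>.\<close>
  have wd: "colim_class C X' (OMap X i) j (AMap X b) = colim_class C X' (OMap X i) j' (AMap X b')"
    if j: "j \<in> Obj (Idx X')" "j' \<in> Obj (Idx X')" and b: "b \<in> hom (Idx X) (\<alpha> j) i" "b' \<in> hom (Idx X) (\<alpha> j') i" for i j j' b b'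
  proof -
    obtain l u v where l: "l \<in> Obj (Idx X')" "u \<in> hom (Idx X') l j" "v \<in> hom (Idx X') l j'"
      using pro_objD(2)[OF X'] j unfolding directed_def by blast
    obtain k w where w: "w \<in> hom (Idx X') k l"
      "(b \<cdot>\<^bsub>Idx X\<^esub> a u) \<cdot>\<^bsub>Idx X\<^esub> a w = (b' \<cdot>\<^bsub>Idx X\<^esub> a v) \<cdot>\<^bsub>Idx X\<^esub> a w"
      using eqz[OF l(1) I.Comp_in[OF a(1)[OF l(2)] b(1)] I.Comp_in[OF a(1)[OF l(3)] b(2)]] by blast
    have st: "colim_class C X' (OMap X i) m (AMap X c) = colim_class C X' (OMap X i) k (AMap X ((c \<cdot>\<^bsub>Idx X\<^esub> a x) \<cdot>\<^bsub>Idx X\<^esub> a w))"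
      if m: "m \<in> Obj (Idx X')" "x \<in> hom (Idx X') l m" "c \<in> hom (Idx X) (\<alpha> m) i" for m c x
    proof -
      note ax = a(1)[OF m(2)] and aw = a(1)[OF w(1)]
      have Xc: "AMap X c \<in> hom C (OMap X' m) (OMap X i)" using diagram_hom[OF dX m(3)] \<alpha>(2)[OF m(1)] by simp
      have Xcx: "AMap X (c \<cdot>\<^bsub>Idx X\<^esub> a x) \<in> hom C (OMap X' l) (OMap X i)"
        using diagram_hom[OF dX I.Comp_in[OF ax m(3)]] \<alpha>(2)[OF l(1)] by simp
      show ?thesis
        using class_restrict[OF dX' m(1) Xc m(2)] class_restrict[OF dX' l(1) Xcx w(1)]
          diagram_comp[OF dX ax m(3)] diagram_comp[OF dX aw I.Comp_in[OF ax m(3)]] a(2)[OF m(2)] a(2)[OF w(1)]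
        by simp
    qed
    show ?thesis using st[OF j(1) l(2) b(1)] st[OF j(2) l(3) b(2)] w(2) by simp
  qed
  have "\<exists>j b. j \<in> Obj (Idx X') \<and> b \<in> hom (Idx X) (\<alpha> j) i" if "i \<in> Obj (Idx X)" for i
    using cof[OF that] by blast
  then obtain J b where Jb: "\<And>i. i \<in> Obj (Idx X) \<Longrightarrow> J i \<in> Obj (Idx X')" "\<And>i. i \<in> Obj (Idx X) \<Longrightarrow> b i \<in> hom (Idx X) (\<alpha> (J i)) i"
    by metis
  define \<kappa> where "\<kappa> i = (if i \<in> Obj (Idx X) then colim_class C X' (OMap X i) (J i) (AMap X (b i)) else undefined)" for i
  have \<kappa>: "\<kappa> i = colim_class C X' (OMap X i) j (AMap X c)" if "i \<in> Obj (Idx X)" "j \<in> Obj (Idx X')" "c \<in> hom (Idx X) (\<alpha> j) i" for i j c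
    using wd[OF Jb(1)[OF that(1)] that(2) Jb(2)[OF that(1)] that(3)] that(1) by (simp add: \<kappa>_def)
  have Xb: "AMap X (b i) \<in> hom C (OMap X' (J i)) (OMap X i)" if "i \<in> Obj (Idx X)" for i
    using diagram_hom[OF dX Jb(2)[OF that]] \<alpha>(2)[OF Jb(1)[OF that]] by simp
  have \<kappa>_in: "\<kappa> \<in> pro_hom C X' X"
  proof (rule pro_homI)
    fix i assume i: "i \<in> Obj (Idx X)"
    show "\<kappa> i \<in> colim_hom C X' (OMap X i)"
      using colim_class_in[OF Jb(1)[OF i] Xb[OF i]] i by (simp add: \<kappa>_def)
    fix i' u assume i': "i' \<in> Obj (Idx X)" and u: "u \<in> hom (Idx X) i i'"
    show "colim_push C X' (OMap X i') (AMap X u) (\<kappa> i) = \<kappa> i'"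
      using push_class[OF dX' Jb(1)[OF i] Xb[OF i] diagram_hom[OF dX u]] \<kappa>[OF i Jb(1)[OF i] Jb(2)[OF i]]
        \<kappa>[OF i' Jb(1)[OF i] I.Comp_in[OF Jb(2)[OF i] u]] diagram_comp[OF dX Jb(2)[OF i] u] by simp
  qed (simp add: \<kappa>_def)
  have "pro_comp C X X \<kappa> \<iota> = pro_idn C X"
  proof (rule pro_hom_ext[OF pro_comp_in[OF dX dX' dX \<iota>_in \<kappa>_in] pro_idn_in[OF dX]])
    fix i assume i: "i \<in> Obj (Idx X)"
    have "pro_comp C X X \<kappa> \<iota> i = colim_push C X (OMap X i) (AMap X (b i)) (\<iota> (J i))"
      using pull_class[OF dX dX' \<iota>_in Jb(1)[OF i] Xb[OF i]] \<kappa>[OF i Jb(1)[OF i] Jb(2)[OF i]] i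
      by (simp add: pro_comp_pull)
    also have "\<dots> = colim_class C X (OMap X i) (\<alpha> (J i)) (AMap X (b i))"
      by (rule push_\<iota>[OF Jb(1)[OF i] diagram_hom[OF dX Jb(2)[OF i]]])
    also have "\<dots> = pro_idn C X i"
      using class_restrict[OF dX i Idn_in[OF Xo[OF i]] Jb(2)[OF i]] i Idn_Comp[OF diagram_hom[OF dX Jb(2)[OF i]]]
      by (simp add: pro_idn_def)
    finally show "pro_comp C X X \<kappa> \<iota> i = pro_idn C X i" .
  qed
  moreover have "pro_comp C X' X' \<iota> \<kappa> = pro_idn C X'"
  proof (rule pro_hom_ext[OF pro_comp_in[OF dX' dX dX' \<kappa>_in \<iota>_in] pro_idn_in[OF dX']])
    fix j assume j: "j \<in> Obj (Idx X')"
    note o = Xo[OF \<alpha>(1)[OF j]]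
    have "pro_comp C X' X' \<iota> \<kappa> j = colim_push C X' (OMap X (\<alpha> j)) (Idn C (OMap X (\<alpha> j))) (\<kappa> (\<alpha> j))"
      using pull_class[OF dX' dX \<kappa>_in \<alpha>(1)[OF j] Idn_in[OF o]] j \<alpha>(2)[OF j]
      by (simp add: pro_comp_pull \<iota>)
    also have "\<dots> = \<kappa> (\<alpha> j)" by (rule push_Idn[OF dX' pro_homD(1)[OF \<kappa>_in \<alpha>(1)[OF j]] o])
    also have "\<dots> = pro_idn C X' j"
      using \<kappa>[OF \<alpha>(1)[OF j] j I.Idn_in[OF \<alpha>(1)[OF j]]] diagram_Idn[OF dX \<alpha>(1)[OF j]] j \<alpha>(2)[OF j]
      by (simp add: pro_idn_def)
    finally show "pro_comp C X' X' \<iota> \<kappa> j = pro_idn C X' j" .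
  qed
  ultimately show thesis using that \<iota>_in \<kappa>_in \<iota> by blast
qed

end

locale indexed_category = category C + index_poset T le lab
  for C :: "('o, 'a) cat" (structure) and T :: "'i set" and le lab
begin

lemmas le_refl = partial_order_onD'(1)[OF po]
  and le_in = partial_order_onD'(2,3)[OF po]
  and le_trans = partial_order_onD'(4)[OF po]
  and le_antisym = partial_order_onD'(5)[OF po]

lemma pro_obj_poset_diagram: "poset_functor C T le ob ar \<Longrightarrow> is_pro_obj C (poset_diagram T le ob ar)"
  using is_diagram_poset_diagram directed_index by (simp add: is_pro_obj_def)

text \<open>The functor \<open>\<alpha>\<close> into the index category of \<open>X\<close> is built by recursion along the poset: at stage \<open>s\<close>
  one takes a vertex of a cone over the finite diagram constructed so far, far enough out that \<open>F\<close>
  is represented compatibly and that the pairs of arrows in the finite set \<open>lab s\<close> are equalized.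
  Since every label recurs above every element, \<open>\<alpha>\<close> is cofinal.\<close>

lemma reindex_stages:
  fixes X :: "('i, 'o, 'a) pro_obj"
  assumes X: "is_pro_obj C X" and W: "poset_functor C T le wo wa"
    and F: "F \<in> pro_hom C X (poset_diagram T le wo wa)"
  obtains \<alpha> :: "'i \<Rightarrow> 'i" and \<phi> :: "'i \<Rightarrow> 'a" and c :: "'i \<Rightarrow> 'i \<Rightarrow> 'i" where
    "\<And>s. s \<in> T \<Longrightarrow> \<alpha> s \<in> Obj (Idx X)"
    "\<And>s. s \<in> T \<Longrightarrow> \<phi> s \<in> hom C (OMap X (\<alpha> s)) (wo s)"
    "\<And>s. s \<in> T \<Longrightarrow> F s = colim_class C X (wo s) (\<alpha> s) (\<phi> s)"
    "\<And>s t. (t, s) \<in> le \<Longrightarrow> t \<noteq> s \<Longrightarrow> c s t \<in> hom (Idx X) (\<alpha> s) (\<alpha> t)"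
    "\<And>s t u. (t, s) \<in> le \<Longrightarrow> t \<noteq> s \<Longrightarrow> (u, t) \<in> le \<Longrightarrow> u \<noteq> t \<Longrightarrow> c t u \<cdot>\<^bsub>Idx X\<^esub> c s t = c s u"
    "\<And>s t. (t, s) \<in> le \<Longrightarrow> t \<noteq> s \<Longrightarrow> \<phi> t \<cdot> AMap X (c s t) = wa s t \<cdot> \<phi> s"
    "\<And>s x. s \<in> T \<Longrightarrow> x \<in> lab s \<Longrightarrow> x \<in> Obj (Idx X) \<Longrightarrow> hom (Idx X) (\<alpha> s) x \<noteq> {}"
    "\<And>s t f g x. (t, s) \<in> le \<Longrightarrow> t \<noteq> s \<Longrightarrow> f \<in> lab s \<Longrightarrow> g \<in> lab s \<Longrightarrow> f \<in> hom (Idx X) (\<alpha> t) x \<Longrightarrow>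
      g \<in> hom (Idx X) (\<alpha> t) x \<Longrightarrow> f \<cdot>\<^bsub>Idx X\<^esub> c s t = g \<cdot>\<^bsub>Idx X\<^esub> c s t"
proof -
  note dX = pro_objD(1)[OF X]
  interpret I: category "Idx X" using pro_objD(3)[OF X] .
  let ?below = "{(s, t). (s, t) \<in> le \<and> s \<noteq> t}"
  let ?\<alpha> = "\<lambda>h t. fst (h t)" and ?c = "\<lambda>h t. fst (snd (h t))" and ?\<phi> = "\<lambda>h t. snd (snd (h t))"
  \<comment> \<open>A stage is a triple \<open>(i, d, f)\<close>: the index chosen for
    \<open>s\<close>, its arrows to the earlier indices, and a representative of \<open>F s\<close>
    there.\<close>
  define P where "P h s r \<longleftrightarrow> (s \<in> T \<longrightarrow> (case r of (i, d, f) \<Rightarrow>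
      i \<in> Obj (Idx X) \<and> f \<in> hom C (OMap X i) (wo s) \<and> F s = colim_class C X (wo s) i f
      \<and> (\<forall>t. (t, s) \<in> le \<and> t \<noteq> s \<longrightarrow> d t \<in> hom (Idx X) i (?\<alpha> h t))
      \<and> (\<forall>t. (t, s) \<in> le \<and> t \<noteq> s \<longrightarrow> (\<forall>u. (u, t) \<in> le \<and> u \<noteq> t \<longrightarrow> ?c h t u \<cdot>\<^bsub>Idx X\<^esub> d t = d u))
      \<and> (\<forall>t. (t, s) \<in> le \<and> t \<noteq> s \<longrightarrow> ?\<phi> h t \<cdot> AMap X (d t) = wa s t \<cdot> f)
      \<and> (\<forall>x \<in> lab s. x \<in> Obj (Idx X) \<longrightarrow> hom (Idx X) i x \<noteq> {})
      \<and> (\<forall>t. (t, s) \<in> le \<and> t \<noteq> s \<longrightarrow> (\<forall>f \<in> lab s. \<forall>g \<in> lab s. \<forall>x.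
           f \<in> hom (Idx X) (?\<alpha> h t) x \<and> g \<in> hom (Idx X) (?\<alpha> h t) x \<longrightarrow> f \<cdot>\<^bsub>Idx X\<^esub> d t = g \<cdot>\<^bsub>Idx X\<^esub> d t))))"
    for h :: "'i \<Rightarrow> 'i \<times> ('i \<Rightarrow> 'i) \<times> 'a" and s r
  have "\<exists>h. \<forall>s. P h s (h s)"
  proof (rule dependent_wf_choice[OF wf_strict])
    fix h g :: "'i \<Rightarrow> 'i \<times> ('i \<Rightarrow> 'i) \<times> 'a" and s r
    assume "\<And>z. (z, s) \<in> ?below \<Longrightarrow> h z = g z"
    then have eq: "h z = g z" if "(z, s) \<in> le" "z \<noteq> s" for z using that by blast
    show "P h s r = P g s r" unfolding P_def by (simp add: eq cong: conj_cong imp_cong)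
  next
    fix s h assume IH: "\<And>t. (t, s) \<in> ?below \<Longrightarrow> P h t (h t)"
    show "\<exists>r. P h s r"
    proof (cases "s \<in> T")
      case False then show ?thesis by (simp add: P_def)
    next
      case s: True
      define S where "S = {t \<in> T. (t, s) \<in> le \<and> t \<noteq> s}"
      have S: "t \<in> S \<longleftrightarrow> (t, s) \<in> le \<and> t \<noteq> s" for t using le_in by (auto simp: S_def)
      have ST: "t \<in> T" if "t \<in> S" for t using that by (simp add: S_def)
      have finS: "finite S" unfolding S_def by (rule finite_below)
      have down: "u \<in> S" if "t \<in> S" "(u, t) \<in> le" for t u
        using that le_trans[OF that(2)] le_antisym unfolding S by blast
      define \<alpha> c \<phi> where "\<alpha> = ?\<alpha> h" and "c = ?c h" and "\<phi> = ?\<phi> h"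
      have h: "h t = (\<alpha> t, c t, \<phi> t)" for t by (simp add: \<alpha>_def c_def \<phi>_def)
      have Pt: "P h t (\<alpha> t, c t, \<phi> t)" if "t \<in> S" for t using IH[of t] that unfolding S h[of t] by blast
      have St: "\<alpha> t \<in> Obj (Idx X)" "\<phi> t \<in> hom C (OMap X (\<alpha> t)) (wo t)" "F t = colim_class C X (wo t) (\<alpha> t) (\<phi> t)"
        "\<And>u. (u, t) \<in> le \<Longrightarrow> u \<noteq> t \<Longrightarrow> c t u \<in> hom (Idx X) (\<alpha> t) (\<alpha> u)"
        if "t \<in> S" for t
        using Pt[OF that] ST[OF that] unfolding P_def h by auto
      obtain r f0 where r: "r \<in> Obj (Idx X)" "f0 \<in> hom C (OMap X r) (wo s)" "F s = colim_class C X (wo s) r f0"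
        using pro_hom_rep[OF dX F, of s, simplified] s by blast
      \<comment> \<open>Targets of the cone: the earlier indices, the labelled objects, and an index
        \<open>r\<close> at which \<open>F s\<close> has a representative.\<close>
      define Ob where "Ob = \<alpha> ` S \<union> (lab s \<inter> Obj (Idx X)) \<union> {r}"
      have "finite Ob" unfolding Ob_def using finS finite_lab by simp
      moreover have "x \<in> Obj (Idx X)" if "x \<in> Ob" for x using that St r unfolding Ob_def by auto
      ultimately obtain k p where k: "k \<in> Obj (Idx X)" and p: "\<And>x. x \<in> Ob \<Longrightarrow> p x \<in> hom (Idx X) k x"
        using I.directed_finite_cone[OF pro_objD(2)[OF X], of Ob "\<lambda>x. x"] by metis
      have p\<alpha>: "p (\<alpha> t) \<in> hom (Idx X) k (\<alpha> t)" if "t \<in> S" for t using p that by (simp add: Ob_def)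
      have pr: "p r \<in> hom (Idx X) k r" using p by (simp add: Ob_def)
      \<comment> \<open>\<open>E1\<close> asks the legs to commute with the earlier transition
        arrows; \<open>E2\<close> asks labelled parallel pairs to agree after the legs.\<close>
      define E1 where "E1 = (\<lambda>(t, u). (c t u \<cdot>\<^bsub>Idx X\<^esub> p (\<alpha> t), p (\<alpha> u))) ` {(t, u) \<in> S \<times> S. (u, t) \<in> le \<and> u \<noteq> t}"
      define E2 where "E2 = (\<lambda>(t, f, g). (f \<cdot>\<^bsub>Idx X\<^esub> p (\<alpha> t), g \<cdot>\<^bsub>Idx X\<^esub> p (\<alpha> t))) `
        {(t, f, g) \<in> S \<times> lab s \<times> lab s. \<exists>x. f \<in> hom (Idx X) (\<alpha> t) x \<and> g \<in> hom (Idx X) (\<alpha> t) x}"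
      have E1: "(c t u \<cdot>\<^bsub>Idx X\<^esub> p (\<alpha> t), p (\<alpha> u)) \<in> E1" if "t \<in> S" "(u, t) \<in> le" "u \<noteq> t" for t u
        using that down[OF that(1,2)] unfolding E1_def by force
      have E2: "(f \<cdot>\<^bsub>Idx X\<^esub> p (\<alpha> t), g \<cdot>\<^bsub>Idx X\<^esub> p (\<alpha> t)) \<in> E2"
        if "t \<in> S" "f \<in> lab s" "g \<in> lab s" "f \<in> hom (Idx X) (\<alpha> t) x" "g \<in> hom (Idx X) (\<alpha> t) x" for t f g x
        using that unfolding E2_def by force
      have "finite (E1 \<union> E2)"
      proof -
        have "finite {(t, u) \<in> S \<times> S. (u, t) \<in> le \<and> u \<noteq> t}"
          by (rule finite_subset[of _ "S \<times> S"]) (use finS in auto)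
        moreover have "finite {(t, f, g) \<in> S \<times> lab s \<times> lab s. \<exists>x. f \<in> hom (Idx X) (\<alpha> t) x \<and> g \<in> hom (Idx X) (\<alpha> t) x}"
          by (rule finite_subset[of _ "S \<times> lab s \<times> lab s"]) (use finS finite_lab in auto)
        ultimately show ?thesis unfolding E1_def E2_def by blast
      qed
      moreover have "\<exists>y. f \<in> hom (Idx X) k y \<and> g \<in> hom (Idx X) k y" if "(f, g) \<in> E1 \<union> E2" for f g
        using that
      proof
        assume "(f, g) \<in> E1"
        then obtain t u where t: "f = c t u \<cdot>\<^bsub>Idx X\<^esub> p (\<alpha> t)" "g = p (\<alpha> u)" "t \<in> S" "u \<in> S" "(u, t) \<in> le" "u \<noteq> t"
          unfolding E1_def by auto
        then show ?thesis using I.Comp_in[OF p\<alpha>[OF t(3)] St(4)[OF t(3,5,6)]] p\<alpha>[OF t(4)] by blast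
      next
        assume "(f, g) \<in> E2"
        then obtain t f' g' x where t: "f = f' \<cdot>\<^bsub>Idx X\<^esub> p (\<alpha> t)" "g = g' \<cdot>\<^bsub>Idx X\<^esub> p (\<alpha> t)" "t \<in> S"
           "f' \<in> hom (Idx X) (\<alpha> t) x" "g' \<in> hom (Idx X) (\<alpha> t) x"
          unfolding E2_def by auto
        then show ?thesis using I.Comp_in[OF p\<alpha>[OF t(3)] t(4)] I.Comp_in[OF p\<alpha>[OF t(3)] t(5)] by blast
      qed
      ultimately obtain l e where l: "l \<in> Obj (Idx X)" and e: "e \<in> hom (Idx X) l k"
        and eq: "\<And>f g. (f, g) \<in> E1 \<union> E2 \<Longrightarrow> f \<cdot>\<^bsub>Idx X\<^esub> e = g \<cdot>\<^bsub>Idx X\<^esub> e"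
        using I.directed_finite_equalize[OF pro_objD(2)[OF X] _ k] by metis
      define q where "q x = p x \<cdot>\<^bsub>Idx X\<^esub> e" for x
      have q: "q x \<in> hom (Idx X) l x" if "x \<in> Ob" for x using I.Comp_in[OF e p[OF that]] by (simp add: q_def)
      have q\<alpha>: "q (\<alpha> t) \<in> hom (Idx X) l (\<alpha> t)" if "t \<in> S" for t using q that by (simp add: Ob_def)
      have qr: "q r \<in> hom (Idx X) l r" using q by (simp add: Ob_def)
      have q1: "c t u \<cdot>\<^bsub>Idx X\<^esub> q (\<alpha> t) = q (\<alpha> u)" if "t \<in> S" "(u, t) \<in> le" "u \<noteq> t" for t u
        using eq[OF UnI1[OF E1[OF that]]] I.Comp_assoc[OF e p\<alpha>[OF that(1)] St(4)[OF that]] by (simp add: q_def)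
      have q2: "f \<cdot>\<^bsub>Idx X\<^esub> q (\<alpha> t) = g \<cdot>\<^bsub>Idx X\<^esub> q (\<alpha> t)"
        if "t \<in> S" "f \<in> lab s" "g \<in> lab s" "f \<in> hom (Idx X) (\<alpha> t) x" "g \<in> hom (Idx X) (\<alpha> t) x" for t f g x
        using eq[OF UnI2[OF E2[OF that]]] I.Comp_assoc[OF e p\<alpha>[OF that(1)] that(4)]
           I.Comp_assoc[OF e p\<alpha>[OF that(1)] that(5)] by (simp add: q_def)
      define f1 where "f1 = f0 \<cdot> AMap X (q r)"
      have f1: "f1 \<in> hom C (OMap X l) (wo s)" "F s = colim_class C X (wo s) l f1"
        using Comp_in[OF diagram_hom[OF dX qr] r(2)] class_restrict[OF dX r(1,2) qr] r(3) by (auto simp: f1_def)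
      have wa: "wa s t \<in> hom C (wo s) (wo t)" if "t \<in> S" for t
        using poset_functorD(3)[OF W, of t s] that S by simp
      \<comment> \<open>The naturality squares hold so far only between classes; a last refinement
        \<open>v\<close> makes these finitely many equations hold in \<open>C\<close>.\<close>
      obtain m v where m: "m \<in> Obj (Idx X)" and v: "v \<in> hom (Idx X) m l"
        and veq: "\<And>t. t \<in> S \<Longrightarrow> (\<phi> t \<cdot> AMap X (q (\<alpha> t))) \<cdot> AMap X v = (wa s t \<cdot> f1) \<cdot> AMap X v"
      proof (rule finite_classes_eqD[OF X l finS, of "\<lambda>t. \<phi> t \<cdot> AMap X (q (\<alpha> t))" wo "\<lambda>t. wa s t \<cdot> f1"])
        fix t assume t: "t \<in> S"
        show "\<phi> t \<cdot> AMap X (q (\<alpha> t)) \<in> hom C (OMap X l) (wo t)"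
          by (rule Comp_in[OF diagram_hom[OF dX q\<alpha>[OF t]] St(2)[OF t]])
        show "wa s t \<cdot> f1 \<in> hom C (OMap X l) (wo t)" by (rule Comp_in[OF f1(1) wa[OF t]])
        have "colim_push C X (wo t) (wa s t) (F s) = F t"
          using pro_homD(2)[OF F, of s t "pair_code (s, t)"] s ST[OF t] t S by (simp add: in_hom_poset_cat)
        then show "colim_class C X (wo t) l (\<phi> t \<cdot> AMap X (q (\<alpha> t))) = colim_class C X (wo t) l (wa s t \<cdot> f1)"
          using class_restrict[OF dX St(1,2)[OF t] q\<alpha>[OF t]] push_class[OF dX l f1(1) wa[OF t]] f1(2) St(3)[OF t] by simp
      qed (rule that)
      note Xv = diagram_hom[OF dX v]
      have qv: "q (\<alpha> t) \<cdot>\<^bsub>Idx X\<^esub> v \<in> hom (Idx X) m (\<alpha> t)" if "t \<in> S" for t by (rule I.Comp_in[OF v q\<alpha>[OF that]])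
      have "P h s (m, \<lambda>t. q (\<alpha> t) \<cdot>\<^bsub>Idx X\<^esub> v, f1 \<cdot> AMap X v)"
        unfolding P_def prod.case h fst_conv snd_conv S[symmetric]
      proof (intro impI conjI allI ballI)
        show "m \<in> Obj (Idx X)" by (rule m)
        show "f1 \<cdot> AMap X v \<in> hom C (OMap X m) (wo s)" by (rule Comp_in[OF Xv f1(1)])
        show "F s = colim_class C X (wo s) m (f1 \<cdot> AMap X v)" using class_restrict[OF dX l f1(1) v] f1(2) by simp
        show "q (\<alpha> t) \<cdot>\<^bsub>Idx X\<^esub> v \<in> hom (Idx X) m (\<alpha> t)" if "t \<in> S" for t by (rule qv[OF that])
        show "c t u \<cdot>\<^bsub>Idx X\<^esub> (q (\<alpha> t) \<cdot>\<^bsub>Idx X\<^esub> v) = q (\<alpha> u) \<cdot>\<^bsub>Idx X\<^esub> v"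
          if t: "t \<in> S" "(u, t) \<in> le \<and> u \<noteq> t" for t u
          using I.Comp_assoc[OF v q\<alpha> St(4), of t u] q1[of t u] t by auto
        show "\<phi> t \<cdot> AMap X (q (\<alpha> t) \<cdot>\<^bsub>Idx X\<^esub> v) = wa s t \<cdot> (f1 \<cdot> AMap X v)" if t: "t \<in> S" for t
          using veq[OF t] Comp_assoc[OF Xv diagram_hom[OF dX q\<alpha>[OF t]] St(2)[OF t]] Comp_assoc[OF Xv f1(1) wa[OF t]]
            diagram_comp[OF dX v q\<alpha>[OF t]] by simp
        show "hom (Idx X) m x \<noteq> {}" if "x \<in> lab s" "x \<in> Obj (Idx X)" for x
          using I.Comp_in[OF v q[of x]] that by (auto simp: Ob_def)
        show "f \<cdot>\<^bsub>Idx X\<^esub> (q (\<alpha> t) \<cdot>\<^bsub>Idx X\<^esub> v) = g \<cdot>\<^bsub>Idx X\<^esub> (q (\<alpha> t) \<cdot>\<^bsub>Idx X\<^esub> v)"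
          if t: "t \<in> S" "f \<in> lab s" "g \<in> lab s" "f \<in> hom (Idx X) (\<alpha> t) x \<and> g \<in> hom (Idx X) (\<alpha> t) x" for t f g x
          using q2[OF t(1-3), of x] t(4) I.Comp_assoc[OF v q\<alpha>[OF t(1)], of f x] I.Comp_assoc[OF v q\<alpha>[OF t(1)], of g x]
          by simp
      qed
      then show ?thesis ..
    qed
  qed
  then obtain h where h: "\<And>s. P h s (h s)" by blast
  define \<alpha> c \<phi> where "\<alpha> = ?\<alpha> h" and "c = ?c h" and "\<phi> = ?\<phi> h"
  have hh: "h t = (\<alpha> t, c t, \<phi> t)" for t by (simp add: \<alpha>_def c_def \<phi>_def)
  note Ps = h[unfolded hh P_def prod.case fst_conv snd_conv, rule_format]
  show thesis
  proof (rule that[of \<alpha> \<phi> c])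
    fix s t assume st: "(t, s) \<in> le" "t \<noteq> s"
    have s: "s \<in> T" using le_in st by blast
    note Q = Ps[OF s]
    show "c s t \<in> hom (Idx X) (\<alpha> s) (\<alpha> t)" "\<phi> t \<cdot> AMap X (c s t) = wa s t \<cdot> \<phi> s" using Q st by blast+
    show "c t u \<cdot>\<^bsub>Idx X\<^esub> c s t = c s u" if "(u, t) \<in> le" "u \<noteq> t" for u using Q st that by blast
    show "f \<cdot>\<^bsub>Idx X\<^esub> c s t = g \<cdot>\<^bsub>Idx X\<^esub> c s t" if "f \<in> lab s" "g \<in> lab s" "f \<in> hom (Idx X) (\<alpha> t) x"
      "g \<in> hom (Idx X) (\<alpha> t) x" for f g x using Q st that by blast
  qed (use Ps in blast)+
qed

text \<open>Changes the domain only: the codomain is already indexed by \<open>T\<close>, and the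
  stages form a \<open>T\<close>-indexed diagram isomorphic to \<open>X\<close> on which
  \<open>F\<close> is levelwise. Cofinality of the stages comes from the recurring labels, an object
  label for reaching \<open>i\<close> and a pair of arrow labels for equalizing.\<close>

lemma reindex:
  fixes X :: "('i, 'o, 'a) pro_obj"
  assumes X: "is_pro_obj C X" and W: "poset_functor C T le wo wa"
    and F: "F \<in> pro_hom C X (poset_diagram T le wo wa)"
  obtains xo xa \<phi> where "poset_trans C T le xo xa wo wa \<phi>"
    "isomorphic (Pro C) X (poset_diagram T le xo xa)"
    "isomorphic (arrow_cat (Pro C)) (X, poset_diagram T le wo wa, F)
       (pro_induced C (poset_diagram T le xo xa) (poset_diagram T le wo wa) \<phi>)"
proof -
  note dX = pro_objD(1)[OF X]
  interpret I: category "Idx X" using pro_objD(3)[OF X] .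
  obtain \<alpha> :: "'i \<Rightarrow> 'i" and c :: "'i \<Rightarrow> 'i \<Rightarrow> 'i" and \<phi> :: "'i \<Rightarrow> 'a" where
    a: "\<And>s. s \<in> T \<Longrightarrow> \<alpha> s \<in> Obj (Idx X)"
    "\<And>s. s \<in> T \<Longrightarrow> \<phi> s \<in> hom C (OMap X (\<alpha> s)) (wo s)"
    "\<And>s. s \<in> T \<Longrightarrow> F s = colim_class C X (wo s) (\<alpha> s) (\<phi> s)"
    "\<And>s t. (t, s) \<in> le \<Longrightarrow> t \<noteq> s \<Longrightarrow> c s t \<in> hom (Idx X) (\<alpha> s) (\<alpha> t)"
    "\<And>s t u. (t, s) \<in> le \<Longrightarrow> t \<noteq> s \<Longrightarrow> (u, t) \<in> le \<Longrightarrow> u \<noteq> t \<Longrightarrow> c t u \<cdot>\<^bsub>Idx X\<^esub> c s t = c s u"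
    "\<And>s t. (t, s) \<in> le \<Longrightarrow> t \<noteq> s \<Longrightarrow> \<phi> t \<cdot> AMap X (c s t) = wa s t \<cdot> \<phi> s"
    "\<And>s x. s \<in> T \<Longrightarrow> x \<in> lab s \<Longrightarrow> x \<in> Obj (Idx X) \<Longrightarrow> hom (Idx X) (\<alpha> s) x \<noteq> {}"
    "\<And>s t f g x. (t, s) \<in> le \<Longrightarrow> t \<noteq> s \<Longrightarrow> f \<in> lab s \<Longrightarrow> g \<in> lab s \<Longrightarrow> f \<in> hom (Idx X) (\<alpha> t) x \<Longrightarrow>
      g \<in> hom (Idx X) (\<alpha> t) x \<Longrightarrow> f \<cdot>\<^bsub>Idx X\<^esub> c s t = g \<cdot>\<^bsub>Idx X\<^esub> c s t"
    by (rule reindex_stages[OF X W F], rule that; assumption?)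
  \<comment> \<open>The stages record arrows for strict pairs only; identities complete them to a
    functor.\<close>
  define d where "d s t = (if s = t then Idn (Idx X) (\<alpha> s) else c s t)" for s t
  have d: "d s t \<in> hom (Idx X) (\<alpha> s) (\<alpha> t)" if "(t, s) \<in> le" for s t
    using a(4)[OF that] I.Idn_in a(1) le_in[OF that] by (simp add: d_def)
  have dd: "d t u \<cdot>\<^bsub>Idx X\<^esub> d s t = d s u" if "(t, s) \<in> le" "(u, t) \<in> le" for s t u
    using a(5)[OF that(1) _ that(2)] I.Comp_Idn[OF a(4)[OF that(2)]] I.Idn_Comp[OF a(4)[OF that(1)]]
      I.Comp_Idn[OF I.Idn_in] a(1) le_in[OF that(1)] le_antisym[OF that(1)] that(2)
    by (auto simp: d_def)
  define xo where "xo s = OMap X (\<alpha> s)" for s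
  define xa where "xa s t = AMap X (d s t)" for s t
  have pf: "poset_functor C T le xo xa"
    unfolding poset_functor_def
  proof (intro conjI ballI)
    fix s assume s: "s \<in> T"
    show "xo s \<in> Obj C" "xa s s = Idn C (xo s)"
      using diagram_Obj[OF dX a(1)[OF s]] diagram_Idn[OF dX a(1)[OF s]] by (simp_all add: xo_def xa_def d_def)
  next
    fix p assume "p \<in> le"
    then obtain s t where p: "p = (t, s)" "(t, s) \<in> le" by (cases p) auto
    show "case p of (t, s) \<Rightarrow> xa s t \<in> hom C (xo s) (xo t)"
      using diagram_hom[OF dX d[OF p(2)]] p by (simp add: xo_def xa_def)
    show "case p of (t, s) \<Rightarrow> \<forall>u. (u, t) \<in> le \<longrightarrow> xa s u = xa t u \<cdot> xa s t"
      using diagram_comp[OF dX d[OF p(2)] d] dd[OF p(2)] p by (auto simp: xa_def)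
  qed
  let ?X' = "poset_diagram T le xo xa" and ?W = "poset_diagram T le wo wa"
  note X' = pro_obj_poset_diagram[OF pf] and pW = pro_obj_poset_diagram[OF W]
  note dX' = pro_objD(1)[OF X'] and dW = pro_objD(1)[OF pW]
  have \<phi>: "\<phi> s \<in> hom C (xo s) (wo s)" if "s \<in> T" for s using a(2)[OF that] by (simp add: xo_def)
  have nat: "\<phi> t \<cdot> xa s t = wa s t \<cdot> \<phi> s" if "(t, s) \<in> le" for s t
  proof (cases "t = s")
    case True
    have s: "s \<in> T" using le_in that by blast
    then show ?thesis
      using True Comp_Idn[OF a(2)[OF s]] Idn_Comp[OF a(2)[OF s]] poset_functorD(2)[OF W s] poset_functorD(2)[OF pf s]
      by (simp add: xo_def)
  qed (use a(6)[OF that] in \<open>simp add: xa_def d_def\<close>)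
  note pt = poset_transI[OF pf W \<phi> nat]
  have nt: "nat_trans C ?X' ?W \<phi>" by (rule nat_trans_poset_diagram[OF pt])
  obtain \<iota> \<kappa> where \<iota>: "\<iota> \<in> pro_hom C X ?X'" "\<kappa> \<in> pro_hom C ?X' X"
    "pro_comp C X X \<kappa> \<iota> = pro_idn C X" "pro_comp C ?X' ?X' \<iota> \<kappa> = pro_idn C ?X'"
    "\<And>j. j \<in> Obj (Idx ?X') \<Longrightarrow> \<iota> j = colim_class C X (OMap X (\<alpha> j)) (\<alpha> j) (Idn C (OMap X (\<alpha> j)))"
  proof (rule cofinal_iso[OF X X', of \<alpha> "\<lambda>u. d (Dom (poset_cat T le) u) (Cod (poset_cat T le) u)"])
    fix i assume i: "i \<in> Obj (Idx X)"
    obtain t where "t \<in> T" using nonempty by blast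
    then obtain s where s: "s \<in> T" "i \<in> lab s" using grow[of t i i] by blast
    show "\<exists>j\<in>Obj (Idx ?X'). hom (Idx X) (\<alpha> j) i \<noteq> {}"
      by (rule bexI[of _ s]) (use a(7)[OF s i] s in simp_all)
  next
    fix i j f g assume j: "j \<in> Obj (Idx ?X')" and fg: "f \<in> hom (Idx X) (\<alpha> j) i" "g \<in> hom (Idx X) (\<alpha> j) i"
    then obtain s where s: "s \<in> T" "(j, s) \<in> le" "j \<noteq> s" "f \<in> lab s" "g \<in> lab s" using grow[of j f g] by auto
    then have "f \<cdot>\<^bsub>Idx X\<^esub> d s j = g \<cdot>\<^bsub>Idx X\<^esub> d s j" using a(8)[OF s(2-5) fg] by (simp add: d_def)
    then show "\<exists>j'. \<exists>u\<in>hom (Idx ?X') j' j.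
       f \<cdot>\<^bsub>Idx X\<^esub> d (Dom (poset_cat T le) u) (Cod (poset_cat T le) u) =
       g \<cdot>\<^bsub>Idx X\<^esub> d (Dom (poset_cat T le) u) (Cod (poset_cat T le) u)"
      using s by (intro exI[of _ s] bexI[of _ "pair_code (s, j)"]) (auto simp: in_hom_poset_cat)
  qed (use a(1) d in \<open>auto simp: in_hom_poset_cat xo_def xa_def that\<close>)
  have iso: "isomorphic (Pro C) X ?X'"
    unfolding isomorphic_def hom_Pro using X X' \<iota> by auto
  have "pro_comp C X ?W (induced_map C ?X' ?W \<phi>) \<iota> = F"
  proof (rule pro_hom_ext[OF pro_comp_in[OF dX dX' dW \<iota>(1) induced_map_in[OF nt]] F])
    fix s assume s: "s \<in> Obj (Idx ?W)"
    then have s': "s \<in> T" by simp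
    note o = diagram_Obj[OF dX a(1)[OF s']]
    show "pro_comp C X ?W (induced_map C ?X' ?W \<phi>) \<iota> s = F s"
      using pull_induced[OF dX nt \<iota>(1) s] push_class[OF dX a(1)[OF s'] Idn_in[OF o] a(2)[OF s']]
        \<iota>(5)[of s] s' a(3)[OF s'] Comp_Idn[OF a(2)[OF s']] by simp
  qed
  then have sq: "pro_comp C X ?W (pro_idn C ?W) F = pro_comp C X ?W (induced_map C ?X' ?W \<phi>) \<iota>"
    using category.Idn_Comp[OF category_Pro, of "(X, ?W, F)" X ?W] X pW F by (simp add: hom_Pro)
  have idW: "pro_idn C ?W \<in> pro_hom C ?W ?W" "pro_comp C ?W ?W (pro_idn C ?W) (pro_idn C ?W) = pro_idn C ?W"
    using pro_idn_in[OF dW] category.Idn_Comp[OF category_Pro, of "(?W, ?W, pro_idn C ?W)" ?W ?W] pW by (simp_all add: hom_Pro)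
  have "isomorphic (arrow_cat (Pro C)) (X, ?W, F) (pro_induced C ?X' ?W \<phi>)"
    unfolding pro_induced_eq
    by (rule category.arrow_isoI[OF category_Pro, where x = X and y = ?W and x' = ?X' and y' = ?W and
        ?s1.0 = "(X, ?X', \<iota>)" and ?r1.0 = "(?X', X, \<kappa>)" and ?s2.0 = "(?W, ?W, pro_idn C ?W)" and ?r2.0 = "(?W, ?W, pro_idn C ?W)"])
       (use X X' pW F \<iota> sq idW induced_map_in[OF nt] in \<open>auto simp: hom_Pro\<close>)
  then show thesis using that[OF pt iso] by blast
qed

text \<open>A constant diagram at a terminal object gives every pro-object a morphism to some
  \<open>T\<close>-indexed one, so that \<open>reindex\<close> can be applied to an object
  alone.\<close>

lemma terminal_diagram:
  fixes Y :: "('i, 'o, 'a) pro_obj"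
  assumes lim: "has_finite_limits C" and Y: "is_pro_obj C Y"
  obtains wo wa F where "poset_functor C T le wo wa" "F \<in> pro_hom C Y (poset_diagram T le wo wa)"
proof -
  note dY = pro_objD(1)[OF Y]
  obtain L where L: "L \<in> Obj C" "\<And>K. K \<in> Obj C \<Longrightarrow> \<exists>!h. h \<in> hom C K L"
    using terminal_exists[OF lim] by blast
  have pf: "poset_functor C T le (\<lambda>_. L) (\<lambda>_ _. Idn C L)"
    unfolding poset_functor_def using L(1) Idn_in[OF L(1)] Comp_Idn[OF Idn_in[OF L(1)]] by auto
  obtain i where i: "i \<in> Obj (Idx Y)" using pro_objD(4)[OF Y] by blast
  obtain f where f: "f \<in> hom C (OMap Y i) L" using L(2)[OF diagram_Obj[OF dY i]] by blast
  let ?F = "\<lambda>s. if s \<in> T then colim_class C Y L i f else undefined"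
  have "?F \<in> pro_hom C Y (poset_diagram T le (\<lambda>_. L) (\<lambda>_ _. Idn C L))"
    by (rule pro_homI)
       (use colim_class_in[OF i f] push_class[OF dY i f Idn_in[OF L(1)]] Idn_Comp[OF f] in \<open>auto simp: in_hom_poset_cat\<close>)
  then show thesis using that pf by blast
qed

text \<open>The codomain is reindexed first and the domain then relative to the new codomain;
  reindexing the two independently need not make the morphism levelwise.\<close>

lemma level_representation:
  fixes f :: "('i, 'o, 'a) pro_arr"
  assumes lim: "has_finite_limits C" and f: "f \<in> Arr (Pro C)"
  obtains xo xa yo ya \<phi> where "poset_trans C T le xo xa yo ya \<phi>"
    "isomorphic (arrow_cat (Pro C)) f (pro_induced C (poset_diagram T le xo xa) (poset_diagram T le yo ya) \<phi>)"
proof -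
  interpret P: category "Pro C :: ('i, 'o, 'a) pro_cat" by (rule category_Pro)
  obtain X Y F where F: "f = (X, Y, F)" "is_pro_obj C X" "is_pro_obj C Y" "F \<in> pro_hom C X Y"
    using Arr_ProE[OF f] .
  obtain wo wa G where G: "poset_functor C T le wo wa" "G \<in> pro_hom C Y (poset_diagram T le wo wa)"
    using terminal_diagram[OF lim F(3)] .
  obtain yo ya where y: "poset_functor C T le yo ya" "isomorphic (Pro C) Y (poset_diagram T le yo ya)"
    using reindex[OF F(3) G] poset_transD(1) by metis
  let ?Y = "poset_diagram T le yo ya"
  obtain u v where uv: "u \<in> hom (Pro C) Y ?Y" "v \<in> hom (Pro C) ?Y Y" "v \<cdot>\<^bsub>Pro C\<^esub> u = Idn (Pro C) Y" "u \<cdot>\<^bsub>Pro C\<^esub> v = Idn (Pro C) ?Y"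
    using y(2) unfolding isomorphic_def by blast
  have fh: "f \<in> hom (Pro C) X Y" using F by (simp add: hom_Pro)
  obtain H where H: "u \<cdot>\<^bsub>Pro C\<^esub> f = (X, ?Y, H)" "H \<in> pro_hom C X ?Y"
    using P.Comp_in[OF fh uv(1)] by (auto simp: hom_Pro)
  have 1: "isomorphic (arrow_cat (Pro C)) f (X, ?Y, H)"
    using P.arrow_iso_sym[OF P.arrow_iso_comp_left[OF fh uv]] H(1) by simp
  obtain xo xa \<phi> where x: "poset_trans C T le xo xa yo ya \<phi>"
    "isomorphic (arrow_cat (Pro C)) (X, ?Y, H) (pro_induced C (poset_diagram T le xo xa) ?Y \<phi>)"
    using reindex[OF F(2) y(1) H(2)] by metis
  show thesis
    by (rule that[OF x(1) P.arrow_iso_trans[OF 1 x(2)]])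
qed

end

section \<open>Reedy factorizations\<close>

context category
begin

lemma poset_limit_restrict:
  "poset_limit C F (le \<inter> F \<times> F) ob ar L \<pi> \<longleftrightarrow> poset_limit C F le ob ar L \<pi>"
proof -
  have "poset_cone C F (le \<inter> F \<times> F) ob ar = poset_cone C F le ob ar"
    by (intro ext) (auto simp: poset_cone_def)
  then show ?thesis unfolding poset_limit_def by simp
qed

lemma finite_subposet_limit:
  assumes "has_finite_limits C" "finite F" "partial_order_on T le" "F \<subseteq> T"
    and "poset_functor C F (le \<inter> F \<times> F) ob ar"
  obtains L \<pi> where "poset_limit C F le ob ar L \<pi>"
proof -
  have "partial_order_on F (le \<inter> F \<times> F)"
    using assms(3,4) unfolding partial_order_on_def preorder_on_def refl_on_def trans_def antisym_def by blast
  from finite_poset_limit[OF assms(1,2) this assms(5)] show thesis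
    using that unfolding poset_limit_restrict by blast
qed

lemma poset_limitD:
  assumes "poset_limit C F le ob ar L \<pi>"
  shows "L \<in> Obj C" "s \<in> F \<Longrightarrow> \<pi> s \<in> hom C L (ob s)"
    "s \<in> F \<Longrightarrow> t \<in> F \<Longrightarrow> (t, s) \<in> le \<Longrightarrow> ar s t \<cdot> \<pi> s = \<pi> t"
  using assms unfolding poset_limit_def poset_cone_def by auto

lemma poset_limit_map:
  assumes "poset_limit C F le ob ar L \<pi>" "K \<in> Obj C"
    and "\<And>s. s \<in> F \<Longrightarrow> \<kappa> s \<in> hom C K (ob s)"
    and "\<And>s t. s \<in> F \<Longrightarrow> t \<in> F \<Longrightarrow> (t, s) \<in> le \<Longrightarrow> ar s t \<cdot> \<kappa> s = \<kappa> t"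
  obtains h where "h \<in> hom C K L" "\<And>s. s \<in> F \<Longrightarrow> \<pi> s \<cdot> h = \<kappa> s"
proof -
  have "poset_cone C F le ob ar K \<kappa>" using assms(2-4) unfolding poset_cone_def by blast
  then show thesis using assms(1) that unfolding poset_limit_def by blast
qed

lemma poset_limit_unique:
  assumes L: "poset_limit C F le ob ar L \<pi>"
    and ar: "\<And>s t. s \<in> F \<Longrightarrow> t \<in> F \<Longrightarrow> (t, s) \<in> le \<Longrightarrow> ar s t \<in> hom C (ob s) (ob t)"
    and h: "h \<in> hom C K L" "h' \<in> hom C K L" "\<And>s. s \<in> F \<Longrightarrow> \<pi> s \<cdot> h = \<pi> s \<cdot> h'"
  shows "h = h'"
proof -
  have "poset_cone C F le ob ar K (\<lambda>s. \<pi> s \<cdot> h)"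
    unfolding poset_cone_def
  proof (intro conjI ballI impI)
    show "K \<in> Obj C" using hom_Obj[OF h(1)] by blast
    fix s assume s: "s \<in> F"
    show "\<pi> s \<cdot> h \<in> hom C K (ob s)" by (rule Comp_in[OF h(1) poset_limitD(2)[OF L s]])
    fix t assume t: "t \<in> F" "(t, s) \<in> le"
    show "ar s t \<cdot> (\<pi> s \<cdot> h) = \<pi> t \<cdot> h"
      by (rule comp_left_eq[OF poset_limitD(3)[OF L s t] poset_limitD(2)[OF L s] ar[OF s t] h(1)])
  qed
  then have "\<exists>!k. k \<in> hom C K L \<and> (\<forall>s \<in> F. \<pi> s \<cdot> k = \<pi> s \<cdot> h)"
    using L unfolding poset_limit_def by blast
  then show ?thesis by (rule ex1E) (use h in \<open>metis (no_types, lifting)\<close>)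
qed

lemma pullback_map:
  assumes "is_pullback C f g P p q" "a \<in> hom C Q (Dom C f)" "b \<in> hom C Q (Dom C g)" "f \<cdot> a = g \<cdot> b"
  obtains h where "h \<in> hom C Q P" "p \<cdot> h = a" "q \<cdot> h = b"
  using assms unfolding is_pullback_def by blast

end

context indexed_category
begin

text \<open>At \<open>t\<close> the source maps to the pullback of \<open>yo t\<close> with the
  matching limit of the part of \<open>Z\<close> built so far. Factoring this map in
  \<open>C\<close> gives the object of \<open>Z\<close> at \<open>t\<close>: the second factor is by
  construction the relative matching map, so \<open>Z \<rightarrow> Y\<close> is special, and the
  first factor is \<open>n t\<close>.\<close>

lemma reedy_factorization:
  fixes xo yo :: "'i \<Rightarrow> 'o" and xa ya :: "'i \<Rightarrow> 'i \<Rightarrow> 'a"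
  assumes lim: "has_finite_limits C" and fac: "all_factor C M N" and M: "M \<subseteq> Arr C" and N: "N \<subseteq> Arr C"
    and xy: "poset_trans C T le xo xa yo ya \<phi>"
  obtains zo za n m where "poset_trans C T le xo xa zo za n" "\<And>s. s \<in> T \<Longrightarrow> n s \<in> N"
    "poset_trans C T le zo za yo ya m" "\<And>s. s \<in> T \<Longrightarrow> m s \<cdot> n s = \<phi> s"
    "\<And>t. t \<in> T \<Longrightarrow> special_at C M le (poset_diagram T le zo za) (poset_diagram T le yo ya) m t"
proof -
  note x = poset_transD(1)[OF xy] and y = poset_transD(2)[OF xy]
    and \<phi> = poset_transD(3)[OF xy] and nat = poset_transD(4)[OF xy]
  let ?zo = "\<lambda>h s. fst (h s)" and ?n = "\<lambda>h s. fst (snd (h s))" and ?m = "\<lambda>h s. fst (snd (snd (h s)))"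
    and ?a = "\<lambda>h s. snd (snd (snd (h s)))"
  \<comment> \<open>The recursion records transition maps to strictly smaller elements; identities
    are supplied on the diagonal.\<close>
  define za where "za h s u = (if s = u then Idn C (?zo h s) else ?a h s u)" for h :: "'i \<Rightarrow> 'o \<times> 'a \<times> 'a \<times> ('i \<Rightarrow> 'a)" and s u
  define S where "S t = {s \<in> T. (s, t) \<in> le \<and> s \<noteq> t}" for t
  have S: "s \<in> S t \<longleftrightarrow> (s, t) \<in> le \<and> s \<noteq> t" for s t using le_in by (auto simp: S_def)
  have ST: "s \<in> T" if "s \<in> S t" for s t using that by (simp add: S_def)
  have finS: "finite (S t)" for t unfolding S_def by (rule finite_below)
  have down: "u \<in> S t" if "s \<in> S t" "(u, s) \<in> le" for s t u
    using that le_trans[OF that(2)] le_antisym unfolding S by blast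
  \<comment> \<open>\<open>B\<close> collects naturality and functoriality of the new level.
    \<open>Q\<close> below records that its matching map lies in \<open>M\<close>, together with the
    limits used, because \<open>M\<close> may distinguish isomorphic choices.\<close>
  define B where "B h t z n m a \<longleftrightarrow>
      z \<in> Obj C \<and> n \<in> N \<and> n \<in> hom C (xo t) z \<and> m \<in> hom C z (yo t) \<and> m \<cdot> n = \<phi> t
      \<and> (\<forall>s \<in> S t. a s \<in> hom C z (?zo h s) \<and> ?m h s \<cdot> a s = ya t s \<cdot> m \<and> a s \<cdot> n = ?n h s \<cdot> xa t s)
      \<and> (\<forall>s \<in> S t. \<forall>u \<in> S s. ?a h s u \<cdot> a s = a u)"
    for h :: "'i \<Rightarrow> 'o \<times> 'a \<times> 'a \<times> ('i \<Rightarrow> 'a)" and t z n m a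
  define Q where "Q h t z m a \<longleftrightarrow> (\<exists>LX \<pi> LY \<rho> a' b P p q k.
      poset_limit C (S t) le (?zo h) (za h) LX \<pi> \<and> poset_limit C (S t) le yo ya LY \<rho>
      \<and> a' \<in> hom C (yo t) LY \<and> (\<forall>s \<in> S t. \<rho> s \<cdot> a' = ya t s)
      \<and> b \<in> hom C LX LY \<and> (\<forall>s \<in> S t. \<rho> s \<cdot> b = ?m h s \<cdot> \<pi> s)
      \<and> is_pullback C a' b P p q \<and> k \<in> hom C z P \<and> p \<cdot> k = m
      \<and> (\<forall>s \<in> S t. \<pi> s \<cdot> (q \<cdot> k) = a s) \<and> k \<in> M)"
    for h :: "'i \<Rightarrow> 'o \<times> 'a \<times> 'a \<times> ('i \<Rightarrow> 'a)" and t z m a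
  define P where "P h t r \<longleftrightarrow> (t \<in> T \<longrightarrow> (case r of (z, n, m, a) \<Rightarrow> B h t z n m a \<and> Q h t z m a))"
    for h :: "'i \<Rightarrow> 'o \<times> 'a \<times> 'a \<times> ('i \<Rightarrow> 'a)" and t r
  \<comment> \<open>Stated for any \<open>h\<close>, so that these facts serve inside the recursion,
    where only levels below \<open>t\<close> are known, and again for the finished family.\<close>
  have z_gen: "?zo h s \<in> Obj C \<and> ?n h s \<in> hom C (xo s) (?zo h s) \<and> ?m h s \<in> hom C (?zo h s) (yo s) \<and> ?m h s \<cdot> ?n h s = \<phi> s"
    if "P h s (h s)" "s \<in> T" for h s
    using that unfolding P_def B_def by (cases "h s") auto
  have za_gen: "za h s u \<in> hom C (?zo h s) (?zo h u) \<and> ?m h u \<cdot> za h s u = ya s u \<cdot> ?m h s \<and> ?n h u \<cdot> xa s u = za h s u \<cdot> ?n h s"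
    if Ps: "P h s (h s)" and us: "(u, s) \<in> le" for h s u
  proof -
    have s: "s \<in> T" using le_in us by blast
    note z = z_gen[OF Ps s]
    show ?thesis
    proof (cases "u = s")
      case True
      then show ?thesis
        using z Idn_in Comp_Idn[of "?m h s"] Idn_Comp[of "?m h s"] Comp_Idn[of "?n h s"] Idn_Comp[of "?n h s"]
          poset_functorD(2)[OF y s] poset_functorD(2)[OF x s] by (auto simp: za_def)
    next
      case False
      then have "u \<in> S s" using us unfolding S by blast
      then show ?thesis using Ps s False unfolding P_def B_def by (cases "h s") (auto simp: za_def)
    qed
  qed
  have za_comp_gen: "za h s v = za h u v \<cdot> za h s u"
    if Ps: "P h s (h s)" and Pu: "P h u (h u)" and us: "(u, s) \<in> le" and vu: "(v, u) \<in> le" for h s u v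
  proof (cases "u = s \<or> v = u")
    case True
    then show ?thesis
      using Comp_Idn[of "za h u v"] Idn_Comp[of "za h s u"] za_gen[OF Ps us] za_gen[OF Pu vu] by (auto simp: za_def)
  next
    case False
    then have "u \<in> S s" "v \<in> S u" using us vu unfolding S by blast+
    moreover have "v \<noteq> s" using le_antisym[OF us] vu False by blast
    ultimately show ?thesis using Ps le_in(2)[OF us] False unfolding P_def B_def by (cases "h s") (auto simp: za_def)
  qed
  have "\<exists>h. \<forall>t. P h t (h t)"
  proof (rule dependent_wf_choice[OF wf_strict])
    fix h g :: "'i \<Rightarrow> 'o \<times> 'a \<times> 'a \<times> ('i \<Rightarrow> 'a)" and t r
    assume "\<And>z. (z, t) \<in> {(s, t). (s, t) \<in> le \<and> s \<noteq> t} \<Longrightarrow> h z = g z"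
    then have eq: "h s = g s" if "s \<in> S t" for s using that unfolding S by blast
    \<comment> \<open>The matching limit depends on \<open>h\<close> only through levels in
      \<open>S t\<close>, which is the locality needed for well-founded choice.\<close>
    have "poset_limit C (S t) le (?zo h) (za h) L \<pi> = poset_limit C (S t) le (?zo g) (za g) L \<pi>" for L \<pi>
      by (rule poset_limit_cong) (auto simp: za_def eq)
    then show "P h t r = P g t r" unfolding P_def B_def Q_def by (simp add: eq cong: conj_cong ball_cong)
  next
    fix t h assume IH: "\<And>s. (s, t) \<in> {(s, t). (s, t) \<in> le \<and> s \<noteq> t} \<Longrightarrow> P h s (h s)"
    show "\<exists>r. P h t r"
    proof (cases "t \<in> T")
      case False then show ?thesis by (simp add: P_def)
    next
      case t: True
      define zo n m a where "zo = ?zo h" and "n = ?n h" and "m = ?m h" and "a = ?a h"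
      have h: "h s = (zo s, n s, m s, a s)" for s by (simp add: zo_def n_def m_def a_def)
      have hs: "?zo h s = zo s" "?m h s = m s" for s by (simp_all add: zo_def m_def)
      have Ps: "P h s (h s)" if "s \<in> S t" for s using IH[of s] that unfolding S by simp
      have za: "za h s u = (if s = u then Idn C (zo s) else a s u)" for s u by (simp add: za_def h)
      have z: "zo s \<in> Obj C" "n s \<in> hom C (xo s) (zo s)" "m s \<in> hom C (zo s) (yo s)" "m s \<cdot> n s = \<phi> s" if "s \<in> S t" for s
        using z_gen[OF Ps ST, OF that that] by (simp_all add: h)
      have za_hom: "za h s u \<in> hom C (zo s) (zo u)" and m_za: "m u \<cdot> za h s u = ya s u \<cdot> m s"
        and za_n: "za h s u \<cdot> n s = n u \<cdot> xa s u" if "s \<in> S t" "(u, s) \<in> le" for s u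
        using za_gen[OF Ps[OF that(1)] that(2)] by (simp_all add: h)
      have za_comp: "za h s v = za h u v \<cdot> za h s u" if "s \<in> S t" "(u, s) \<in> le" "(v, u) \<in> le" for s u v
        by (rule za_comp_gen[OF Ps[OF that(1)] Ps[OF down[OF that(1,2)]] that(2,3)])
      have pfz: "poset_functor C (S t) (le \<inter> S t \<times> S t) zo (za h)"
      proof (rule poset_functorI)
        fix s u v assume "(u, s) \<in> le \<inter> S t \<times> S t" "(v, u) \<in> le \<inter> S t \<times> S t"
        then show "za h s v = za h u v \<cdot> za h s u" using za_comp by blast
      qed (use z(1) za_hom za in auto)
      have pfy: "poset_functor C (S t) (le \<inter> S t \<times> S t) yo ya"
        using y ST[of _ t] unfolding poset_functor_def by blast
      have sub: "S t \<subseteq> T" using ST by blast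
      obtain LX \<pi> where LX: "poset_limit C (S t) le zo (za h) LX \<pi>"
        using finite_subposet_limit[OF lim finS po sub pfz] .
      obtain LY \<rho> where LY: "poset_limit C (S t) le yo ya LY \<rho>"
        using finite_subposet_limit[OF lim finS po sub pfy] .
      note \<pi> = poset_limitD[OF LX] and \<rho> = poset_limitD[OF LY]
      have ya: "ya t s \<in> hom C (yo t) (yo s)" "xa t s \<in> hom C (xo t) (xo s)" if "s \<in> S t" for s
        using that poset_functorD(3)[OF y] poset_functorD(3)[OF x] unfolding S by blast+
      have ya': "ya s u \<in> hom C (yo s) (yo u)" if "s \<in> S t" "u \<in> S t" "(u, s) \<in> le" for s u
        using that poset_functorD(3)[OF y] by blast
      have yaya: "ya s u \<cdot> ya t s = ya t u" if "s \<in> S t" "(u, s) \<in> le" for s u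
        using that poset_functorD(4)[OF y, of s t u] unfolding S by simp
      have xaxa: "xa s u \<cdot> xa t s = xa t u" if "s \<in> S t" "(u, s) \<in> le" for s u
        using that poset_functorD(4)[OF x, of s t u] unfolding S by simp
      obtain a' where a': "a' \<in> hom C (yo t) LY" "\<And>s. s \<in> S t \<Longrightarrow> \<rho> s \<cdot> a' = ya t s"
        by (rule poset_limit_map[OF LY poset_functorD(1)[OF y t], of "ya t"]) (use ya yaya in auto)
      obtain b where b: "b \<in> hom C LX LY" "\<And>s. s \<in> S t \<Longrightarrow> \<rho> s \<cdot> b = m s \<cdot> \<pi> s"
      proof (rule poset_limit_map[OF LY \<pi>(1), of "\<lambda>s. m s \<cdot> \<pi> s"])
        fix s assume s: "s \<in> S t"
        show "m s \<cdot> \<pi> s \<in> hom C LX (yo s)" by (rule Comp_in[OF \<pi>(2)[OF s] z(3)[OF s]])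
        fix u assume u: "u \<in> S t" "(u, s) \<in> le"
        have "ya s u \<cdot> (m s \<cdot> \<pi> s) = (m u \<cdot> za h s u) \<cdot> \<pi> s"
          unfolding m_za[OF s u(2)] by (rule Comp_assoc[OF \<pi>(2)[OF s] z(3)[OF s] ya'[OF s u], symmetric])
        also have "\<dots> = m u \<cdot> \<pi> u"
          using Comp_assoc[OF \<pi>(2)[OF s] za_hom[OF s u(2)] z(3)[OF u(1)]] \<pi>(3)[OF s u] by simp
        finally show "ya s u \<cdot> (m s \<cdot> \<pi> s) = m u \<cdot> \<pi> u" .
      qed (rule that)
      obtain PB p q where PB: "is_pullback C a' b PB p q" using pullback_exists[OF lim a'(1) b(1)] .
      have ab: "Dom C a' = yo t" "Dom C b = LX" using a' b by (auto simp: hom_def)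
      note pq = pullbackD(3,4)[OF PB, unfolded ab]
      obtain w where w: "w \<in> hom C (xo t) LX" "\<And>s. s \<in> S t \<Longrightarrow> \<pi> s \<cdot> w = n s \<cdot> xa t s"
      proof (rule poset_limit_map[OF LX poset_functorD(1)[OF x t], of "\<lambda>s. n s \<cdot> xa t s"])
        fix s assume s: "s \<in> S t"
        show "n s \<cdot> xa t s \<in> hom C (xo t) (zo s)" by (rule Comp_in[OF ya(2)[OF s] z(2)[OF s]])
        fix u assume u: "u \<in> S t" "(u, s) \<in> le"
        have xsu: "xa s u \<in> hom C (xo s) (xo u)" by (rule poset_functorD(3)[OF x u(2)])
        have "za h s u \<cdot> (n s \<cdot> xa t s) = (n u \<cdot> xa s u) \<cdot> xa t s"
          unfolding za_n[OF s u(2), symmetric]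
          by (rule Comp_assoc[OF ya(2)[OF s] z(2)[OF s] za_hom[OF s u(2)], symmetric])
        also have "\<dots> = n u \<cdot> xa t u"
          using Comp_assoc[OF ya(2)[OF s] xsu z(2)[OF u(1)]] xaxa[OF s u(2)] by simp
        finally show "za h s u \<cdot> (n s \<cdot> xa t s) = n u \<cdot> xa t u" .
      qed (rule that)
      \<comment> \<open>The compatibility that sends \<open>xo t\<close> into the pullback; it is
        checked on the projections of \<open>LY\<close>.\<close>
      have "a' \<cdot> \<phi> t = b \<cdot> w"
      proof (rule poset_limit_unique[OF LY ya'])
        show "a' \<cdot> \<phi> t \<in> hom C (xo t) LY" "b \<cdot> w \<in> hom C (xo t) LY"
          using Comp_in[OF \<phi>[OF t] a'(1)] Comp_in[OF w(1) b(1)] .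
        fix s assume s: "s \<in> S t"
        have "\<rho> s \<cdot> (a' \<cdot> \<phi> t) = ya t s \<cdot> \<phi> t" by (rule comp_left_eq[OF a'(2)[OF s] a'(1) \<rho>(2)[OF s] \<phi>[OF t]])
        also have "\<dots> = \<phi> s \<cdot> xa t s" using nat[of s t] s unfolding S by simp
        also have "\<dots> = m s \<cdot> (n s \<cdot> xa t s)"
          by (rule comp_left_eq[OF z(4)[OF s] z(2,3)[OF s] ya(2)[OF s], symmetric])
        also have "\<dots> = m s \<cdot> (\<pi> s \<cdot> w)" using w(2)[OF s] by simp
        also have "\<dots> = (\<rho> s \<cdot> b) \<cdot> w" unfolding b(2)[OF s] by (rule Comp_assoc[OF w(1) \<pi>(2)[OF s] z(3)[OF s], symmetric])
        also have "\<dots> = \<rho> s \<cdot> (b \<cdot> w)" by (rule Comp_assoc[OF w(1) b(1) \<rho>(2)[OF s]])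
        finally show "\<rho> s \<cdot> (a' \<cdot> \<phi> t) = \<rho> s \<cdot> (b \<cdot> w)" .
      qed
      then obtain g where g: "g \<in> hom C (xo t) PB" "p \<cdot> g = \<phi> t" "q \<cdot> g = w"
        using pullback_map[OF PB, unfolded ab, OF \<phi>[OF t] w(1)] by blast
      then have "g \<in> Arr C" by (simp add: hom_def)
      \<comment> \<open>The factorization in \<open>C\<close> is applied to the map \<open>g\<close>
        into the pullback; composing \<open>k\<close> with the projections will give
        \<open>m\<close> at \<open>t\<close> and the new transition maps.\<close>
      then obtain n' k where nk: "n' \<in> N" "k \<in> M" "Cod C n' = Dom C k" "k \<cdot> n' = g"
        using fac unfolding all_factor_def by blast
      have nkA: "n' \<in> Arr C" "k \<in> Arr C" using nk N M by auto
      have "Dom C g = Dom C n'" "Cod C g = Cod C k" using nkA nk(3,4) by auto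
      then have n': "n' \<in> hom C (xo t) (Dom C k)" and k: "k \<in> hom C (Dom C k) PB"
        using nkA nk(3) g(1) by (auto simp: hom_def)
      note qk = Comp_in[OF k pq(2)]
      have "B h t (Dom C k) n' (p \<cdot> k) (\<lambda>s. \<pi> s \<cdot> (q \<cdot> k))"
        unfolding B_def h fst_conv snd_conv
      proof (intro conjI ballI)
        show "Dom C k \<in> Obj C" using hom_Obj[OF k] by blast
        show "p \<cdot> k \<in> hom C (Dom C k) (yo t)" by (rule Comp_in[OF k pq(1)])
        show "(p \<cdot> k) \<cdot> n' = \<phi> t" using Comp_assoc[OF n' k pq(1)] nk(4) g(2) by simp
        fix s assume s: "s \<in> S t"
        show "\<pi> s \<cdot> (q \<cdot> k) \<in> hom C (Dom C k) (zo s)" by (rule Comp_in[OF qk \<pi>(2)[OF s]])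
        have "m s \<cdot> (\<pi> s \<cdot> (q \<cdot> k)) = (\<rho> s \<cdot> b) \<cdot> (q \<cdot> k)"
          unfolding b(2)[OF s] by (rule Comp_assoc[OF qk \<pi>(2)[OF s] z(3)[OF s], symmetric])
        also have "\<dots> = \<rho> s \<cdot> (b \<cdot> (q \<cdot> k))" by (rule Comp_assoc[OF qk b(1) \<rho>(2)[OF s]])
        also have "b \<cdot> (q \<cdot> k) = (b \<cdot> q) \<cdot> k" by (rule Comp_assoc[OF k pq(2) b(1), symmetric])
        also have "\<dots> = a' \<cdot> (p \<cdot> k)"
          unfolding pullbackD(5)[OF PB, symmetric] by (rule Comp_assoc[OF k pq(1) a'(1)])
        also have "\<rho> s \<cdot> (a' \<cdot> (p \<cdot> k)) = ya t s \<cdot> (p \<cdot> k)"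
          by (rule comp_left_eq[OF a'(2)[OF s] a'(1) \<rho>(2)[OF s] Comp_in[OF k pq(1)]])
        finally show "m s \<cdot> (\<pi> s \<cdot> (q \<cdot> k)) = ya t s \<cdot> (p \<cdot> k)" .
        have "(\<pi> s \<cdot> (q \<cdot> k)) \<cdot> n' = \<pi> s \<cdot> (q \<cdot> (k \<cdot> n'))"
          using Comp_assoc[OF n' qk \<pi>(2)[OF s]] Comp_assoc[OF n' k pq(2)] by simp
        also have "\<dots> = n s \<cdot> xa t s" using nk(4) g(3) w(2)[OF s] by simp
        finally show "(\<pi> s \<cdot> (q \<cdot> k)) \<cdot> n' = n s \<cdot> xa t s" .
        fix u assume u: "u \<in> S s"
        then have u': "u \<in> S t" "(u, s) \<in> le" "s \<noteq> u" using down[OF s] unfolding S by blast+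
        show "a s u \<cdot> (\<pi> s \<cdot> (q \<cdot> k)) = \<pi> u \<cdot> (q \<cdot> k)"
          using comp_left_eq[OF \<pi>(3)[OF s u'(1,2)] \<pi>(2)[OF s] za_hom[OF s u'(2)] qk] u'(3) by (simp add: za)
      qed (use nk n' in blast)+
      moreover have "Q h t (Dom C k) (p \<cdot> k) (\<lambda>s. \<pi> s \<cdot> (q \<cdot> k))"
        unfolding Q_def hs
        by (rule exI[of _ LX], rule exI[of _ \<pi>], rule exI[of _ LY], rule exI[of _ \<rho>], rule exI[of _ a'], rule exI[of _ b],
            rule exI[of _ PB], rule exI[of _ p], rule exI[of _ q], rule exI[of _ k])
          (use LX LY a' b PB k nk(2) in simp)
      ultimately show ?thesis unfolding P_def by blast
    qed
  qed
  then obtain h where h: "\<And>t. P h t (h t)" by blast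
  define zo n m a where "zo = ?zo h" and "n = ?n h" and "m = ?m h" and "a = ?a h"
  have hh: "h s = (zo s, n s, m s, a s)" for s by (simp add: zo_def n_def m_def a_def)
  have hs: "?zo h s = zo s" "?m h s = m s" for s by (simp_all add: zo_def m_def)
  have Qs: "Q h s (zo s) (m s) (a s)" and nN: "n s \<in> N" if "s \<in> T" for s
    using h[of s] that hh[of s] unfolding P_def B_def by simp_all
  have z: "zo s \<in> Obj C" "n s \<in> hom C (xo s) (zo s)" "m s \<in> hom C (zo s) (yo s)" "m s \<cdot> n s = \<phi> s" if "s \<in> T" for s
    using z_gen[OF h that] by (simp_all add: hh)
  have za: "za h s u = (if s = u then Idn C (zo s) else a s u)" for s u by (simp add: za_def hh)
  have zh: "za h s u \<in> hom C (zo s) (zo u)" "m u \<cdot> za h s u = ya s u \<cdot> m s" "n u \<cdot> xa s u = za h s u \<cdot> n s"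
    if "(u, s) \<in> le" for s u
    using za_gen[OF h that] by (simp_all add: hh)
  note zcomp = za_comp_gen[OF h h]
  have pf: "poset_functor C T le zo (za h)"
    by (rule poset_functorI[OF z(1) _ zh(1) zcomp]) (simp_all add: za)
  have "special_at C M le (poset_diagram T le zo (za h)) (poset_diagram T le yo ya) m t" if t: "t \<in> T" for t
  proof -
    obtain LX \<pi> LY \<rho> a' b PB p q k where
      L: "poset_limit C (S t) le zo (za h) LX \<pi>" "poset_limit C (S t) le yo ya LY \<rho>"
      and ab: "a' \<in> hom C (yo t) LY" "\<forall>s \<in> S t. \<rho> s \<cdot> a' = ya t s" "b \<in> hom C LX LY" "\<forall>s \<in> S t. \<rho> s \<cdot> b = m s \<cdot> \<pi> s"
      and PB: "is_pullback C a' b PB p q"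
      and k: "k \<in> hom C (zo t) PB" "p \<cdot> k = m t" "\<forall>s \<in> S t. \<pi> s \<cdot> (q \<cdot> k) = a t s" "k \<in> M"
      using Qs[OF t] unfolding Q_def hs by blast
    have sub: "S t \<subseteq> T" using ST by blast
    have ta: "za h t s = a t s" if "s \<in> S t" for s using that unfolding S by (auto simp: za)
    show ?thesis
      unfolding special_at_def Let_def poset_diagram_simps poset_cat_simps S_def[symmetric]
      by (rule exI[of _ LX], rule exI[of _ \<pi>], rule exI[of _ LY], rule exI[of _ \<rho>], rule exI[of _ a'], rule exI[of _ b],
          rule exI[of _ PB], rule exI[of _ p], rule exI[of _ q], rule exI[of _ k])
        (use limit_cone_restrict_poset_diagram[OF sub L(1)] limit_cone_restrict_poset_diagram[OF sub L(2)] ab PB k ta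
          in \<open>auto simp: in_hom_poset_cat\<close>)
  qed
  then show thesis using that[OF poset_transI[OF x pf z(2) zh(3)] nN poset_transI[OF pf y z(3) zh(2)] z(4)] by blast
qed

end

section \<open>Factorizations in the pro-category\<close>

abbreviation levelwise_maps :: "('o, 'a) cat \<Rightarrow> 'a set \<Rightarrow> ('i, 'o, 'a) pro_arr set" where
  "levelwise_maps C N \<equiv> {pro_induced C X Y \<phi> | X Y \<phi>. directed (Idx X) \<and> levelwise C N X Y \<phi>}"

abbreviation special_maps :: "('o, 'a) cat \<Rightarrow> 'a set \<Rightarrow> ('i, 'o, 'a) pro_arr set" where
  "special_maps C M \<equiv> {pro_induced C X Y \<phi> | X Y \<phi>. directed (Idx X) \<and> special C M X Y \<phi>}"

context category
begin

lemma pro_comp_induced: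
  assumes \<phi>: "nat_trans C X Z \<phi>" and \<psi>: "nat_trans C Z Y \<psi>" and \<chi>: "nat_trans C X Y \<chi>"
    and eq: "\<And>s. s \<in> Obj (Idx X) \<Longrightarrow> \<psi> s \<cdot> \<phi> s = \<chi> s"
  shows "pro_comp C X Y (induced_map C Z Y \<psi>) (induced_map C X Z \<phi>) = induced_map C X Y \<chi>"
proof -
  have d: "is_diagram C X" "is_diagram C Z" "is_diagram C Y" "Idx Z = Idx X" "Idx Y = Idx X"
    and h: "\<And>s. s \<in> Obj (Idx X) \<Longrightarrow> \<phi> s \<in> hom C (OMap X s) (OMap Z s)" "\<And>s. s \<in> Obj (Idx X) \<Longrightarrow> \<psi> s \<in> hom C (OMap Z s) (OMap Y s)"
    using \<phi> \<psi> unfolding nat_trans_def by auto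
  show ?thesis
  proof (rule pro_hom_ext[OF pro_comp_in[OF d(1-3) induced_map_in[OF \<phi>] induced_map_in[OF \<psi>]] induced_map_in[OF \<chi>]])
    fix s assume s: "s \<in> Obj (Idx Y)"
    then have s': "s \<in> Obj (Idx X)" "s \<in> Obj (Idx Z)" using d by auto
    show "pro_comp C X Y (induced_map C Z Y \<psi>) (induced_map C X Z \<phi>) s = induced_map C X Y \<chi> s"
      using pull_induced[OF d(1) \<psi> induced_map_in[OF \<phi>] s] push_class[OF d(1) s'(1) h(1)[OF s'(1)] h(2)[OF s'(1)]]
        eq[OF s'(1)] s s' by (simp add: induced_map_def)
  qed
qed

lemma Lw_base_Arr: "levelwise_maps C N \<subseteq> Arr (Pro C)"
  using pro_induced_hom unfolding levelwise_def hom_def by blast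

lemma Sp_base_Arr: "special_maps C M \<subseteq> Arr (Pro C)"
  using pro_induced_hom unfolding special_def hom_def by blast

lemma Lw_Arr: "Lw C N \<subseteq> Arr (Pro C)" and Sp_Arr: "Sp C M \<subseteq> Arr (Pro C)"
  unfolding Lw_def Sp_def iso_closure_def by auto

lemma pro_induced_Sp: "special C M X Y \<phi> \<Longrightarrow> directed (Idx X) \<Longrightarrow> pro_induced C X Y \<phi> \<in> Sp C M"
  unfolding Sp_def by (rule subsetD[OF category.iso_closure_incl[OF category_Pro Sp_base_Arr]]) blast

text \<open>On the one-point poset the matching limits are terminal, and the pullback is taken to be
  \<open>d\<close> with identity projection, so that the relative matching map is \<open>m\<close>
  itself and not merely isomorphic to it.\<close>

lemma simple_arr_Sp:
  assumes lim: "has_finite_limits C" and m: "m \<in> M" "m \<in> Arr C"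
  shows "(simple_arr C m :: ('i, 'o, 'a) pro_arr) \<in> Sp C M"
proof -
  define c d where "c = Dom C m" and "d = Cod C m"
  have mh: "m \<in> hom C c d" using m(2) by (simp add: hom_def c_def d_def)
  note o = hom_Obj[OF mh]
  let ?c = "simple_obj C c :: ('i, 'o, 'a) pro_obj" and ?d = "simple_obj C d :: ('i, 'o, 'a) pro_obj"
  obtain L where L: "L \<in> Obj C" "\<And>K. K \<in> Obj C \<Longrightarrow> \<exists>!h. h \<in> hom C K L" using terminal_exists[OF lim] by blast
  obtain a where a: "a \<in> hom C d L" using L(2)[OF o(2)] by blast
  obtain q where q: "q \<in> hom C d L" using a by blast
  have uniq: "h = h'" if "h \<in> hom C K L" "h' \<in> hom C K L" for h h' K
    using L(2)[OF hom_Obj(1)[OF that(1)]] that by blast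
  define le :: "('i \<times> 'i) set" where "le = {(undefined, undefined)}"
  have lc: "limit_cone C (restrict_diagram (simple_obj C e :: ('i, 'o, 'a) pro_obj) {}) L (\<lambda>_. undefined)" for e
    unfolding limit_cone_def cone_def using L by (simp add: restrict_diagram_def full_subcat_def)
  have pb: "is_pullback C a (Idn C L) d (Idn C d) a"
    unfolding is_pullback_def
  proof (intro conjI allI ballI impI)
    have ad: "Dom C a = d" "Cod C a = L" "a \<in> Arr C" using a by (auto simp: hom_def)
    show "a \<in> Arr C" "Idn C L \<in> Arr C" "Cod C a = Cod C (Idn C L)" "Idn C d \<in> hom C d (Dom C a)"
      "a \<in> hom C d (Dom C (Idn C L))" "a \<cdot> Idn C d = Idn C L \<cdot> a"
      using ad o L Idn_in[OF o(2)] a by simp_all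
    fix Q x y assume x: "x \<in> hom C Q (Dom C a)" and y: "y \<in> hom C Q (Dom C (Idn C L))"
      and e: "a \<cdot> x = Idn C L \<cdot> y"
    have x': "x \<in> hom C Q d" and y': "y \<in> hom C Q L" using x y ad L by simp_all
    show "\<exists>!h. h \<in> hom C Q d \<and> Idn C d \<cdot> h = x \<and> a \<cdot> h = y"
    proof (rule ex1I[of _ x])
      show "x \<in> hom C Q d \<and> Idn C d \<cdot> x = x \<and> a \<cdot> x = y"
        using x' Idn_Comp[OF x'] uniq[OF Comp_in[OF x' a] y'] by blast
      show "h = x" if "h \<in> hom C Q d \<and> Idn C d \<cdot> h = x \<and> a \<cdot> h = y" for h
        using that Idn_Comp[of h Q d] by simp
    qed
  qed
  have S: "{s \<in> Obj (Idx ?c). (s, undefined) \<in> le \<and> s \<noteq> undefined} = {}" by (simp add: le_def)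
  have "special_at C M le ?c ?d (\<lambda>_. m) undefined"
    unfolding special_at_def Let_def S
    by (rule exI[of _ L], rule exI[of _ "\<lambda>_. undefined"], rule exI[of _ L], rule exI[of _ "\<lambda>_. undefined"],
        rule exI[of _ a], rule exI[of _ "Idn C L"], rule exI[of _ d], rule exI[of _ "Idn C d"], rule exI[of _ a], rule exI[of _ m])
      (use lc a Idn_in[OF L(1)] pb mh Idn_Comp[OF mh] m(1) in simp)
  moreover have "poset_category le (point_cat :: ('i, 'i) cat)"
    unfolding poset_category_def using category_point_cat
    by (auto simp: le_def partial_order_on_def preorder_on_def refl_on_def trans_def antisym_def)
  moreover have "cofinite (Obj (point_cat :: ('i, 'i) cat)) le" by (simp add: cofinite_def)
  ultimately have "\<exists>le. poset_category le (Idx ?c) \<and> cofinite (Obj (Idx ?c)) le \<and> (\<forall>t \<in> Obj (Idx ?c). special_at C M le ?c ?d (\<lambda>_. m) t)"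
    by (intro exI[of _ le]) simp
  then have sp: "special C M ?c ?d (\<lambda>_. m)"
    unfolding special_def using nat_trans_simple[OF mh] by blast
  have "simple_arr C m = pro_induced C ?c ?d (\<lambda>_. m)" by (simp add: simple_arr_def c_def d_def)
  then show ?thesis using pro_induced_Sp[OF sp] directed_point_cat by simp
qed

text \<open>One inclusion holds because simple morphisms from \<open>M\<close> are themselves
  special, the other because lifting passes from them to special maps and then to the isomorphism
  closure.\<close>

lemma left_orth_Sp:
  assumes lim: "has_finite_limits C" and M: "M \<subseteq> Arr C"
  shows "left_orth (Pro C) (Sp C M) = left_orth (Pro C) (simple_arr C ` M)"
proof
  show "left_orth (Pro C) (Sp C M) \<subseteq> left_orth (Pro C) (simple_arr C ` M)"
    using simple_arr_Sp[OF lim] M unfolding left_orth_def by blast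
  have "left_orth (Pro C) (simple_arr C ` M) \<subseteq>
    left_orth (Pro C) (special_maps C M)"
  proof
    fix i assume i: "i \<in> left_orth (Pro C) (simple_arr C ` M)"
    then have "i \<in> Arr (Pro C)" by (simp add: left_orth_def)
    then obtain A B I where I: "i = (A, B, I)" "is_pro_obj C A" "is_pro_obj C B" "I \<in> pro_hom C A B"
      by (rule Arr_ProE)
    have "lifts (Pro C) (A, B, I) (simple_arr C m)" if "m \<in> M" for m
      using i that unfolding left_orth_def I(1) by blast
    from special_lifts[OF I(2-4) this M]
    show "i \<in> left_orth (Pro C) (special_maps C M)"
      using \<open>i \<in> Arr (Pro C)\<close> unfolding left_orth_def I(1) by blast
  qed
  then show "left_orth (Pro C) (simple_arr C ` M) \<subseteq> left_orth (Pro C) (Sp C M)"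
    unfolding Sp_def using category.left_orth_iso_closure[OF category_Pro Sp_base_Arr] by blast
qed

text \<open>For a levelwise map the lift is found at a single level; isomorphic morphisms inherit it
  as retracts.\<close>

lemma Lw_subset_left_orth:
  assumes lim: "has_finite_limits C" and M: "M \<subseteq> Arr C" and o: "orth C N M"
  shows "Lw C N \<subseteq> left_orth (Pro C) (simple_arr C ` M)"
proof
  interpret P: category "Pro C" by (rule category_Pro)
  fix i assume i: "i \<in> Lw C N"
  then obtain A B \<phi> where j: "directed (Idx A)" "levelwise C N A B \<phi>"
    "isomorphic (arrow_cat (Pro C)) i (pro_induced C A B \<phi>)" and iA: "i \<in> Arr (Pro C)"
    unfolding Lw_def iso_closure_def by blast
  have jA: "pro_induced C A B \<phi> \<in> Arr (Pro C)" using Lw_base_Arr j(1,2) by blast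
  have "lifts (Pro C) i (simple_arr C m)" if "m \<in> M" for m
  proof (rule P.lifts_retract_left[OF iA jA])
    have "m \<in> Arr C" using M that by blast
    then show "simple_arr C m \<in> Arr (Pro C)"
      using subsetD[OF Sp_Arr simple_arr_Sp[OF lim]] that by blast
    show "retract_of (arrow_cat (Pro C)) i (pro_induced C A B \<phi>)"
      using category.isomorphic_imp_retract[OF P.category_arrow_cat j(3)] .
    show "lifts (Pro C) (pro_induced C A B \<phi>) (simple_arr C m)"
      by (rule levelwise_lifts_simple[OF j(2,1) that \<open>m \<in> Arr C\<close> o])
  qed
  then show "i \<in> left_orth (Pro C) (simple_arr C ` M)" using iA unfolding left_orth_def by blast
qed

end

context indexed_category
begin

text \<open>Keeps the explicit diagrams over \<open>T\<close> and not only membership in the two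
  classes, because the argument by lifting has to modify the middle diagram.\<close>

lemma levelwise_factorization:
  fixes f :: "('i, 'o, 'a) pro_arr"
  assumes lim: "has_finite_limits C" and fac: "all_factor C M N" and M: "M \<subseteq> Arr C" and N: "N \<subseteq> Arr C"
    and f: "f \<in> Arr (Pro C)"
  obtains xo xa yo ya zo za n m \<phi> where "poset_trans C T le xo xa zo za n" "\<And>s. s \<in> T \<Longrightarrow> n s \<in> N" "poset_trans C T le zo za yo ya m"
    "poset_trans C T le xo xa yo ya \<phi>" "\<And>s. s \<in> T \<Longrightarrow> m s \<cdot> n s = \<phi> s"
    "special C M (poset_diagram T le zo za) (poset_diagram T le yo ya) m"
    "isomorphic (arrow_cat (Pro C)) f (pro_induced C (poset_diagram T le xo xa) (poset_diagram T le yo ya) \<phi>)"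
proof -
  obtain xo xa yo ya \<phi> where \<phi>: "poset_trans C T le xo xa yo ya \<phi>"
    "isomorphic (arrow_cat (Pro C)) f (pro_induced C (poset_diagram T le xo xa) (poset_diagram T le yo ya) \<phi>)"
    using level_representation[OF lim f] .
  obtain zo za n m where z: "poset_trans C T le xo xa zo za n" "\<And>s. s \<in> T \<Longrightarrow> n s \<in> N"
    "poset_trans C T le zo za yo ya m" "\<And>s. s \<in> T \<Longrightarrow> m s \<cdot> n s = \<phi> s"
    and sp: "\<And>t. t \<in> T \<Longrightarrow> special_at C M le (poset_diagram T le zo za) (poset_diagram T le yo ya) m t"
    using reedy_factorization[OF lim fac M N \<phi>(1)] by blast
  have "special C M (poset_diagram T le zo za) (poset_diagram T le yo ya) m"
    unfolding special_def using nat_trans_poset_diagram[OF z(3)] poset_category_poset_cat cofinite sp by auto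
  from that[OF z(1-3) \<phi>(1) z(4) this \<phi>(2)] show thesis .
qed

lemma all_factor_Pro:
  assumes lim: "has_finite_limits C" and fac: "all_factor C M N" and M: "M \<subseteq> Arr C" and N: "N \<subseteq> Arr C"
  shows "all_factor (Pro C :: ('i, 'o, 'a) pro_cat) (Sp C M) (Lw C N)"
  unfolding all_factor_def
proof
  fix f :: "('i, 'o, 'a) pro_arr" assume f: "f \<in> Arr (Pro C)"
  interpret P: category "Pro C :: ('i, 'o, 'a) pro_cat" by (rule category_Pro)
  obtain xo xa yo ya zo za n m \<phi> where n: "poset_trans C T le xo xa zo za n" "\<And>s. s \<in> T \<Longrightarrow> n s \<in> N"
    and m: "poset_trans C T le zo za yo ya m"
    and \<phi>: "poset_trans C T le xo xa yo ya \<phi>" and mn: "\<And>s. s \<in> T \<Longrightarrow> m s \<cdot> n s = \<phi> s"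
    and sp: "special C M (poset_diagram T le zo za) (poset_diagram T le yo ya) m"
    and iso: "isomorphic (arrow_cat (Pro C)) f (pro_induced C (poset_diagram T le xo xa) (poset_diagram T le yo ya) \<phi>)"
    by (rule levelwise_factorization[OF lim fac M N f], rule that; assumption?)
  let ?X = "poset_diagram T le xo xa" and ?Y = "poset_diagram T le yo ya" and ?Z = "poset_diagram T le zo za"
  have nX: "nat_trans C ?X ?Z n" by (rule nat_trans_poset_diagram[OF n(1)])
  have nY: "nat_trans C ?Z ?Y m" by (rule nat_trans_poset_diagram[OF m])
  have nf: "nat_trans C ?X ?Y \<phi>" by (rule nat_trans_poset_diagram[OF \<phi>])
  have "levelwise C N ?X ?Z n" unfolding levelwise_def using nX n(2) by simp
  then have 1: "pro_induced C ?X ?Z n \<in> levelwise_maps C N"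
    using directed_index by (auto intro!: exI)
  have 2: "pro_induced C ?Z ?Y m \<in> special_maps C M"
    using directed_index sp by (auto intro!: exI)
  have "pro_comp C ?X ?Y (induced_map C ?Z ?Y m) (induced_map C ?X ?Z n) = induced_map C ?X ?Y \<phi>"
    by (rule pro_comp_induced[OF nX nY nf]) (simp add: mn)
  then have 3: "pro_induced C ?Z ?Y m \<cdot>\<^bsub>Pro C\<^esub> pro_induced C ?X ?Z n = pro_induced C ?X ?Y \<phi>"
    by (simp add: pro_induced_eq)
  have "pro_induced C ?X ?Y \<phi> \<in> Arr (Pro C)"
    using pro_induced_hom[OF nf] directed_index by (simp add: hom_def)
  from P.factor_iso_closure[OF f this iso 1 _ 2 _ _ 3]
  show "\<exists>n\<in>Lw C N. \<exists>m\<in>Sp C M. Cod (Pro C) n = Dom (Pro C) m \<and> m \<cdot>\<^bsub>Pro C\<^esub> n = f"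
    unfolding Lw_def Sp_def using subsetD[OF Lw_base_Arr 1] subsetD[OF Sp_base_Arr 2] by (simp add: pro_induced_eq)
qed

text \<open>A morphism \<open>\<phi> = m \<circ> n\<close> that has the left lifting property against its second factor admits \<open>k\<close> with
  \<open>k \<circ> \<phi> = n\<close> and \<open>m \<circ> k = id\<close>. Spreading the index poset out so that \<open>s\<close> lies below \<open>t\<close> only if a
  representative of \<open>k\<close> into \<open>Z\<^sub>s\<close> starts at or below \<open>Y\<^sub>t\<close>, the idempotent \<open>k \<circ> m\<close> provides new transition maps
  on the objects \<open>Z\<^sub>s\<close>. They turn \<open>Z\<close> into a pro-object isomorphic to \<open>Y\<close>, and \<open>n\<close> remains a levelwise map
  into it.\<close>

lemma levelwise_of_lift:
  assumes xz: "poset_trans C T le xo xa zo za n" and nN: "\<And>s. s \<in> T \<Longrightarrow> n s \<in> N"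
    and zy: "poset_trans C T le zo za yo ya m" and xy: "poset_trans C T le xo xa yo ya \<phi>"
    and mn: "\<And>s. s \<in> T \<Longrightarrow> m s \<cdot> n s = \<phi> s"
    and lift: "lifts (Pro C) (pro_induced C (poset_diagram T le xo xa) (poset_diagram T le yo ya) \<phi>)
      (pro_induced C (poset_diagram T le zo za) (poset_diagram T le yo ya) m)"
  shows "pro_induced C (poset_diagram T le xo xa) (poset_diagram T le yo ya) \<phi> \<in> Lw C N"
proof -
  let ?X = "poset_diagram T le xo xa" and ?Y = "poset_diagram T le yo ya" and ?Z = "poset_diagram T le zo za"
  note x = poset_transD(1)[OF xz] and z = poset_transD(2)[OF xz] and y = poset_transD(2)[OF xy]
  note n = poset_transD(3,4)[OF xz] and m = poset_transD(3,4)[OF zy] and \<phi> = poset_transD(3,4)[OF xy]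
  note nX = nat_trans_poset_diagram[OF xz] and nY = nat_trans_poset_diagram[OF zy] and nf = nat_trans_poset_diagram[OF xy]
  note pX = pro_obj_poset_diagram[OF x] and pY = pro_obj_poset_diagram[OF y] and pZ = pro_obj_poset_diagram[OF z]
  note dX = pro_objD(1)[OF pX] and dY = pro_objD(1)[OF pY] and dZ = pro_objD(1)[OF pZ]
  note xo = poset_functorD(1)[OF x] and yo = poset_functorD(1)[OF y] and zo = poset_functorD(1)[OF z]
  note xa = poset_functorD(3)[OF x] and ya = poset_functorD(3)[OF y] and za = poset_functorD(3)[OF z]
  note xa' = poset_functorD(4)[OF x] and ya' = poset_functorD(4)[OF y] and za' = poset_functorD(4)[OF z]
  interpret P: category "Pro C :: ('i, 'o, 'a) pro_cat" by (rule category_Pro)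
  note in_f = induced_map_in[OF nf] and in_n = induced_map_in[OF nX] and in_m = induced_map_in[OF nY]
  have "pro_comp C ?X ?Y (induced_map C ?Z ?Y m) (induced_map C ?X ?Z n) = induced_map C ?X ?Y \<phi>"
    by (rule pro_comp_induced[OF nX nY nf]) (simp add: mn)
  moreover have "pro_comp C ?X ?Y (pro_idn C ?Y) (induced_map C ?X ?Y \<phi>) = induced_map C ?X ?Y \<phi>"
    using P.Idn_Comp[of "(?X, ?Y, induced_map C ?X ?Y \<phi>)" ?X ?Y] pX pY in_f by (simp add: hom_Pro)
  ultimately obtain k where k: "k \<in> pro_hom C ?Y ?Z" "pro_comp C ?X ?Z k (induced_map C ?X ?Y \<phi>) = induced_map C ?X ?Z n"
    "pro_comp C ?Y ?Y (induced_map C ?Z ?Y m) k = pro_idn C ?Y"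
    using lift in_n pro_idn_in[OF dY] unfolding pro_induced_eq lifts_Pro_iff[OF pX pY pZ pY] by metis

  \<comment> \<open>Strict representatives of the lift \<open>k\<close>\<close>
  have cl: "colim_class C (poset_diagram T le ob ar) c t (f \<cdot> ar t s) = colim_class C (poset_diagram T le ob ar) c s f"
    if "poset_functor C T le ob ar" "(s, t) \<in> le" "f \<in> hom C (ob s) c" for ob ar c s t f
    using class_restrict[OF is_diagram_poset_diagram[OF that(1)], of s f c "pair_code (t, s)" t] that le_in[OF that(2)]
    by (simp add: in_hom_poset_cat)
  have clD: "\<exists>r. (s, r) \<in> le \<and> (t, r) \<in> le \<and> f \<cdot> ar r s = g \<cdot> ar r t"
    if pf: "poset_functor C T le ob ar" and s: "s \<in> T" "f \<in> hom C (ob s) c"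
      and e: "colim_class C (poset_diagram T le ob ar) c s f = colim_class C (poset_diagram T le ob ar) c t g"
    for ob ar c s t f g
  proof -
    obtain r u v where "u \<in> hom (poset_cat T le) r s" "v \<in> hom (poset_cat T le) r t"
      "f \<cdot> AMap (poset_diagram T le ob ar) u = g \<cdot> AMap (poset_diagram T le ob ar) v"
      by (rule class_eqD[OF pro_obj_poset_diagram[OF pf], of s f c t g]) (use s e in auto)
    then show ?thesis by (auto simp: in_hom_poset_cat)
  qed
  \<comment> \<open>Both triangle identities for \<open>k\<close> hold between classes; far enough
    out, at some \<open>b\<close> strictly above \<open>s\<close>, they hold in \<open>C\<close> for
    one representative \<open>\<kappa>\<close>.\<close>
  define R where "R s b \<kappa> \<longleftrightarrow> (s, b) \<in> le \<and> s \<noteq> b \<and> \<kappa> \<in> hom C (yo b) (zo s)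
      \<and> k s = colim_class C ?Y (zo s) b \<kappa> \<and> m s \<cdot> \<kappa> = ya b s \<and> \<kappa> \<cdot> \<phi> b = n s \<cdot> xa b s" for s b \<kappa>
  have "\<exists>p. R s (fst p) (snd p)" if s: "s \<in> T" for s
  proof -
    obtain i g where i: "i \<in> T" "g \<in> hom C (yo i) (zo s)" "k s = colim_class C ?Y (zo s) i g"
      using pro_homD(1)[OF k(1), of s] s by - (rule colim_homE, simp, rule that; simp)
    have "colim_push C ?Y (yo s) (m s) (k s) = colim_class C ?Y (yo s) s (Idn C (yo s))"
      using fun_cong[OF k(3), of s] pull_induced[OF dY nY k(1), of s] s by (simp add: pro_idn_def)
    then have "colim_class C ?Y (yo s) i (m s \<cdot> g) = colim_class C ?Y (yo s) s (Idn C (yo s))"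
      using push_class[OF dY, of i g "zo s" "m s" "yo s"] i m(1)[OF s] by simp
    from clD[OF y i(1) Comp_in[OF i(2) m(1)[OF s]] this]
    obtain r1 where r1: "(i, r1) \<in> le" "(s, r1) \<in> le" "(m s \<cdot> g) \<cdot> ya r1 i = Idn C (yo s) \<cdot> ya r1 s" by blast
    have "colim_push C ?X (zo s) g (induced_map C ?X ?Y \<phi> i) = induced_map C ?X ?Z n s"
      using fun_cong[OF k(2), of s] pull_class[OF dX dY in_f, of i g "zo s"] i s by (simp add: pro_comp_pull)
    then have "colim_class C ?X (zo s) i (g \<cdot> \<phi> i) = colim_class C ?X (zo s) s (n s)"
      using push_class[OF dX, of i "\<phi> i" "yo i" g "zo s"] i \<phi>(1)[OF i(1)] s by (simp add: induced_map_def)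
    from clD[OF x i(1) Comp_in[OF \<phi>(1)[OF i(1)] i(2)] this]
    obtain r2 where r2: "(i, r2) \<in> le" "(s, r2) \<in> le" "(g \<cdot> \<phi> i) \<cdot> xa r2 i = n s \<cdot> xa r2 s" by blast
    \<comment> \<open>\<open>r1\<close> settles the identity with \<open>m\<close> and
      \<open>r2\<close> the one with \<open>\<phi>\<close>; \<open>b\<close> lies above both,
      strictly above \<open>r\<close>, so that it differs from \<open>s\<close>.\<close>
    obtain r where r: "r \<in> T" "(r1, r) \<in> le" "(r2, r) \<in> le" using upper[of r1 r2] le_in r1 r2 by blast
    obtain b where b: "(r, b) \<in> le" "r \<noteq> b" using grow[OF r(1)] by blast
    have rb: "(r1, b) \<in> le" "(r2, b) \<in> le" using le_trans r b by blast+
    have ib: "(i, b) \<in> le" "(s, b) \<in> le" using le_trans r1 rb by blast+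
    have "s \<noteq> b" using le_trans[OF r1(2) r(2)] le_antisym[of s r] b by blast
    have \<kappa>: "g \<cdot> ya b i \<in> hom C (yo b) (zo s)" by (rule Comp_in[OF ya[OF ib(1)] i(2)])
    moreover have "k s = colim_class C ?Y (zo s) b (g \<cdot> ya b i)" using cl[OF y ib(1) i(2)] i(3) by simp
    moreover have "m s \<cdot> (g \<cdot> ya b i) = ya b s"
    proof -
      have "m s \<cdot> (g \<cdot> ya b i) = (m s \<cdot> g) \<cdot> (ya r1 i \<cdot> ya b r1)"
        using Comp_assoc[OF ya[OF ib(1)] i(2) m(1)[OF s]] ya'[OF rb(1) r1(1)] by simp
      also have "\<dots> = ((m s \<cdot> g) \<cdot> ya r1 i) \<cdot> ya b r1"
        by (rule Comp_assoc[OF ya[OF rb(1)] ya[OF r1(1)] Comp_in[OF i(2) m(1)[OF s]], symmetric])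
      also have "\<dots> = ya b s" using r1(3) Idn_Comp[OF ya[OF r1(2)]] ya'[OF rb(1) r1(2)] by simp
      finally show ?thesis .
    qed
    moreover have "(g \<cdot> ya b i) \<cdot> \<phi> b = n s \<cdot> xa b s"
    proof -
      have bT: "b \<in> T" using le_in b by blast
      have "(g \<cdot> ya b i) \<cdot> \<phi> b = g \<cdot> (\<phi> i \<cdot> xa b i)"
        using Comp_assoc[OF \<phi>(1)[OF bT] ya[OF ib(1)] i(2)] \<phi>(2)[OF ib(1)] by simp
      also have "\<dots> = (g \<cdot> \<phi> i) \<cdot> (xa r2 i \<cdot> xa b r2)"
        using Comp_assoc[OF xa[OF ib(1)] \<phi>(1)[OF i(1)] i(2)] xa'[OF rb(2) r2(1)] by simp
      also have "\<dots> = ((g \<cdot> \<phi> i) \<cdot> xa r2 i) \<cdot> xa b r2"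
        by (rule Comp_assoc[OF xa[OF rb(2)] xa[OF r2(1)] Comp_in[OF \<phi>(1)[OF i(1)] i(2)], symmetric])
      also have "\<dots> = n s \<cdot> xa b s"
        using r2(3) Comp_assoc[OF xa[OF rb(2)] xa[OF r2(2)] n(1)[OF s]] xa'[OF rb(2) r2(2)] by simp
      finally show ?thesis .
    qed
    ultimately show ?thesis
      unfolding R_def using ib \<open>s \<noteq> b\<close> by (intro exI[of _ "(b, g \<cdot> ya b i)"]) simp
  qed
  then obtain g where g: "\<And>s. s \<in> T \<Longrightarrow> R s (fst (g s)) (snd (g s))" by metis
  define \<beta> \<kappa> where "\<beta> s = fst (g s)" and "\<kappa> s = snd (g s)" for s
  have \<beta>: "\<And>s. s \<in> T \<Longrightarrow> (s, \<beta> s) \<in> le" "\<And>s. s \<in> T \<Longrightarrow> s \<noteq> \<beta> s"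
    and \<kappa>: "\<And>s. s \<in> T \<Longrightarrow> \<kappa> s \<in> hom C (yo (\<beta> s)) (zo s)" "\<And>s. s \<in> T \<Longrightarrow> k s = colim_class C ?Y (zo s) (\<beta> s) (\<kappa> s)"
    and m\<kappa>: "\<And>s. s \<in> T \<Longrightarrow> m s \<cdot> \<kappa> s = ya (\<beta> s) s" and \<kappa>\<phi>: "\<And>s. s \<in> T \<Longrightarrow> \<kappa> s \<cdot> \<phi> (\<beta> s) = n s \<cdot> xa (\<beta> s) s"
    using g unfolding R_def \<beta>_def \<kappa>_def by blast+

  \<comment> \<open>A sparser order on the same index set\<close>
  define lt where "lt s t \<longleftrightarrow> s \<in> T \<and> (\<beta> s, t) \<in> le" for s t
  \<comment> \<open>\<open>lt\<close> is irreflexive because \<open>\<beta> s\<close> lies strictly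
    above \<open>s\<close>, so the diagonal is added separately.\<close>
  define le' where "le' = {(s, t). s \<in> T \<and> t \<in> T \<and> (s = t \<or> lt s t)}"
  have lt: "s \<in> T" "t \<in> T" "(\<beta> s, t) \<in> le" "(s, t) \<in> le" "(s, t) \<in> le'" "s \<noteq> t" if "lt s t" for s t
    using that le_in le_trans[OF \<beta>(1)] \<beta> le_antisym unfolding lt_def le'_def by blast+
  have le'_le: "(s, t) \<in> le" if "(s, t) \<in> le'" for s t using that lt(4) le_refl unfolding le'_def by blast
  have lt_trans: "lt s u" if "lt s t" "lt t u" for s t u
    using lt[OF that(1)] lt[OF that(2)] le_trans unfolding lt_def by blast
  have le'E: "s = t \<and> s \<in> T \<or> lt s t" if "(s, t) \<in> le'" for s t using that unfolding le'_def by blast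
  have le'_refl: "(s, s) \<in> le'" if "s \<in> T" for s using that unfolding le'_def by blast
  have "partial_order_on T le'"
    unfolding partial_order_on_def preorder_on_def refl_on_def
  proof (intro conjI ballI)
    show "le' \<subseteq> T \<times> T" unfolding le'_def by blast
    show "trans le'"
    proof (rule transI)
      fix s t u assume "(s, t) \<in> le'" "(t, u) \<in> le'"
      then show "(s, u) \<in> le'" using le'E[of s t] le'E[of t u] lt_trans[of s t u] lt(5) by blast
    qed
    show "antisym le'" using le'_le le_antisym by (blast intro: antisymI)
  qed (rule le'_refl)
  then interpret Q: coded_poset T le' using infinite_index by unfold_locales
  have upper': "\<exists>u. lt s u \<and> lt t u" if st: "s \<in> T" "t \<in> T" for s t
    using upper[of "\<beta> s" "\<beta> t"] le_in \<beta>(1) st unfolding lt_def by blast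
  have dir: "directed (poset_cat T le')"
  proof (rule Q.directed_poset_cat[OF nonempty])
    fix s t assume "s \<in> T" "t \<in> T"
    then obtain u where "lt s u" "lt t u" using upper' by blast
    then show "\<exists>u\<in>T. (s, u) \<in> le' \<and> (t, u) \<in> le'" using lt(2,5) by blast
  qed

  \<comment> \<open>New transition maps from the idempotent\<close>
  define za1 where "za1 t s = (if t = s then Idn C (zo s) else \<kappa> s \<cdot> (ya t (\<beta> s) \<cdot> m t))" for t s
  have za1: "za1 t s = \<kappa> s \<cdot> (ya t (\<beta> s) \<cdot> m t)" if "lt s t" for s t using lt(6)[OF that] by (auto simp: za1_def)
  have h1: "ya t (\<beta> s) \<cdot> m t \<in> hom C (zo t) (yo (\<beta> s))" if "lt s t" for s t
    using Comp_in[OF m(1)[OF lt(2)[OF that]] ya[OF lt(3)[OF that]]] .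
  have za1_hom: "za1 t s \<in> hom C (zo t) (zo s)" if "(s, t) \<in> le'" for s t
    using le'E[OF that]
  proof
    assume "lt s t" then show ?thesis using Comp_in[OF h1 \<kappa>(1)] lt(1) za1 by simp
  qed (use Idn_in[OF zo] in \<open>auto simp: za1_def\<close>)
  \<comment> \<open>\<open>m\<close> stays natural for the new maps since
    \<open>m s \<cdot> \<kappa> s\<close> is a transition map of \<open>Y\<close>; their
    functoriality is reduced to this.\<close>
  have m_za1: "m s \<cdot> za1 t s = ya t s \<cdot> m t" if "(s, t) \<in> le'" for s t
    using le'E[OF that]
  proof
    assume l: "lt s t"
    have "m s \<cdot> za1 t s = ya (\<beta> s) s \<cdot> (ya t (\<beta> s) \<cdot> m t)"
      unfolding za1[OF l] by (rule comp_left_eq[OF m\<kappa>[OF lt(1)[OF l]] \<kappa>(1)[OF lt(1)[OF l]] m(1)[OF lt(1)[OF l]] h1[OF l]])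
    also have "\<dots> = ya t s \<cdot> m t"
      by (rule comp_left_eq[OF ya'[OF lt(3)[OF l] \<beta>(1)[OF lt(1)[OF l]], symmetric] ya[OF lt(3)[OF l]]
           ya[OF \<beta>(1)[OF lt(1)[OF l]]] m(1)[OF lt(2)[OF l]]])
    finally show ?thesis .
  next
    assume "s = t \<and> s \<in> T"
    then show ?thesis using Comp_Idn[OF m(1)] Idn_Comp[OF m(1)] poset_functorD(2)[OF y] by (auto simp: za1_def)
  qed
  have pz1: "poset_functor C T le' zo za1"
  proof (rule poset_functorI[OF zo _ za1_hom])
    fix s t u assume ts: "(t, s) \<in> le'" and ut: "(u, t) \<in> le'"
    consider "t = s" | "u = t" | "lt t s" "lt u t" using le'E[OF ts] le'E[OF ut] by blast
    then show "za1 s u = za1 t u \<cdot> za1 s t"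
    proof cases
      case 1 then show ?thesis using Comp_Idn[OF za1_hom[OF ut]] by (simp add: za1_def)
    next
      case 2 then show ?thesis using Idn_Comp[OF za1_hom[OF ts]] by (simp add: za1_def)
    next
      case 3
      note a1 = m(1)[OF lt(2)[OF 3(2)]] and a2 = ya[OF lt(3)[OF 3(2)]]
      have "za1 t u \<cdot> za1 s t = \<kappa> u \<cdot> ((ya t (\<beta> u) \<cdot> m t) \<cdot> za1 s t)"
        unfolding za1[OF 3(2)] by (rule Comp_assoc[OF za1_hom[OF ts] h1[OF 3(2)] \<kappa>(1)[OF lt(1)[OF 3(2)]]])
      also have "(ya t (\<beta> u) \<cdot> m t) \<cdot> za1 s t = ya t (\<beta> u) \<cdot> (ya s t \<cdot> m s)"
        using Comp_assoc[OF za1_hom[OF ts] a1 a2] m_za1[OF ts] by simp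
      also have "\<dots> = ya s (\<beta> u) \<cdot> m s"
        by (rule comp_left_eq[OF ya'[OF lt(4)[OF 3(1)] lt(3)[OF 3(2)], symmetric] ya[OF lt(4)[OF 3(1)]] a2 m(1)[OF lt(2)[OF 3(1)]]])
      finally show ?thesis using za1[OF lt_trans[OF 3(2,1)]] by simp
    qed
  qed (simp_all add: za1_def)
  have px1: "poset_functor C T le' xo xa"
    by (rule poset_functorI[OF xo poset_functorD(2)[OF x] xa xa']) (use le'_le in blast)+
  let ?X' = "poset_diagram T le' xo xa" and ?Z' = "poset_diagram T le' zo za1"
  have pX': "is_pro_obj C ?X'" and pZ': "is_pro_obj C ?Z'"
    using Q.is_diagram_poset_diagram px1 pz1 dir by (simp_all add: is_pro_obj_def)
  note dX' = pro_objD(1)[OF pX'] and dZ' = pro_objD(1)[OF pZ']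
  \<comment> \<open>Naturality of \<open>n\<close> survives because
    \<open>\<kappa> t \<cdot> \<phi> (\<beta> t)\<close> is \<open>n t\<close> after a transition
    map of \<open>X\<close>.\<close>
  have n_nat: "n t \<cdot> xa s t = za1 s t \<cdot> n s" if "(t, s) \<in> le'" for s t
    using le'E[OF that]
  proof
    assume l: "lt t s"
    have t: "t \<in> T" "s \<in> T" using lt(1,2)[OF l] .
    have bT: "\<beta> t \<in> T" using le_in(1)[OF lt(3)[OF l]] .
    have "za1 s t \<cdot> n s = \<kappa> t \<cdot> ((ya s (\<beta> t) \<cdot> m s) \<cdot> n s)"
      unfolding za1[OF l] by (rule Comp_assoc[OF n(1)[OF t(2)] h1[OF l] \<kappa>(1)[OF t(1)]])
    also have "(ya s (\<beta> t) \<cdot> m s) \<cdot> n s = \<phi> (\<beta> t) \<cdot> xa s (\<beta> t)"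
      using Comp_assoc[OF n(1)[OF t(2)] m(1)[OF t(2)] ya[OF lt(3)[OF l]]] mn[OF t(2)] \<phi>(2)[OF lt(3)[OF l]] by simp
    also have "\<kappa> t \<cdot> (\<phi> (\<beta> t) \<cdot> xa s (\<beta> t)) = (n t \<cdot> xa (\<beta> t) t) \<cdot> xa s (\<beta> t)"
      by (rule comp_left_eq[OF \<kappa>\<phi>[OF t(1)] \<phi>(1)[OF bT] \<kappa>(1)[OF t(1)] xa[OF lt(3)[OF l]]])
    also have "\<dots> = n t \<cdot> xa s t"
      using Comp_assoc[OF xa[OF lt(3)[OF l]] xa[OF \<beta>(1)[OF t(1)]] n(1)[OF t(1)]] xa'[OF lt(3)[OF l] \<beta>(1)[OF t(1)]] by simp
    finally show ?thesis ..
  next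
    assume "t = s \<and> t \<in> T"
    then show ?thesis using Comp_Idn[OF n(1)] Idn_Comp[OF n(1)] poset_functorD(2)[OF x] by (auto simp: za1_def)
  qed
  have nn: "nat_trans C ?X' ?Z' n" by (rule Q.nat_trans_poset_diagram[OF poset_transI[OF px1 pz1 n(1) n_nat]])
  note in_nn = induced_map_in[OF nn]
  \<comment> \<open>On \<open>X\<close> only the order is thinned out and every element is kept, so
    the identity on elements is cofinal.\<close>
  obtain \<iota> \<iota>' where \<iota>: "\<iota> \<in> pro_hom C ?X ?X'" "\<iota>' \<in> pro_hom C ?X' ?X"
    "pro_comp C ?X ?X \<iota>' \<iota> = pro_idn C ?X" "pro_comp C ?X' ?X' \<iota> \<iota>' = pro_idn C ?X'"
    "\<And>j. j \<in> Obj (Idx ?X') \<Longrightarrow> \<iota> j = colim_class C ?X (OMap ?X j) j (Idn C (OMap ?X j))"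
  proof (rule cofinal_iso[OF pX pX', of "\<lambda>j. j" "\<lambda>u. u"])
    fix i j f g assume j: "j \<in> Obj (Idx ?X')" and fg: "f \<in> hom (Idx ?X) j i" "g \<in> hom (Idx ?X) j i"
    then have "f = g" by (simp add: in_hom_poset_cat)
    then show "\<exists>j'. \<exists>u\<in>hom (Idx ?X') j' j. f \<cdot>\<^bsub>Idx ?X\<^esub> u = g \<cdot>\<^bsub>Idx ?X\<^esub> u"
      using le'_refl[of j] j by (intro exI[of _ j] bexI[of _ "pair_code (j, j)"]) (auto simp: Q.in_hom_poset_cat)
  next
    fix i assume "i \<in> Obj (Idx ?X)"
    then show "\<exists>j\<in>Obj (Idx ?X'). hom (Idx ?X) j i \<noteq> {}" using le_refl by (auto simp: hom_poset_cat)
  next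
    fix j j' u assume "u \<in> hom (Idx ?X') j j'"
    then show "u \<in> hom (Idx ?X) j j'" "AMap ?X' u = AMap ?X u"
      using le'_le by (auto simp: Q.in_hom_poset_cat in_hom_poset_cat)
  qed (simp_all add: that)

  \<comment> \<open>The isomorphism between \<open>Y\<close> and the new middle object\<close>
  have cl': "colim_class C ?Z' c t (f \<cdot> za1 t s) = colim_class C ?Z' c s f" if "(s, t) \<in> le'" "f \<in> hom C (zo s) c" for c s t f
    using class_restrict[OF dZ', of s f c "pair_code (t, s)" t] that le'_le[OF that(1)] le_in by (auto simp: Q.in_hom_poset_cat)
  \<comment> \<open>The components of \<open>k\<close> stay as they are: composing
    \<open>\<kappa> s\<close> with the new map to \<open>s'\<close> gives a restriction of
    \<open>\<kappa> s'\<close>, whose class is \<open>k s'\<close>.\<close>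
  have kin: "k \<in> pro_hom C ?Y ?Z'"
  proof (rule pro_homI)
    fix s s' u assume "s \<in> Obj (Idx ?Z')" "s' \<in> Obj (Idx ?Z')" "u \<in> hom (Idx ?Z') s s'"
    then have s: "s \<in> T" "s' \<in> T" and u: "(s', s) \<in> le'" "u = pair_code (s, s')" by (simp_all add: Q.in_hom_poset_cat)
    have ks: "k s \<in> colim_hom C ?Y (zo s)" using pro_homD(1)[OF k(1), of s] s by simp
    have "colim_push C ?Y (zo s') (za1 s s') (k s) = k s'"
      using le'E[OF u(1)]
    proof
      assume "s' = s \<and> s' \<in> T"
      then show ?thesis using push_Idn[OF dY ks zo[OF s(1)]] by (auto simp: za1_def)
    next
      assume l: "lt s' s"
      note b = \<beta>(1)[OF s(1)] and b' = lt(3)[OF l]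
      have bT: "\<beta> s \<in> T" using le_in b by blast
      have e: "za1 s s' \<cdot> \<kappa> s = \<kappa> s' \<cdot> ya (\<beta> s) (\<beta> s')"
      proof -
        have "za1 s s' \<cdot> \<kappa> s = \<kappa> s' \<cdot> ((ya s (\<beta> s') \<cdot> m s) \<cdot> \<kappa> s)"
          unfolding za1[OF l] by (rule Comp_assoc[OF \<kappa>(1)[OF s(1)] h1[OF l] \<kappa>(1)[OF s(2)]])
        also have "(ya s (\<beta> s') \<cdot> m s) \<cdot> \<kappa> s = ya (\<beta> s) (\<beta> s')"
          using Comp_assoc[OF \<kappa>(1)[OF s(1)] m(1)[OF s(1)] ya[OF b']] m\<kappa>[OF s(1)] ya'[OF b b'] by simp
        finally show ?thesis .
      qed
      have "colim_push C ?Y (zo s') (za1 s s') (k s) = colim_class C ?Y (zo s') (\<beta> s) (za1 s s' \<cdot> \<kappa> s)"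
        using push_class[OF dY, of "\<beta> s" "\<kappa> s" "zo s" "za1 s s'" "zo s'"] \<kappa>(1,2)[OF s(1)] za1_hom[OF u(1)] bT by simp
      also have "\<dots> = k s'"
        unfolding e using cl[OF y le_trans[OF b' b] \<kappa>(1)[OF s(2)]] \<kappa>(2)[OF s(2)] by simp
      finally show ?thesis .
    qed
    then show "colim_push C ?Y (OMap ?Z' s') (AMap ?Z' u) (k s) = k s'" using u(2) by simp
  qed (use pro_homD(1,3)[OF k(1)] in simp_all)
  define p where "p s = (if s \<in> T then colim_class C ?Z' (yo s) s (m s) else undefined)" for s
  have pin: "p \<in> pro_hom C ?Z' ?Y"
  proof (rule pro_homI)
    fix s assume "s \<in> Obj (Idx ?Y)"
    then have s: "s \<in> T" by simp
    then show "p s \<in> colim_hom C ?Z' (OMap ?Y s)" using colim_class_in[of s ?Z' "m s" "yo s"] m(1) by (simp add: p_def)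
    fix s' u assume "s' \<in> Obj (Idx ?Y)" "u \<in> hom (Idx ?Y) s s'"
    then have s': "s' \<in> T" and u: "(s', s) \<in> le" "u = pair_code (s, s')" by (simp_all add: in_hom_poset_cat)
    \<comment> \<open>With the new transition maps \<open>m\<close> is known to be natural only
      along the new order, so an arrow of the old order is checked after refinement to an
      \<open>r\<close> above both ends.\<close>
    obtain r where r: "lt s r" "lt s' r" using upper'[OF s s'] by blast
    note rT = lt(2)[OF r(1)]
    have "colim_class C ?Z' (yo s') s (ya s s' \<cdot> m s) = colim_class C ?Z' (yo s') r ((ya s s' \<cdot> m s) \<cdot> za1 r s)"
      using cl'[OF lt(5)[OF r(1)] Comp_in[OF m(1)[OF s] ya[OF u(1)]]] by simp
    also have "(ya s s' \<cdot> m s) \<cdot> za1 r s = ya s s' \<cdot> (ya r s \<cdot> m r)"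
      using Comp_assoc[OF za1_hom[OF lt(5)[OF r(1)]] m(1)[OF s] ya[OF u(1)]] m_za1[OF lt(5)[OF r(1)]] by simp
    also have "\<dots> = ya r s' \<cdot> m r"
      by (rule comp_left_eq[OF ya'[OF lt(4)[OF r(1)] u(1), symmetric] ya[OF lt(4)[OF r(1)]] ya[OF u(1)] m(1)[OF rT]])
    also have "\<dots> = m s' \<cdot> za1 r s'" using m_za1[OF lt(5)[OF r(2)]] by simp
    also have "colim_class C ?Z' (yo s') r (m s' \<cdot> za1 r s') = colim_class C ?Z' (yo s') s' (m s')"
      by (rule cl'[OF lt(5)[OF r(2)] m(1)[OF s']])
    finally show "colim_push C ?Z' (OMap ?Y s') (AMap ?Y u) (p s) = p s'"
      using push_class[OF dZ', of s "m s" "yo s" "ya s s'" "yo s'"] m(1)[OF s] ya[OF u(1)] s s' u(2) by (simp add: p_def)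
  qed (simp add: p_def)
  have pk: "pro_comp C ?Y ?Y p k = pro_idn C ?Y"
  proof (rule pro_hom_ext[OF pro_comp_in[OF dY dZ' dY kin pin] pro_idn_in[OF dY]])
    fix s assume "s \<in> Obj (Idx ?Y)"
    then have s: "s \<in> T" by simp
    have "pro_comp C ?Y ?Y p k s = colim_push C ?Y (yo s) (m s) (k s)"
      using pull_class[OF dY dZ' kin, of s "m s" "yo s"] m(1)[OF s] s by (simp add: pro_comp_pull p_def)
    also have "\<dots> = pro_idn C ?Y s"
      using fun_cong[OF k(3), of s] pull_induced[OF dY nY k(1), of s] s by simp
    finally show "pro_comp C ?Y ?Y p k s = pro_idn C ?Y s" .
  qed
  \<comment> \<open>The purpose of the construction:
    \<open>\<kappa> s \<cdot> m (\<beta> s)\<close>, which represents the idempotent, is now the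
    transition map from \<open>\<beta> s\<close> to \<open>s\<close> and hence represents the
    identity.\<close>
  have kp: "pro_comp C ?Z' ?Z' k p = pro_idn C ?Z'"
  proof (rule pro_hom_ext[OF pro_comp_in[OF dZ' dY dZ' pin kin] pro_idn_in[OF dZ']])
    fix s assume "s \<in> Obj (Idx ?Z')"
    then have s: "s \<in> T" by simp
    have bT: "\<beta> s \<in> T" using le_in \<beta>(1)[OF s] by blast
    have l: "lt s (\<beta> s)" unfolding lt_def using s le_refl[OF bT] by blast
    have "pro_comp C ?Z' ?Z' k p s = colim_push C ?Z' (zo s) (\<kappa> s) (p (\<beta> s))"
      using pull_class[OF dZ' dY pin, of "\<beta> s" "\<kappa> s" "zo s"] \<kappa>(1,2)[OF s] s bT by (simp add: pro_comp_pull)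
    also have "\<dots> = colim_class C ?Z' (zo s) (\<beta> s) (\<kappa> s \<cdot> m (\<beta> s))"
      using push_class[OF dZ', of "\<beta> s" "m (\<beta> s)" "yo (\<beta> s)" "\<kappa> s" "zo s"] m(1)[OF bT] \<kappa>(1)[OF s] bT by (simp add: p_def)
    also have "\<kappa> s \<cdot> m (\<beta> s) = Idn C (zo s) \<cdot> za1 (\<beta> s) s"
      using Idn_Comp[OF za1_hom[OF lt(5)[OF l]]] za1[OF l] poset_functorD(2)[OF y bT] Idn_Comp[OF m(1)[OF bT]] by simp
    also have "colim_class C ?Z' (zo s) (\<beta> s) (Idn C (zo s) \<cdot> za1 (\<beta> s) s) = pro_idn C ?Z' s"
      using cl'[OF lt(5)[OF l] Idn_in[OF zo[OF s]]] s by (simp add: pro_idn_def)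
    finally show "pro_comp C ?Z' ?Z' k p s = pro_idn C ?Z' s" .
  qed
  have "pro_comp C ?X ?Z' k (induced_map C ?X ?Y \<phi>) = pro_comp C ?X ?Z' (induced_map C ?X' ?Z' n) \<iota>"
  proof (rule pro_hom_ext[OF pro_comp_in[OF dX dY dZ' in_f kin] pro_comp_in[OF dX dX' dZ' \<iota>(1) in_nn]])
    fix s assume "s \<in> Obj (Idx ?Z')"
    then have s: "s \<in> T" by simp
    have "pro_comp C ?X ?Z' k (induced_map C ?X ?Y \<phi>) s = pro_comp C ?X ?Z k (induced_map C ?X ?Y \<phi>) s"
      using s by (simp add: pro_comp_pull)
    also have "\<dots> = colim_class C ?X (zo s) s (n s)" unfolding k(2) using s by (simp add: induced_map_def)
    also have "\<dots> = pro_comp C ?X ?Z' (induced_map C ?X' ?Z' n) \<iota> s"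
      using pull_induced[OF dX nn \<iota>(1), of s] \<iota>(5)[of s] s
        push_class[OF dX, of s "Idn C (xo s)" "xo s" "n s" "zo s"] Idn_in[OF xo[OF s]] n(1)[OF s] Comp_Idn[OF n(1)[OF s]] by simp
    finally show "pro_comp C ?X ?Z' k (induced_map C ?X ?Y \<phi>) s = pro_comp C ?X ?Z' (induced_map C ?X' ?Z' n) \<iota> s" .
  qed
  then have sq: "(?Y, ?Z', k) \<cdot>\<^bsub>Pro C\<^esub> pro_induced C ?X ?Y \<phi> = pro_induced C ?X' ?Z' n \<cdot>\<^bsub>Pro C\<^esub> (?X, ?X', \<iota>)"
    by (simp add: pro_induced_eq)
  have f: "pro_induced C ?X ?Y \<phi> \<in> hom (Pro C) ?X ?Y" and g: "pro_induced C ?X' ?Z' n \<in> hom (Pro C) ?X' ?Z'"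
    using pro_induced_hom[OF nf] pro_induced_hom[OF nn] directed_index dir by simp_all
  have "isomorphic (arrow_cat (Pro C)) (pro_induced C ?X ?Y \<phi>) (pro_induced C ?X' ?Z' n)"
    by (rule P.arrow_isoI[OF f g _ _ _ _ sq, of "(?X', ?X, \<iota>')" "(?Z', ?Y, p)"])
       (use pX pY pX' pZ' \<iota> kin pin kp pk in \<open>simp_all add: hom_Pro\<close>)
  moreover have "levelwise C N ?X' ?Z' n" unfolding levelwise_def using nn nN by simp
  ultimately show ?thesis
    unfolding Lw_def using f dir by (intro P.iso_closureI[of _ "pro_induced C ?X' ?Z' n"]) (auto simp: hom_def intro!: exI)
qed

text \<open>The lifting property of \<open>f\<close> against its own second factor is exactly the
  input of \<open>levelwise_of_lift\<close>; isomorphisms carry it from \<open>f\<close> to the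
  levelwise form and carry the conclusion back.\<close>

lemma left_orth_subset_Lw:
  assumes lim: "has_finite_limits C" and fac: "all_factor C M N" and M: "M \<subseteq> Arr C" and N: "N \<subseteq> Arr C"
  shows "left_orth (Pro C :: ('i, 'o, 'a) pro_cat) (Sp C M) \<subseteq> Lw C N"
proof
  interpret P: category "Pro C :: ('i, 'o, 'a) pro_cat" by (rule category_Pro)
  fix f :: "('i, 'o, 'a) pro_arr" assume f: "f \<in> left_orth (Pro C) (Sp C M)"
  then have fA: "f \<in> Arr (Pro C)" by (simp add: left_orth_def)
  obtain xo xa yo ya zo za n m \<phi> where n: "poset_trans C T le xo xa zo za n" "\<And>s. s \<in> T \<Longrightarrow> n s \<in> N"
    and m: "poset_trans C T le zo za yo ya m"
    and \<phi>: "poset_trans C T le xo xa yo ya \<phi>" and mn: "\<And>s. s \<in> T \<Longrightarrow> m s \<cdot> n s = \<phi> s"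
    and sp: "special C M (poset_diagram T le zo za) (poset_diagram T le yo ya) m"
    and iso: "isomorphic (arrow_cat (Pro C)) f (pro_induced C (poset_diagram T le xo xa) (poset_diagram T le yo ya) \<phi>)"
    by (rule levelwise_factorization[OF lim fac M N fA], rule that; assumption?)
  let ?X = "poset_diagram T le xo xa" and ?Y = "poset_diagram T le yo ya" and ?Z = "poset_diagram T le zo za"
  have nf: "nat_trans C ?X ?Y \<phi>" by (rule nat_trans_poset_diagram[OF \<phi>])
  have gA: "pro_induced C ?X ?Y \<phi> \<in> Arr (Pro C)"
    using pro_induced_hom[OF nf] directed_index by (simp add: hom_def)
  have pS: "pro_induced C ?Z ?Y m \<in> Sp C M" by (rule pro_induced_Sp[OF sp]) (simp add: directed_index)
  have lift: "lifts (Pro C) (pro_induced C ?X ?Y \<phi>) (pro_induced C ?Z ?Y m)"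
  proof (rule P.lifts_retract_left[OF gA fA])
    show "retract_of (arrow_cat (Pro C)) (pro_induced C ?X ?Y \<phi>) f"
      by (rule category.isomorphic_imp_retract[OF P.category_arrow_cat P.arrow_iso_sym[OF iso]])
    show "lifts (Pro C) f (pro_induced C ?Z ?Y m)" using f pS by (simp add: left_orth_def)
  qed (use pS Sp_Arr in blast)
  have "pro_induced C ?X ?Y \<phi> \<in> Lw C N" by (rule levelwise_of_lift[OF n m \<phi> mn lift])
  then show "f \<in> Lw C N"
    unfolding Lw_def iso_closure_def using fA P.arrow_iso_trans[OF iso] by blast
qed

text \<open>The right class is determined by the retract argument in one direction and by the
  description of the left class in the other; the left class itself is squeezed between the two
  inclusions proved before.\<close>

lemma weak_factorization_system_Pro:
  assumes lim: "has_finite_limits C" and fac: "all_factor C M N" and M: "M \<subseteq> Arr C" and N: "N \<subseteq> Arr C"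
    and o: "orth C N M"
  shows "weak_factorization_system (Pro C :: ('i, 'o, 'a) pro_cat) (Lw C N) (retracts (Pro C) (Sp C M))"
  unfolding weak_factorization_system_def
proof (intro conjI)
  interpret P: category "Pro C :: ('i, 'o, 'a) pro_cat" by (rule category_Pro)
  note fP = all_factor_Pro[OF lim fac M N]
  show "all_factor (Pro C) (retracts (Pro C) (Sp C M)) (Lw C N :: ('i, 'o, 'a) pro_arr set)"
    using fP P.retracts_incl[OF Sp_Arr] unfolding all_factor_def by blast
  show L: "(Lw C N :: ('i, 'o, 'a) pro_arr set) = left_orth (Pro C) (retracts (Pro C) (Sp C M))"
    unfolding P.left_orth_retracts[OF Sp_Arr]
    using left_orth_subset_Lw[OF lim fac M N] Lw_subset_left_orth[OF lim M o] left_orth_Sp[OF lim M] by blast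
  show "right_orth (Pro C) (Lw C N :: ('i, 'o, 'a) pro_arr set) = retracts (Pro C) (Sp C M)"
  proof
    show "right_orth (Pro C) (Lw C N :: ('i, 'o, 'a) pro_arr set) \<subseteq> retracts (Pro C) (Sp C M)"
      by (rule P.right_orth_subset_retracts[OF fP Lw_Arr Sp_Arr])
    show "retracts (Pro C) (Sp C M) \<subseteq> right_orth (Pro C) (Lw C N :: ('i, 'o, 'a) pro_arr set)"
    proof
      fix p assume p: "p \<in> retracts (Pro C :: ('i, 'o, 'a) pro_cat) (Sp C M)"
      then have "lifts (Pro C) i p" if "i \<in> Lw C N" for i
        using that[unfolded L] unfolding left_orth_def by blast
      moreover have "p \<in> Arr (Pro C)" using p by (simp add: retracts_def)
      ultimately show "p \<in> right_orth (Pro C) (Lw C N)" by (simp add: right_orth_def)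
    qed
  qed
qed

end

theorem proposition1p1:
  fixes C :: "('o, 'a) cat" and N M :: "'a set"
    and P :: "('i, 'o, 'a) pro_cat"
  assumes "infinite (UNIV :: 'i set)"
    and "category C" and "has_finite_limits C"
    and "N \<subseteq> Arr C" and "M \<subseteq> Arr C"
    and "P = Pro C"
  shows "(left_orth P (retracts P (Sp C M)) = left_orth P (Sp C M)
           \<and> left_orth P (Sp C M) = left_orth P (simple_arr C ` M))
         \<and> (all_factor C M N \<longrightarrow> all_factor P (Sp C M) (Lw C N))
         \<and> (all_factor C M N \<and> orth C N M \<longrightarrow>
             weak_factorization_system P (Lw C N) (retracts P (Sp C M)))
         \<and> (weak_factorization_system C N M \<longrightarrow>
             weak_factorization_system P (Lw C N) (retracts P (Sp C M)))"
proof -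
  interpret category C by fact
  \<comment> \<open>The conclusion does not mention the poset; infinitude of the index type
    guarantees that one exists.\<close>
  obtain T :: "'i set" and le lab where "index_poset T le lab"
    using index_poset_exists[OF assms(1)] .
  then interpret indexed_category C T le lab
    using assms(2) by (simp add: indexed_category_def)
  interpret P: category P unfolding assms(6) by (rule category_Pro)
  have "weak_factorization_system C N M \<Longrightarrow> orth C N M"
    unfolding weak_factorization_system_def orth_def left_orth_def by blast
  moreover have "weak_factorization_system C N M \<Longrightarrow> all_factor C M N"
    unfolding weak_factorization_system_def by blast
  ultimately show ?thesis
    using P.left_orth_retracts[of "Sp C M"] Sp_Arr left_orth_Sp[OF assms(3,5)] all_factor_Pro[OF assms(3) _ assms(5,4)]
      weak_factorization_system_Pro[OF assms(3) _ assms(5,4)] unfolding assms(6) by blast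
qed

end
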